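(* Let $R$ be a commutative ring with unity, $p$ a prime and $G$ a finite $p$-group. Let $\mathcal{D}_G^c$ be the orbit category of sections over the collection $\{(C_G(E),E) : E\ne1\text{ an elementary abelian }p\text{-subgroup of }G\}$, and let $j_*:\mathcal{D}_G^c\to\mathcal{D}_G^*$ be the functor induced by inclusion. Then for any $R\mathcal{D}_G$-module $F$ there is an isomorphism $$\widetilde{H}^*(\mathcal{D}_G^*;F)\cong\widetilde{H}^*(\mathcal{D}_G^c;F\circ j_* ).$$
   Context: A section of $G$ is a pair $(U,V)$ with $V\trianglelefteq U\le G$; $(U,V)\preceq(M,L)$ means $L\le V\le U\le M$. For a conjugation-closed set (collection) $\mathcal{C}$ of sections, $\mathcal{D}_G^{\mathcal{C}}$ has objects $\mathcal{C}$, morphisms $\mathrm{Hom}((U,V),(M,L))=\{Mg:g\in G,\ {}^g(U,V)\preceq(M,L)\}$, composition $Nh\circ Mg=Nhg$; $\mathcal{D}_G$ uses all sections and $\mathcal{D}_G^*$ uses the sections $(U,V)$ with $V\ne1$. An $R\mathcal{D}_G^{\mathcal{C}}$-module is a contravariant functor to $R$-modules; an $R\mathcal{D}_G$-module restricts to $\mathcal{D}_G^{\mathcal{C}}$. $F(G):=F((G,1))$, $F(U/V):=F((U,V))$. Reduced cohomology: $\widetilde{H}^n(\mathcal{D}_G^{\mathcal{C}};F)=\mathrm{Ext}^n_{R\mathcal{D}_G^{\mathcal{C}}}(\underline{R},F)$ for $n\ge1$ ($\underline{R}$ constant functor); $\widetilde{H}^{-1}$ and $\widetilde{H}^0$ are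 the kernel and cokernel of the map $F(G)\to\varprojlim_{(U,V)\in\mathcal{D}_G^{\mathcal{C}}}F(U/V)$ whose components are induced by the morphisms $G\cdot1:(U,V)\to(G,1)$ of $\mathcal{D}_G$. *)

theory Defs
  imports
    "HOL-Algebra.Module"
    "HOL-Algebra.AbelCoset"
    "HOL-Library.FuncSet"
    "HOL-Computational_Algebra.Primes"
begin

section \<open>Modules over a commutative ring\<close>

text \<open>
  The multiplication and unit fields of a \<^typ>\<open>('r, 'm) module\<close> record play no role in the
  library locale \<^locale>\<open>module\<close>; they are left undefined where a module is built below.
\<close>

definition mod_hom ::
  "('r, 's) ring_scheme \<Rightarrow> ('r, 'm) module \<Rightarrow> ('r, 'n) module \<Rightarrow> ('m \<Rightarrow> 'n) set"
  where "mod_hom R M N =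
    {f \<in> carrier M \<rightarrow> carrier N.
       (\<forall>u\<in>carrier M. \<forall>v\<in>carrier M. f (u \<oplus>\<^bsub>M\<^esub> v) = f u \<oplus>\<^bsub>N\<^esub> f v) \<and>
       (\<forall>r\<in>carrier R. \<forall>u\<in>carrier M. f (r \<odot>\<^bsub>M\<^esub> u) = r \<odot>\<^bsub>N\<^esub> f u)}"

definition mod_iso ::
  "('r, 's) ring_scheme \<Rightarrow> ('r, 'm) module \<Rightarrow> ('r, 'n) module \<Rightarrow> bool"
  where "mod_iso R M N \<longleftrightarrow> (\<exists>f \<in> mod_hom R M N. bij_betw f (carrier M) (carrier N))"

definition mod_restrict :: "('r, 'm) module \<Rightarrow> 'm set \<Rightarrow> ('r, 'm) module"
  where "mod_restrict M N = M\<lparr>carrier := N\<rparr>"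

definition mod_kernel ::
  "('r, 'm) module \<Rightarrow> ('r, 'n) module \<Rightarrow> ('m \<Rightarrow> 'n) \<Rightarrow> 'm set"
  where "mod_kernel M N f = {u \<in> carrier M. f u = \<zero>\<^bsub>N\<^esub>}"

text \<open>The quotient of \<open>M\<close> by a submodule with carrier \<open>N\<close>.\<close>

definition mod_quotient :: "('r, 'm) module \<Rightarrow> 'm set \<Rightarrow> ('r, 'm set) module"
  where "mod_quotient M N =
    \<lparr>carrier = a_rcosets\<^bsub>M\<^esub> N, monoid.mult = undefined, one = undefined,
     zero = N, add = (\<lambda>X Y. X <+>\<^bsub>M\<^esub> Y),
     smult = (\<lambda>r X. \<Union>u\<in>X. N +>\<^bsub>M\<^esub> (r \<odot>\<^bsub>M\<^esub> u))\<rparr>"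

definition regular_module :: "('r, 's) ring_scheme \<Rightarrow> ('r, 'r) module"
  where "regular_module R =
    \<lparr>carrier = carrier R, monoid.mult = monoid.mult R, one = one R, zero = zero R, add = add R,
     smult = monoid.mult R\<rparr>"


section \<open>Modules over a category\<close>

text \<open>
  An arrow need not determine its source and target; they are the explicit arguments of \<open>Hom\<close>.
  \<open>Cmp C b a\<close> is the composite of \<open>b\<close> after \<open>a\<close>.
\<close>

record ('o, 'a) cat =
  Obj :: "'o set"
  Hom :: "'o \<Rightarrow> 'o \<Rightarrow> 'a set"
  Cmp :: "'a \<Rightarrow> 'a \<Rightarrow> 'a"
  Idn :: "'o \<Rightarrow> 'a"

text \<open>
  The data of a contravariant functor to modules: \<open>res F x y a\<close> is the map \<open>F(y) \<rightarrow> F(x)\<close>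
  induced by an arrow \<open>a\<close> from \<open>x\<close> to \<open>y\<close>.  Nothing is required outside the objects and
  arrows of the category at hand, so the restriction of a functor to a full subcategory is
  given by the same record.
\<close>

record ('o, 'a, 'r, 'm) cfunctor =
  val :: "'o \<Rightarrow> ('r, 'm) module"
  res :: "'o \<Rightarrow> 'o \<Rightarrow> 'a \<Rightarrow> 'm \<Rightarrow> 'm"

definition cat_module ::
  "('o, 'a) cat \<Rightarrow> ('r, 's) ring_scheme \<Rightarrow> ('o, 'a, 'r, 'm) cfunctor \<Rightarrow> bool"
  where "cat_module C R F \<longleftrightarrow>
    (\<forall>x\<in>Obj C. module R (val F x)) \<and>
    (\<forall>x\<in>Obj C. \<forall>y\<in>Obj C. \<forall>a\<in>Hom C x y. res F x y a \<in> mod_hom R (val F y) (val F x)) \<and>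
    (\<forall>x\<in>Obj C. \<forall>u\<in>carrier (val F x). res F x x (Idn C x) u = u) \<and>
    (\<forall>x\<in>Obj C. \<forall>y\<in>Obj C. \<forall>z\<in>Obj C. \<forall>a\<in>Hom C x y. \<forall>b\<in>Hom C y z. \<forall>u\<in>carrier (val F z).
       res F x z (Cmp C b a) u = res F x y a (res F y z b u))"

text \<open>Extensionality makes a natural transformation unique as a HOL function.\<close>

definition nat_trans ::
  "('o, 'a) cat \<Rightarrow> ('r, 's) ring_scheme \<Rightarrow> ('o, 'a, 'r, 'm) cfunctor \<Rightarrow> ('o, 'a, 'r, 'n) cfunctor
    \<Rightarrow> ('o \<Rightarrow> 'm \<Rightarrow> 'n) set"
  where "nat_trans C R M N =
    {\<eta> \<in> extensional (Obj C).
       (\<forall>x\<in>Obj C. \<eta> x \<in> mod_hom R (val M x) (val N x) \<inter> extensional (carrier (val M x))) \<and>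
       (\<forall>x\<in>Obj C. \<forall>y\<in>Obj C. \<forall>a\<in>Hom C x y. \<forall>u\<in>carrier (val M y).
          \<eta> x (res M x y a u) = res N x y a (\<eta> y u))}"

definition nat_trans_module ::
  "('o, 'a) cat \<Rightarrow> ('r, 's) ring_scheme \<Rightarrow> ('o, 'a, 'r, 'm) cfunctor \<Rightarrow> ('o, 'a, 'r, 'n) cfunctor
    \<Rightarrow> ('r, 'o \<Rightarrow> 'm \<Rightarrow> 'n) module"
  where "nat_trans_module C R M N =
    \<lparr>carrier = nat_trans C R M N, monoid.mult = undefined, one = undefined,
     zero = (\<lambda>x\<in>Obj C. \<lambda>u\<in>carrier (val M x). \<zero>\<^bsub>val N x\<^esub>),
     add = (\<lambda>\<eta> \<theta>. \<lambda>x\<in>Obj C. \<lambda>u\<in>carrier (val M x). \<eta> x u \<oplus>\<^bsub>val N x\<^esub> \<theta> x u),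
     smult = (\<lambda>r \<eta>. \<lambda>x\<in>Obj C. \<lambda>u\<in>carrier (val M x). r \<odot>\<^bsub>val N x\<^esub> \<eta> x u)\<rparr>"

definition const_functor :: "('r, 's) ring_scheme \<Rightarrow> ('o, 'a, 'r, 'r) cfunctor"
  where "const_functor R = \<lparr>val = (\<lambda>_. regular_module R), res = (\<lambda>_ _ _ u. u)\<rparr>"

definition cat_lim ::
  "('o, 'a) cat \<Rightarrow> ('o, 'a, 'r, 'm) cfunctor \<Rightarrow> ('r, 'o \<Rightarrow> 'm) module"
  where "cat_lim C F =
    \<lparr>carrier = {s \<in> (\<Pi>\<^sub>E x\<in>Obj C. carrier (val F x)).
        \<forall>x\<in>Obj C. \<forall>y\<in>Obj C. \<forall>a\<in>Hom C x y. res F x y a (s y) = s x},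
     monoid.mult = undefined, one = undefined,
     zero = (\<lambda>x\<in>Obj C. \<zero>\<^bsub>val F x\<^esub>),
     add = (\<lambda>s t. \<lambda>x\<in>Obj C. s x \<oplus>\<^bsub>val F x\<^esub> t x),
     smult = (\<lambda>r s. \<lambda>x\<in>Obj C. r \<odot>\<^bsub>val F x\<^esub> s x)\<rparr>"


section \<open>Projective resolutions and Ext\<close>

definition nat_epi ::
  "('o, 'a) cat \<Rightarrow> ('r, 's) ring_scheme \<Rightarrow> ('o, 'a, 'r, 'm) cfunctor \<Rightarrow> ('o, 'a, 'r, 'n) cfunctor
    \<Rightarrow> ('o \<Rightarrow> 'm \<Rightarrow> 'n) \<Rightarrow> bool"
  where "nat_epi C R M N e \<longleftrightarrow> e \<in> nat_trans C R M N \<and>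
    (\<forall>x\<in>Obj C. e x ` carrier (val M x) = carrier (val N x))"

text \<open>
  Projectivity as the lifting property against epimorphisms \<open>B \<rightarrow> N\<close>.  HOL cannot quantify over
  the types in which \<open>B\<close> and \<open>N\<close> take their values, so these are fixed: \<open>N\<close> lives in the type
  \<^typ>\<open>'p\<close> of \<open>P\<close> itself, and \<open>B\<close> in a type that has room for the free module with a generator
  for each arrow \<open>x \<rightarrow> y\<close> and each element of \<open>P(y)\<close>.  Nothing is lost: for \<open>N = P\<close> the lifting
  property splits the canonical epimorphism from this free module onto \<open>P\<close>, whence \<open>P\<close> lifts
  against epimorphisms between modules in arbitrary types.
\<close>

definition cat_projective ::
  "('o, 'a) cat \<Rightarrow> ('r, 's) ring_scheme \<Rightarrow> ('o, 'a, 'r, 'p) cfunctor \<Rightarrow> bool"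
  where "cat_projective C R P \<longleftrightarrow> cat_module C R P \<and>
    (\<forall>(B :: ('o, 'a, 'r, 'o \<times> 'a \<times> 'p \<Rightarrow> 'r) cfunctor) (N :: ('o, 'a, 'r, 'p) cfunctor) e f.
       cat_module C R B \<longrightarrow> cat_module C R N \<longrightarrow> nat_epi C R B N e \<longrightarrow> f \<in> nat_trans C R P N \<longrightarrow>
       (\<exists>g \<in> nat_trans C R P B. \<forall>x\<in>Obj C. \<forall>u\<in>carrier (val P x). e x (g x u) = f x u))"

text \<open>\<open>\<cdots> \<rightarrow> P 2 \<rightarrow> P 1 \<rightarrow> P 0 \<rightarrow> M \<rightarrow> 0\<close> with \<open>d n : P (n + 1) \<rightarrow> P n\<close> and \<open>\<epsilon> : P 0 \<rightarrow> M\<close>.\<close>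

definition projective_resolution ::
  "('o, 'a) cat \<Rightarrow> ('r, 's) ring_scheme \<Rightarrow> ('o, 'a, 'r, 'm) cfunctor
    \<Rightarrow> (nat \<Rightarrow> ('o, 'a, 'r, 'p) cfunctor) \<Rightarrow> (nat \<Rightarrow> 'o \<Rightarrow> 'p \<Rightarrow> 'p) \<Rightarrow> ('o \<Rightarrow> 'p \<Rightarrow> 'm) \<Rightarrow> bool"
  where "projective_resolution C R M P d \<epsilon> \<longleftrightarrow>
    (\<forall>n. cat_projective C R (P n)) \<and>
    (\<forall>n. d n \<in> nat_trans C R (P (Suc n)) (P n)) \<and>
    nat_epi C R (P 0) M \<epsilon> \<and>
    (\<forall>x\<in>Obj C. d 0 x ` carrier (val (P 1) x) = mod_kernel (val (P 0) x) (val M x) (\<epsilon> x)) \<and>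
    (\<forall>n. \<forall>x\<in>Obj C. d (Suc n) x ` carrier (val (P (Suc (Suc n))) x) =
       mod_kernel (val (P (Suc n)) x) (val (P n) x) (d n x))"

definition coboundary ::
  "('o, 'a) cat \<Rightarrow> (nat \<Rightarrow> ('o, 'a, 'r, 'p) cfunctor) \<Rightarrow> (nat \<Rightarrow> 'o \<Rightarrow> 'p \<Rightarrow> 'p)
    \<Rightarrow> nat \<Rightarrow> ('o \<Rightarrow> 'p \<Rightarrow> 'm) \<Rightarrow> ('o \<Rightarrow> 'p \<Rightarrow> 'm)"
  where "coboundary C P d n \<phi> =
    (\<lambda>x\<in>Obj C. \<lambda>u\<in>carrier (val (P (Suc n)) x). \<phi> x (d n x u))"

definition Hom_cocycles ::
  "('o, 'a) cat \<Rightarrow> ('r, 's) ring_scheme \<Rightarrow> (nat \<Rightarrow> ('o, 'a, 'r, 'p) cfunctor)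
    \<Rightarrow> (nat \<Rightarrow> 'o \<Rightarrow> 'p \<Rightarrow> 'p) \<Rightarrow> ('o, 'a, 'r, 'm) cfunctor \<Rightarrow> nat \<Rightarrow> ('o \<Rightarrow> 'p \<Rightarrow> 'm) set"
  where "Hom_cocycles C R P d F n =
    mod_kernel (nat_trans_module C R (P n) F) (nat_trans_module C R (P (Suc n)) F)
      (coboundary C P d n)"

definition Hom_coboundaries ::
  "('o, 'a) cat \<Rightarrow> ('r, 's) ring_scheme \<Rightarrow> (nat \<Rightarrow> ('o, 'a, 'r, 'p) cfunctor)
    \<Rightarrow> (nat \<Rightarrow> 'o \<Rightarrow> 'p \<Rightarrow> 'p) \<Rightarrow> ('o, 'a, 'r, 'm) cfunctor \<Rightarrow> nat \<Rightarrow> ('o \<Rightarrow> 'p \<Rightarrow> 'm) set"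
  where "Hom_coboundaries C R P d F n =
    (case n of 0 \<Rightarrow> {\<zero>\<^bsub>nat_trans_module C R (P 0) F\<^esub>}
     | Suc k \<Rightarrow> coboundary C P d k ` nat_trans C R (P k) F)"

definition Hom_cohomology ::
  "('o, 'a) cat \<Rightarrow> ('r, 's) ring_scheme \<Rightarrow> (nat \<Rightarrow> ('o, 'a, 'r, 'p) cfunctor)
    \<Rightarrow> (nat \<Rightarrow> 'o \<Rightarrow> 'p \<Rightarrow> 'p) \<Rightarrow> ('o, 'a, 'r, 'm) cfunctor \<Rightarrow> nat
    \<Rightarrow> ('r, ('o \<Rightarrow> 'p \<Rightarrow> 'm) set) module"
  where "Hom_cohomology C R P d F n =
    mod_quotient
      (mod_restrict (nat_trans_module C R (P n) F) (Hom_cocycles C R P d F n))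
      (Hom_coboundaries C R P d F n)"

text \<open>
  Ext is computed from a chosen projective resolution of the first argument \<open>M\<close> with values in
  the type of functions \<^typ>\<open>('o \<times> 'a) list \<Rightarrow> 'r\<close>.  For \<open>M = const_functor R\<close>, the only case
  used below, such a resolution always exists, namely the bar resolution: in degree \<open>n\<close> and at
  the object \<open>x\<close> it is free on the chains of arrows \<open>x \<rightarrow> x0 \<rightarrow> x1 \<rightarrow> \<cdots> \<rightarrow> xn\<close>, which are lists
  of pairs consisting of a target and an arrow.
\<close>

definition chosen_resolution ::
  "('o, 'a) cat \<Rightarrow> ('r, 's) ring_scheme \<Rightarrow> ('o, 'a, 'r, 'm) cfunctor
    \<Rightarrow> (nat \<Rightarrow> ('o, 'a, 'r, ('o \<times> 'a) list \<Rightarrow> 'r) cfunctor) \<times>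
      (nat \<Rightarrow> 'o \<Rightarrow> (('o \<times> 'a) list \<Rightarrow> 'r) \<Rightarrow> (('o \<times> 'a) list \<Rightarrow> 'r)) \<times>
      ('o \<Rightarrow> (('o \<times> 'a) list \<Rightarrow> 'r) \<Rightarrow> 'm)"
  where "chosen_resolution C R M =
    (SOME (P, d, \<epsilon>). projective_resolution C R M P d \<epsilon>)"

definition Ext ::
  "('o, 'a) cat \<Rightarrow> ('r, 's) ring_scheme \<Rightarrow> nat \<Rightarrow> ('o, 'a, 'r, 'm) cfunctor
    \<Rightarrow> ('o, 'a, 'r, 'n) cfunctor \<Rightarrow> ('r, ('o \<Rightarrow> (('o \<times> 'a) list \<Rightarrow> 'r) \<Rightarrow> 'n) set) module"
  where "Ext C R n M F =
    (case chosen_resolution C R M of (P, d, \<epsilon>) \<Rightarrow> Hom_cohomology C R P d F n)"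


section \<open>Orbit categories of sections\<close>

type_synonym 'g section_pair = "'g set \<times> 'g set"

definition sections :: "('g, 'h) monoid_scheme \<Rightarrow> 'g section_pair set"
  where "sections G = {(U, V). subgroup U G \<and> subgroup V G \<and> V \<lhd> (G\<lparr>carrier := U\<rparr>)}"

text \<open>\<open>conj_set G g X\<close> is \<open>g X g\<^sup>-\<^sup>1\<close>.\<close>

definition conj_set :: "('g, 'h) monoid_scheme \<Rightarrow> 'g \<Rightarrow> 'g set \<Rightarrow> 'g set"
  where "conj_set G g X = (g <#\<^bsub>G\<^esub> X) #>\<^bsub>G\<^esub> (inv\<^bsub>G\<^esub> g)"

definition conj_section ::
  "('g, 'h) monoid_scheme \<Rightarrow> 'g \<Rightarrow> 'g section_pair \<Rightarrow> 'g section_pair"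
  where "conj_section G g s = (conj_set G g (fst s), conj_set G g (snd s))"

definition section_le :: "'g section_pair \<Rightarrow> 'g section_pair \<Rightarrow> bool"  (infix \<open>\<preceq>\<close> 50)
  where "s \<preceq> t \<longleftrightarrow> snd t \<subseteq> snd s \<and> snd s \<subseteq> fst s \<and> fst s \<subseteq> fst t"

text \<open>
  If \<open>M g\<close> is an arrow to \<open>(M, L)\<close> and \<open>N h\<close> an arrow from \<open>(M, L)\<close> to \<open>(N, K)\<close>, then
  \<open>h M h\<^sup>-\<^sup>1 \<subseteq> N\<close>, so the product of the sets \<open>N h\<close> and \<open>M g\<close> is the coset \<open>N h g\<close>.
\<close>

definition section_orbit_cat ::
  "('g, 'h) monoid_scheme \<Rightarrow> 'g section_pair set \<Rightarrow> ('g section_pair, 'g set) cat"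
  where "section_orbit_cat G \<C> =
    \<lparr>Obj = \<C>,
     Hom = (\<lambda>s t. {fst t #>\<^bsub>G\<^esub> g | g. g \<in> carrier G \<and> conj_section G g s \<preceq> t}),
     Cmp = (\<lambda>Y X. Y <#>\<^bsub>G\<^esub> X),
     Idn = (\<lambda>s. fst s #>\<^bsub>G\<^esub> \<one>\<^bsub>G\<^esub>)\<rparr>"

definition nontrivial_sections :: "('g, 'h) monoid_scheme \<Rightarrow> 'g section_pair set"
  where "nontrivial_sections G = {(U, V) \<in> sections G. V \<noteq> {\<one>\<^bsub>G\<^esub>}}"

definition elementary_abelian_subgroup ::
  "nat \<Rightarrow> ('g, 'h) monoid_scheme \<Rightarrow> 'g set \<Rightarrow> bool"
  where "elementary_abelian_subgroup p G E \<longleftrightarrow> subgroup E G \<and>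
    (\<forall>x\<in>E. \<forall>y\<in>E. x \<otimes>\<^bsub>G\<^esub> y = y \<otimes>\<^bsub>G\<^esub> x) \<and> (\<forall>x\<in>E. x [^]\<^bsub>G\<^esub> p = \<one>\<^bsub>G\<^esub>)"

definition centralizer :: "('g, 'h) monoid_scheme \<Rightarrow> 'g set \<Rightarrow> 'g set"
  where "centralizer G E = {g \<in> carrier G. \<forall>x\<in>E. g \<otimes>\<^bsub>G\<^esub> x = x \<otimes>\<^bsub>G\<^esub> g}"

definition centralizer_sections ::
  "nat \<Rightarrow> ('g, 'h) monoid_scheme \<Rightarrow> 'g section_pair set"
  where "centralizer_sections p G =
    {(centralizer G E, E) | E. elementary_abelian_subgroup p G E \<and> E \<noteq> {\<one>\<^bsub>G\<^esub>}}"


section \<open>Reduced cohomology\<close>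

text \<open>
  In the following, \<open>F\<close> is a module over the orbit category of all sections of \<open>G\<close>, and \<open>\<C>\<close> is a
  collection of sections.  The cohomology is that of the restriction of \<open>F\<close> to the full
  subcategory on \<open>\<C>\<close>, augmented by the value of \<open>F\<close> at \<open>(G, 1)\<close>.
\<close>

definition top_section :: "('g, 'h) monoid_scheme \<Rightarrow> 'g section_pair"
  where "top_section G = (carrier G, {\<one>\<^bsub>G\<^esub>})"

definition augmentation ::
  "('g, 'h) monoid_scheme \<Rightarrow> 'g section_pair set \<Rightarrow> ('g section_pair, 'g set, 'r, 'm) cfunctor
    \<Rightarrow> 'm \<Rightarrow> ('g section_pair \<Rightarrow> 'm)"
  where "augmentation G \<C> F u =
    (\<lambda>s\<in>\<C>. res F s (top_section G) (carrier G #>\<^bsub>G\<^esub> \<one>\<^bsub>G\<^esub>) u)"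

definition reduced_cohomology_minus1 ::
  "('g, 'h) monoid_scheme \<Rightarrow> 'g section_pair set \<Rightarrow> ('g section_pair, 'g set, 'r, 'm) cfunctor
    \<Rightarrow> ('r, 'm) module"
  where "reduced_cohomology_minus1 G \<C> F =
    mod_restrict (val F (top_section G))
      (mod_kernel (val F (top_section G)) (cat_lim (section_orbit_cat G \<C>) F)
        (augmentation G \<C> F))"

definition reduced_cohomology_0 ::
  "('g, 'h) monoid_scheme \<Rightarrow> 'g section_pair set \<Rightarrow> ('g section_pair, 'g set, 'r, 'm) cfunctor
    \<Rightarrow> ('r, ('g section_pair \<Rightarrow> 'm) set) module"
  where "reduced_cohomology_0 G \<C> F =
    mod_quotient (cat_lim (section_orbit_cat G \<C>) F)
      (augmentation G \<C> F ` carrier (val F (top_section G)))"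

text \<open>The reduced cohomology in degrees \<open>n \<ge> 1\<close>.\<close>

definition reduced_cohomology_pos ::
  "('g, 'h) monoid_scheme \<Rightarrow> ('r, 's) ring_scheme \<Rightarrow> 'g section_pair set \<Rightarrow> nat
    \<Rightarrow> ('g section_pair, 'g set, 'r, 'm) cfunctor
    \<Rightarrow> ('r, ('g section_pair \<Rightarrow> (('g section_pair \<times> 'g set) list \<Rightarrow> 'r) \<Rightarrow> 'm) set) module"
  where "reduced_cohomology_pos G R \<C> n F =
    Ext (section_orbit_cat G \<C>) R n (const_functor R) F"

end

theory Submission
  imports "HOL-Algebra.Group_Action" "HOL-Algebra.Multiplicative_Group" Defs
begin

text \<open>
  The centralizer sections form a reflective subcategory, and a reflective subcategory computes the
  same cohomology.

  For a section \<open>(U, V)\<close> with \<open>V \<noteq> 1\<close> let \<open>\<Omega>\<close> be the subgroup of those \<open>x\<close> in the intersection of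
  \<open>V\<close> with the centre of \<open>U\<close> that satisfy \<open>x\<^sup>p = 1\<close>.  It is nontrivial, since a nontrivial normal
  subgroup of a finite \<open>p\<close>-group meets the centre (\<open>p_group_central_element\<close>), and it is elementary
  abelian.  An element \<open>g\<close> represents an arrow from \<open>(U, V)\<close> to \<open>(C\<^sub>G(E), E)\<close> iff \<open>g\<^sup>-\<^sup>1 E g\<close> lies
  in \<open>V\<close> and is centralized by \<open>U\<close>, that is, iff \<open>g\<^sup>-\<^sup>1 E g \<subseteq> \<Omega>\<close>.  So every such arrow factors
  uniquely through the arrow from \<open>(U, V)\<close> to \<open>L (U, V) = (C\<^sub>G(\<Omega>), \<Omega>)\<close> represented by \<open>1\<close>, and \<open>L\<close>
  is left adjoint to the inclusion (\<open>centralizer_sections_reflective\<close>).  On the sections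
  \<open>(C\<^sub>G(E), E)\<close> themselves \<open>L\<close> is the identity.

  For modules over a category, which are contravariant, pullback along \<open>L\<close> is then left adjoint to
  restriction to the subcategory.  Pullback is exact and preserves projectives and the constant
  functor, so it turns a projective resolution \<open>P\<close> of the constant functor over the subcategory into
  one over the whole category, and natural maps from \<open>P \<circ> L\<close> to \<open>F\<close> are the same as natural maps
  from \<open>P\<close> to the restriction of \<open>F\<close>.  Hence the Ext modules agree (\<open>Ext_reflective_iso\<close>).  As
  \<^const>\<open>Ext\<close> refers to an unspecified resolution in a fixed type, this rests on two general facts:
  over a finite category such a resolution exists (\<open>projective_resolution_exists\<close>), and the cohomology
  does not depend on it (\<open>Hom_cohomology_independent\<close>).

  In degree \<open>0\<close>, compatible families on the subcategory extend uniquely along the units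
  (\<open>cat_lim_quotient_iso\<close>).  In degree \<open>-1\<close>, the two kernels are equal because every arrow to \<open>(G, 1)\<close>
  factors through a unit.
\<close>

section \<open>Modules\<close>

lemma mod_hom_closed: "f \<in> mod_hom R M N \<Longrightarrow> u \<in> carrier M \<Longrightarrow> f u \<in> carrier N"
  by (auto simp: mod_hom_def)

lemma mod_hom_add:
  "f \<in> mod_hom R M N \<Longrightarrow> u \<in> carrier M \<Longrightarrow> v \<in> carrier M \<Longrightarrow> f (u \<oplus>\<^bsub>M\<^esub> v) = f u \<oplus>\<^bsub>N\<^esub> f v"
  by (auto simp: mod_hom_def)

lemma mod_hom_smult:
  "f \<in> mod_hom R M N \<Longrightarrow> r \<in> carrier R \<Longrightarrow> u \<in> carrier M \<Longrightarrow> f (r \<odot>\<^bsub>M\<^esub> u) = r \<odot>\<^bsub>N\<^esub> f u"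
  by (auto simp: mod_hom_def)

lemma mod_homI:
  assumes "\<And>u. u \<in> carrier M \<Longrightarrow> f u \<in> carrier N"
    and "\<And>u v. u \<in> carrier M \<Longrightarrow> v \<in> carrier M \<Longrightarrow> f (u \<oplus>\<^bsub>M\<^esub> v) = f u \<oplus>\<^bsub>N\<^esub> f v"
    and "\<And>r u. r \<in> carrier R \<Longrightarrow> u \<in> carrier M \<Longrightarrow> f (r \<odot>\<^bsub>M\<^esub> u) = r \<odot>\<^bsub>N\<^esub> f u"
  shows "f \<in> mod_hom R M N"
  using assms by (auto simp: mod_hom_def)

lemma mod_hom_zero:
  assumes "module R M" "module R N" "f \<in> mod_hom R M N"
  shows "f \<zero>\<^bsub>M\<^esub> = \<zero>\<^bsub>N\<^esub>"
proof -
  interpret M: module R M by fact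
  interpret N: module R N by fact
  have "f \<zero>\<^bsub>M\<^esub> = f (\<zero>\<^bsub>R\<^esub> \<odot>\<^bsub>M\<^esub> \<zero>\<^bsub>M\<^esub>)" by simp
  also have "\<dots> = \<zero>\<^bsub>N\<^esub>"
    using mod_hom_smult[OF assms(3) M.R.zero_closed M.M.zero_closed] mod_hom_closed[OF assms(3) M.M.zero_closed]
    by simp
  finally show ?thesis .
qed

lemma mod_hom_uminus:
  assumes "module R M" "module R N" "f \<in> mod_hom R M N" "u \<in> carrier M"
  shows "f (\<ominus>\<^bsub>M\<^esub> u) = \<ominus>\<^bsub>N\<^esub> f u"
proof -
  interpret M: module R M by fact
  interpret N: module R N by fact
  have "f (\<ominus>\<^bsub>M\<^esub> u) \<oplus>\<^bsub>N\<^esub> f u = \<zero>\<^bsub>N\<^esub>"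
    using assms(4) mod_hom_add[OF assms(3), of "\<ominus>\<^bsub>M\<^esub> u" u] mod_hom_zero[OF assms(1-3)]
    by (simp add: M.M.l_neg)
  then show ?thesis
    using assms(4) mod_hom_closed[OF assms(3)] by (simp add: N.M.minus_equality)
qed

lemma mod_hom_minus:
  assumes "module R M" "module R N" "f \<in> mod_hom R M N" "u \<in> carrier M" "v \<in> carrier M"
  shows "f (u \<ominus>\<^bsub>M\<^esub> v) = f u \<ominus>\<^bsub>N\<^esub> f v"
proof -
  interpret M: module R M by fact
  show ?thesis
    using assms mod_hom_add[OF assms(3), of u "\<ominus>\<^bsub>M\<^esub> v"] mod_hom_uminus[OF assms(1-3)]
    by (simp add: a_minus_def)
qed

lemma mod_hom_compose:
  assumes "f \<in> mod_hom R M N" "g \<in> mod_hom R N K"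
  shows "(\<lambda>u. g (f u)) \<in> mod_hom R M K"
  using assms by (auto simp: mod_hom_def Pi_iff)

lemma mod_hom_cong:
  assumes "module R M" "f \<in> mod_hom R M N" and eq: "\<And>u. u \<in> carrier M \<Longrightarrow> g u = f u"
  shows "g \<in> mod_hom R M N"
proof -
  interpret M: module R M by fact
  show ?thesis
    by (rule mod_homI)
      (simp_all add: eq mod_hom_closed[OF assms(2)] mod_hom_add[OF assms(2)] mod_hom_smult[OF assms(2)])
qed

lemma mod_hom_add_maps:
  assumes "module R N" "f \<in> mod_hom R M N" "g \<in> mod_hom R M N"
  shows "(\<lambda>u. f u \<oplus>\<^bsub>N\<^esub> g u) \<in> mod_hom R M N"
proof -
  interpret N: module R N by fact
  show ?thesis
    using assms(2,3) by (auto simp: mod_hom_def N.smult_r_distr N.a_ac Pi_iff)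
qed

lemma mod_hom_smult_map:
  assumes "module R N" "f \<in> mod_hom R M N" "r \<in> carrier R"
  shows "(\<lambda>u. r \<odot>\<^bsub>N\<^esub> f u) \<in> mod_hom R M N"
proof -
  interpret N: module R N by fact
  show ?thesis
    using assms(2,3)
    by (auto simp: mod_hom_def N.smult_r_distr Pi_iff simp flip: N.smult_assoc1) (simp add: N.R.m_comm)
qed

lemma mod_hom_minus_maps:
  assumes "module R N" "f \<in> mod_hom R M N" "g \<in> mod_hom R M N"
  shows "(\<lambda>u. f u \<ominus>\<^bsub>N\<^esub> g u) \<in> mod_hom R M N"
proof -
  interpret N: module R N by fact
  have "(\<lambda>u. \<ominus>\<^bsub>N\<^esub> g u) \<in> mod_hom R M N"
    using assms(3) by (auto simp: mod_hom_def N.smult_r_minus N.M.minus_add Pi_iff)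
  from mod_hom_add_maps[OF assms(1,2) this] show ?thesis by (simp add: a_minus_def)
qed

lemma mod_iso_trans:
  assumes "mod_iso R M N" "mod_iso R N K"
  shows "mod_iso R M K"
proof -
  obtain f g where f: "f \<in> mod_hom R M N" "bij_betw f (carrier M) (carrier N)"
    and g: "g \<in> mod_hom R N K" "bij_betw g (carrier N) (carrier K)"
    using assms by (auto simp: mod_iso_def)
  have "bij_betw (\<lambda>u. g (f u)) (carrier M) (carrier K)"
    using bij_betw_trans[OF f(2) g(2)] by (simp add: comp_def)
  with mod_hom_compose[OF f(1) g(1)] show ?thesis by (auto simp: mod_iso_def)
qed

text \<open>
  All modules built below are modules of functions with pointwise operations, or are modules
  carried along a bijection.  In each case evaluation maps into known modules separate the
  elements, so the axioms are inherited from there.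
\<close>

lemma module_if_separated:
  fixes R :: "('r, 's) ring_scheme" and M :: "('r, 'm) module" and N :: "'k \<Rightarrow> ('r, 'n) module"
  assumes R: "cring R"
    and N: "\<And>k. k \<in> K \<Longrightarrow> module R (N k)"
    and add: "\<And>u v. u \<in> carrier M \<Longrightarrow> v \<in> carrier M \<Longrightarrow> u \<oplus>\<^bsub>M\<^esub> v \<in> carrier M"
    and zero: "\<zero>\<^bsub>M\<^esub> \<in> carrier M"
    and smult: "\<And>r u. r \<in> carrier R \<Longrightarrow> u \<in> carrier M \<Longrightarrow> r \<odot>\<^bsub>M\<^esub> u \<in> carrier M"
    and hom: "\<And>k. k \<in> K \<Longrightarrow> \<pi> k \<in> mod_hom R M (N k)"
    and hom_zero: "\<And>k. k \<in> K \<Longrightarrow> \<pi> k \<zero>\<^bsub>M\<^esub> = \<zero>\<^bsub>N k\<^esub>"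
    and inj: "\<And>u v. u \<in> carrier M \<Longrightarrow> v \<in> carrier M \<Longrightarrow> (\<And>k. k \<in> K \<Longrightarrow> \<pi> k u = \<pi> k v) \<Longrightarrow> u = v"
  shows "module R M"
proof -
  interpret R: cring R by fact
  have cl: "\<pi> k u \<in> carrier (N k)" if "k \<in> K" "u \<in> carrier M" for k u
    using mod_hom_closed[OF hom] that by blast
  note a = mod_hom_add[OF hom] and s = mod_hom_smult[OF hom]
  note ag = module.axioms(2)[OF N]
  show ?thesis
  proof (rule moduleI[OF R])
    show "abelian_group M"
    proof (rule abelian_groupI)
      fix u v w assume u: "u \<in> carrier M" and v: "v \<in> carrier M" and w: "w \<in> carrier M"
      show "u \<oplus>\<^bsub>M\<^esub> v \<oplus>\<^bsub>M\<^esub> w = u \<oplus>\<^bsub>M\<^esub> (v \<oplus>\<^bsub>M\<^esub> w)"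
        using u v w cl ag by (intro inj) (auto simp: add a abelian_monoid.a_assoc abelian_group_def)
      show "u \<oplus>\<^bsub>M\<^esub> v = v \<oplus>\<^bsub>M\<^esub> u"
        using u v cl ag by (intro inj) (auto simp: add a abelian_monoid.a_comm abelian_group_def)
    next
      fix u assume u: "u \<in> carrier M"
      show "\<zero>\<^bsub>M\<^esub> \<oplus>\<^bsub>M\<^esub> u = u"
        using u cl ag
        by (intro inj) (auto simp: add zero a hom_zero abelian_monoid.l_zero abelian_group_def)
      have "(\<ominus>\<^bsub>R\<^esub> \<one>\<^bsub>R\<^esub>) \<odot>\<^bsub>M\<^esub> u \<oplus>\<^bsub>M\<^esub> u = \<zero>\<^bsub>M\<^esub>"
      proof (rule inj)
        fix k assume k: "k \<in> K"
        interpret N: module R "N k" by (rule N[OF k])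
        show "\<pi> k ((\<ominus>\<^bsub>R\<^esub> \<one>\<^bsub>R\<^esub>) \<odot>\<^bsub>M\<^esub> u \<oplus>\<^bsub>M\<^esub> u) = \<pi> k \<zero>\<^bsub>M\<^esub>"
          using u k cl[OF k u] by (simp add: a s smult hom_zero N.smult_l_minus N.M.l_neg)
      qed (auto simp: u zero add smult)
      then show "\<exists>y\<in>carrier M. y \<oplus>\<^bsub>M\<^esub> u = \<zero>\<^bsub>M\<^esub>"
        using u smult by blast
    qed (auto simp: add zero)
  next
    fix x y u v assume r: "x \<in> carrier R" "y \<in> carrier R" and u: "u \<in> carrier M" and v: "v \<in> carrier M"
    show "(x \<oplus>\<^bsub>R\<^esub> y) \<odot>\<^bsub>M\<^esub> u = x \<odot>\<^bsub>M\<^esub> u \<oplus>\<^bsub>M\<^esub> y \<odot>\<^bsub>M\<^esub> u"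
      using r u cl by (intro inj) (auto simp: add smult a s module.smult_l_distr[OF N])
    show "x \<odot>\<^bsub>M\<^esub> (u \<oplus>\<^bsub>M\<^esub> v) = x \<odot>\<^bsub>M\<^esub> u \<oplus>\<^bsub>M\<^esub> x \<odot>\<^bsub>M\<^esub> v"
      using r u v cl by (intro inj) (auto simp: add smult a s module.smult_r_distr[OF N])
    show "(x \<otimes>\<^bsub>R\<^esub> y) \<odot>\<^bsub>M\<^esub> u = x \<odot>\<^bsub>M\<^esub> (y \<odot>\<^bsub>M\<^esub> u)"
      using r u cl by (intro inj) (auto simp: smult s module.smult_assoc1[OF N])
  next
    fix u assume u: "u \<in> carrier M"
    show "\<one>\<^bsub>R\<^esub> \<odot>\<^bsub>M\<^esub> u = u"
      using u cl by (intro inj) (auto simp: smult s module.smult_one[OF N])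
  qed (auto simp: smult)
qed

lemma regular_module_module:
  assumes "cring R" shows "module R (regular_module R)"
proof -
  interpret cring R by fact
  have "abelian_group (regular_module R)"
    by (rule abelian_groupI) (auto simp: regular_module_def a_ac intro: l_neg)
  then show ?thesis
    by (intro moduleI) (auto simp: assms regular_module_def l_distr r_distr m_assoc)
qed

lemma mod_restrict_simps [simp]:
  "carrier (mod_restrict M A) = A" "\<zero>\<^bsub>mod_restrict M A\<^esub> = \<zero>\<^bsub>M\<^esub>"
  "u \<oplus>\<^bsub>mod_restrict M A\<^esub> v = u \<oplus>\<^bsub>M\<^esub> v" "r \<odot>\<^bsub>mod_restrict M A\<^esub> u = r \<odot>\<^bsub>M\<^esub> u"
  by (auto simp: mod_restrict_def)

lemma mod_restrict_module:
  assumes "module R M" "submodule A R M" shows "module R (mod_restrict M A)"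
  unfolding mod_restrict_def by (rule submodule.submodule_is_module[OF assms(2,1)])

lemma submodule_kernel:
  assumes M: "module R M" and N: "module R N" and f: "f \<in> mod_hom R M N"
  shows "submodule (mod_kernel M N f) R M"
proof -
  interpret M: module R M by fact
  interpret N: module R N by fact
  show ?thesis
    by (rule M.submoduleI)
      (auto simp: mod_kernel_def mod_hom_zero[OF M N f] mod_hom_uminus[OF M N f]
        mod_hom_add[OF f] mod_hom_smult[OF f])
qed

lemma submodule_image:
  assumes M: "module R M" and N: "module R N" and f: "f \<in> mod_hom R M N"
  shows "submodule (f ` carrier M) R N"
proof -
  interpret M: module R M by fact
  interpret N: module R N by fact
  show ?thesis
  proof (rule N.submoduleI)
    show "f ` carrier M \<subseteq> carrier N" using mod_hom_closed[OF f] by auto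
    show "\<zero>\<^bsub>N\<^esub> \<in> f ` carrier M" by (auto simp flip: mod_hom_zero[OF M N f])
    show "\<ominus>\<^bsub>N\<^esub> a \<in> f ` carrier M" if "a \<in> f ` carrier M" for a
      using that by (auto simp flip: mod_hom_uminus[OF M N f])
    show "a \<oplus>\<^bsub>N\<^esub> b \<in> f ` carrier M" if "a \<in> f ` carrier M" "b \<in> f ` carrier M" for a b
      using that by (auto simp flip: mod_hom_add[OF f])
    show "r \<odot>\<^bsub>N\<^esub> b \<in> f ` carrier M" if "r \<in> carrier R" "b \<in> f ` carrier M" for r b
      using that by (auto simp flip: mod_hom_smult[OF f])
  qed
qed

lemma submodule_restrict:
  assumes M: "module R M" and A: "submodule A R M" and B: "submodule B R M" and BA: "B \<subseteq> A"
  shows "submodule B R (mod_restrict M A)"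
proof -
  interpret M: module R M by fact
  interpret A: module R "mod_restrict M A" by (rule mod_restrict_module[OF M A])
  note b = M.submoduleE[OF B] and a = M.submoduleE(1)[OF A]
  show ?thesis
  proof (rule A.submoduleI)
    show zB: "\<zero>\<^bsub>mod_restrict M A\<^esub> \<in> B"
      using submodule.axioms(1)[OF B] by (auto dest: subgroup.one_closed)
    show "\<ominus>\<^bsub>mod_restrict M A\<^esub> u \<in> B" if u: "u \<in> B" for u
    proof -
      have "\<ominus>\<^bsub>M\<^esub> u \<oplus>\<^bsub>mod_restrict M A\<^esub> u = \<zero>\<^bsub>mod_restrict M A\<^esub>"
        using u b(1) by (auto simp: M.M.l_neg)
      then have "\<ominus>\<^bsub>mod_restrict M A\<^esub> u = \<ominus>\<^bsub>M\<^esub> u"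
        using b(3)[OF u] u BA by (intro A.M.minus_equality) auto
      then show ?thesis using b(3)[OF u] by simp
    qed
  qed (use b BA in auto)
qed

lemma mod_quotient_coset_ops:
  assumes M: "module R M" and A: "submodule A R M"
  shows "carrier (mod_quotient M A) = (\<lambda>u. A +>\<^bsub>M\<^esub> u) ` carrier M"
    and "\<And>u v. u \<in> carrier M \<Longrightarrow> v \<in> carrier M \<Longrightarrow> A +>\<^bsub>M\<^esub> u = A +>\<^bsub>M\<^esub> v \<longleftrightarrow> u \<ominus>\<^bsub>M\<^esub> v \<in> A"
    and "\<And>u v. u \<in> carrier M \<Longrightarrow> v \<in> carrier M \<Longrightarrow>
      (A +>\<^bsub>M\<^esub> u) \<oplus>\<^bsub>mod_quotient M A\<^esub> (A +>\<^bsub>M\<^esub> v) = A +>\<^bsub>M\<^esub> (u \<oplus>\<^bsub>M\<^esub> v)"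
    and "\<And>r u. r \<in> carrier R \<Longrightarrow> u \<in> carrier M \<Longrightarrow>
      r \<odot>\<^bsub>mod_quotient M A\<^esub> (A +>\<^bsub>M\<^esub> u) = A +>\<^bsub>M\<^esub> (r \<odot>\<^bsub>M\<^esub> u)"
proof -
  interpret M: module R M by fact
  note sub = M.submoduleE[OF A]
  interpret A: abelian_subgroup A M
    using submodule.axioms(1)[OF A]
    by (intro abelian_subgroupI3 additive_subgroup.intro M.abelian_group_axioms)
  show "carrier (mod_quotient M A) = (\<lambda>u. A +>\<^bsub>M\<^esub> u) ` carrier M"
    by (auto simp: mod_quotient_def A_RCOSETS_def')
  show eq: "A +>\<^bsub>M\<^esub> u = A +>\<^bsub>M\<^esub> v \<longleftrightarrow> u \<ominus>\<^bsub>M\<^esub> v \<in> A"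
    if u: "u \<in> carrier M" and v: "v \<in> carrier M" for u v
    using u v A.a_rcos_module[OF v u] A.a_rcos_self[OF u] A.a_repr_independence'[OF _ v]
    by (auto simp: M.M.minus_eq)
  show "(A +>\<^bsub>M\<^esub> u) \<oplus>\<^bsub>mod_quotient M A\<^esub> (A +>\<^bsub>M\<^esub> v) = A +>\<^bsub>M\<^esub> (u \<oplus>\<^bsub>M\<^esub> v)"
    if u: "u \<in> carrier M" and v: "v \<in> carrier M" for u v
    using A.a_rcos_sum[OF u v] by (simp add: mod_quotient_def)
  show "r \<odot>\<^bsub>mod_quotient M A\<^esub> (A +>\<^bsub>M\<^esub> u) = A +>\<^bsub>M\<^esub> (r \<odot>\<^bsub>M\<^esub> u)"
    if r: "r \<in> carrier R" and u: "u \<in> carrier M" for r u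
  proof -
    have "A +>\<^bsub>M\<^esub> (r \<odot>\<^bsub>M\<^esub> w) = A +>\<^bsub>M\<^esub> (r \<odot>\<^bsub>M\<^esub> u)" if w: "w \<in> A +>\<^bsub>M\<^esub> u" for w
    proof -
      have wc: "w \<in> carrier M" using w A.a_elemrcos_carrier u by blast
      have "w \<ominus>\<^bsub>M\<^esub> u \<in> A"
        using w u wc A.a_rcos_module by (simp add: M.M.minus_eq)
      then have "r \<odot>\<^bsub>M\<^esub> (w \<ominus>\<^bsub>M\<^esub> u) \<in> A" using r sub(4) by blast
      also have "r \<odot>\<^bsub>M\<^esub> (w \<ominus>\<^bsub>M\<^esub> u) = r \<odot>\<^bsub>M\<^esub> w \<ominus>\<^bsub>M\<^esub> r \<odot>\<^bsub>M\<^esub> u"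
        using r u wc by (simp add: M.M.minus_eq M.smult_r_distr M.smult_r_minus)
      finally show ?thesis using eq r u wc by simp
    qed
    moreover have "A +>\<^bsub>M\<^esub> u \<noteq> {}" using A.a_rcos_self[OF u] by blast
    ultimately show ?thesis by (auto simp: mod_quotient_def)
  qed
qed

text \<open>
  The map \<open>f\<close> need only be bijective up to the submodules divided out.  It can thus be the map that a
  homotopy equivalence induces on cocycles, as well as an isomorphism of complexes.
\<close>

lemma mod_quotient_iso:
  assumes M: "module R M" and N: "module R N"
    and A: "submodule A R M" and B: "submodule B R N"
    and f: "f \<in> mod_hom R M N"
    and into: "\<And>u. u \<in> A \<Longrightarrow> f u \<in> B"
    and refl: "\<And>u. u \<in> carrier M \<Longrightarrow> f u \<in> B \<Longrightarrow> u \<in> A"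
    and onto: "\<And>v. v \<in> carrier N \<Longrightarrow> \<exists>u\<in>carrier M. v \<ominus>\<^bsub>N\<^esub> f u \<in> B"
  shows "mod_iso R (mod_quotient M A) (mod_quotient N B)"
proof -
  interpret M: module R M by fact
  interpret N: module R N by fact
  note fc = mod_hom_closed[OF f]
  note qM = mod_quotient_coset_ops[OF M A] and qN = mod_quotient_coset_ops[OF N B]
  define F where "F X = B +>\<^bsub>N\<^esub> f (SOME u. u \<in> carrier M \<and> X = A +>\<^bsub>M\<^esub> u)" for X
  have iff: "B +>\<^bsub>N\<^esub> f u = B +>\<^bsub>N\<^esub> f v \<longleftrightarrow> A +>\<^bsub>M\<^esub> u = A +>\<^bsub>M\<^esub> v"
    if u: "u \<in> carrier M" and v: "v \<in> carrier M" for u v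
  proof -
    have "f u \<ominus>\<^bsub>N\<^esub> f v \<in> B \<longleftrightarrow> u \<ominus>\<^bsub>M\<^esub> v \<in> A"
      using into refl M.M.minus_closed[OF u v] mod_hom_minus[OF M N f u v] by metis
    then show ?thesis by (simp only: qM(2)[OF u v] qN(2)[OF fc[OF u] fc[OF v]])
  qed
  have F: "F (A +>\<^bsub>M\<^esub> u) = B +>\<^bsub>N\<^esub> f u" if u: "u \<in> carrier M" for u
  proof -
    have "\<exists>w. w \<in> carrier M \<and> A +>\<^bsub>M\<^esub> u = A +>\<^bsub>M\<^esub> w" using u by blast
    from someI_ex[OF this] show ?thesis unfolding F_def by (subst iff) (auto simp: u)
  qed
  have "F \<in> mod_hom R (mod_quotient M A) (mod_quotient N B)"
    by (rule mod_homI)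
      (auto simp: qM(1,3,4) qN(1,3,4) F fc mod_hom_add[OF f] mod_hom_smult[OF f])
  moreover have "bij_betw F (carrier (mod_quotient M A)) (carrier (mod_quotient N B))"
  proof (rule bij_betw_imageI)
    show "inj_on F (carrier (mod_quotient M A))"
      by (auto simp: inj_on_def qM(1) F iff)
    have "B +>\<^bsub>N\<^esub> v \<in> F ` carrier (mod_quotient M A)" if v: "v \<in> carrier N" for v
    proof -
      obtain u where u: "u \<in> carrier M" "v \<ominus>\<^bsub>N\<^esub> f u \<in> B" using onto[OF v] by blast
      then have "B +>\<^bsub>N\<^esub> v = F (A +>\<^bsub>M\<^esub> u)" using F qN(2) v fc by simp
      then show ?thesis using u(1) qM(1) by auto
    qed
    then show "F ` carrier (mod_quotient M A) = carrier (mod_quotient N B)"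
      by (auto simp: qM(1) qN(1) F fc)
  qed
  ultimately show ?thesis by (auto simp: mod_iso_def)
qed

section \<open>Natural transformations\<close>

lemma cat_moduleD:
  assumes "cat_module C R F" "x \<in> Obj C"
  shows "module R (val F x)"
    and "u \<in> carrier (val F x) \<Longrightarrow> res F x x (Idn C x) u = u"
    and "y \<in> Obj C \<Longrightarrow> a \<in> Hom C x y \<Longrightarrow> res F x y a \<in> mod_hom R (val F y) (val F x)"
    and "y \<in> Obj C \<Longrightarrow> a \<in> Hom C x y \<Longrightarrow> v \<in> carrier (val F y) \<Longrightarrow> res F x y a v \<in> carrier (val F x)"
    and "y \<in> Obj C \<Longrightarrow> z \<in> Obj C \<Longrightarrow> a \<in> Hom C x y \<Longrightarrow> b \<in> Hom C y z \<Longrightarrow> w \<in> carrier (val F z) \<Longrightarrow>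
      res F x z (Cmp C b a) w = res F x y a (res F y z b w)"
proof -
  show h: "y \<in> Obj C \<Longrightarrow> a \<in> Hom C x y \<Longrightarrow> res F x y a \<in> mod_hom R (val F y) (val F x)"
    using assms unfolding cat_module_def by blast
  show "y \<in> Obj C \<Longrightarrow> a \<in> Hom C x y \<Longrightarrow> v \<in> carrier (val F y) \<Longrightarrow> res F x y a v \<in> carrier (val F x)"
    by (rule mod_hom_closed[OF h])
qed (use assms in \<open>unfold cat_module_def, blast+\<close>)

lemma nat_transD:
  assumes "\<eta> \<in> nat_trans C R M N" "x \<in> Obj C"
  shows "\<eta> x \<in> mod_hom R (val M x) (val N x)"
    and "u \<in> carrier (val M x) \<Longrightarrow> \<eta> x u \<in> carrier (val N x)"
    and "y \<in> Obj C \<Longrightarrow> a \<in> Hom C x y \<Longrightarrow> v \<in> carrier (val M y) \<Longrightarrow>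
      \<eta> x (res M x y a v) = res N x y a (\<eta> y v)"
proof -
  show h: "\<eta> x \<in> mod_hom R (val M x) (val N x)"
    and "y \<in> Obj C \<Longrightarrow> a \<in> Hom C x y \<Longrightarrow> v \<in> carrier (val M y) \<Longrightarrow>
      \<eta> x (res M x y a v) = res N x y a (\<eta> y v)"
    using assms by (simp_all add: nat_trans_def)
  show "u \<in> carrier (val M x) \<Longrightarrow> \<eta> x u \<in> carrier (val N x)"
    by (rule mod_hom_closed[OF h])
qed

lemma nat_trans_eqI:
  assumes "\<eta> \<in> nat_trans C R M N" "\<theta> \<in> nat_trans C R M N'"
    and "\<And>x u. x \<in> Obj C \<Longrightarrow> u \<in> carrier (val M x) \<Longrightarrow> \<eta> x u = \<theta> x u"
  shows "\<eta> = \<theta>"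
proof (rule extensionalityI)
  show "\<eta> \<in> extensional (Obj C)" "\<theta> \<in> extensional (Obj C)"
    using assms by (auto simp: nat_trans_def)
  fix x assume x: "x \<in> Obj C"
  show "\<eta> x = \<theta> x"
  proof (rule extensionalityI)
    show "\<eta> x \<in> extensional (carrier (val M x))" "\<theta> x \<in> extensional (carrier (val M x))"
      using assms x by (auto simp: nat_trans_def)
  qed (use assms(3) x in blast)
qed

lemma restrict_eq_iff: "restrict f S = restrict g S \<longleftrightarrow> (\<forall>s\<in>S. f s = g s)"
  by (auto simp: restrict_def fun_eq_iff)

text \<open>
  Elements of \<^const>\<open>nat_trans\<close> are undefined outside objects and carriers; families given by a
  formula are cut down to this form.
\<close>

definition nt_restrict ::
  "('o, 'a) cat \<Rightarrow> ('o, 'a, 'r, 'm) cfunctor \<Rightarrow> ('o \<Rightarrow> 'm \<Rightarrow> 'n) \<Rightarrow> ('o \<Rightarrow> 'm \<Rightarrow> 'n)"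
  where "nt_restrict C M \<eta> = (\<lambda>x\<in>Obj C. \<lambda>u\<in>carrier (val M x). \<eta> x u)"

lemma nt_restrict_apply [simp]:
  "x \<in> Obj C \<Longrightarrow> u \<in> carrier (val M x) \<Longrightarrow> nt_restrict C M \<eta> x u = \<eta> x u"
  by (simp add: nt_restrict_def)

lemma nt_restrict_nat_trans:
  assumes M: "cat_module C R M"
    and hom: "\<And>x. x \<in> Obj C \<Longrightarrow> \<eta> x \<in> mod_hom R (val M x) (val N x)"
    and nat: "\<And>x y a u. x \<in> Obj C \<Longrightarrow> y \<in> Obj C \<Longrightarrow> a \<in> Hom C x y \<Longrightarrow> u \<in> carrier (val M y) \<Longrightarrow>
      \<eta> x (res M x y a u) = res N x y a (\<eta> y u)"
  shows "nt_restrict C M \<eta> \<in> nat_trans C R M N"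
proof -
  have "restrict (\<eta> x) (carrier (val M x)) \<in> mod_hom R (val M x) (val N x)" if x: "x \<in> Obj C" for x
    by (rule mod_hom_cong[OF cat_moduleD(1)[OF M x] hom[OF x]]) simp
  then show ?thesis
    by (auto simp: nat_trans_def nt_restrict_def nat cat_moduleD(4)[OF M])
qed

lemma nat_trans_id:
  assumes "cat_module C R M" shows "nt_restrict C M (\<lambda>x u. u) \<in> nat_trans C R M M"
  by (rule nt_restrict_nat_trans[OF assms]) (auto simp: mod_hom_def)

lemma nat_trans_compose:
  assumes M: "cat_module C R M" and f: "f \<in> nat_trans C R M N" and g: "g \<in> nat_trans C R N K"
  shows "nt_restrict C M (\<lambda>x u. g x (f x u)) \<in> nat_trans C R M K"
  by (rule nt_restrict_nat_trans[OF M])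
    (auto simp: nat_transD[OF f] nat_transD[OF g] intro: mod_hom_compose[OF nat_transD(1)[OF f] nat_transD(1)[OF g]])

lemma nat_trans_add:
  assumes M: "cat_module C R M" and N: "cat_module C R N"
    and f: "f \<in> nat_trans C R M N" and g: "g \<in> nat_trans C R M N"
  shows "nt_restrict C M (\<lambda>x u. f x u \<oplus>\<^bsub>val N x\<^esub> g x u) \<in> nat_trans C R M N"
  by (rule nt_restrict_nat_trans[OF M])
    (auto simp: nat_transD[OF f] nat_transD[OF g] mod_hom_add[OF cat_moduleD(3)[OF N]]
      intro: mod_hom_add_maps cat_moduleD(1)[OF N])

lemma nat_trans_minus:
  assumes M: "cat_module C R M" and N: "cat_module C R N"
    and f: "f \<in> nat_trans C R M N" and g: "g \<in> nat_trans C R M N"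
  shows "nt_restrict C M (\<lambda>x u. f x u \<ominus>\<^bsub>val N x\<^esub> g x u) \<in> nat_trans C R M N"
  by (rule nt_restrict_nat_trans[OF M])
    (auto simp: nat_transD[OF f] nat_transD[OF g]
      mod_hom_minus[OF cat_moduleD(1)[OF N] cat_moduleD(1)[OF N] cat_moduleD(3)[OF N]]
      intro: mod_hom_minus_maps cat_moduleD(1)[OF N])

lemma nat_trans_smult:
  assumes M: "cat_module C R M" and N: "cat_module C R N"
    and f: "f \<in> nat_trans C R M N" and r: "r \<in> carrier R"
  shows "nt_restrict C M (\<lambda>x u. r \<odot>\<^bsub>val N x\<^esub> f x u) \<in> nat_trans C R M N"
  by (rule nt_restrict_nat_trans[OF M])
    (auto simp: nat_transD[OF f] r mod_hom_smult[OF cat_moduleD(3)[OF N]]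
      intro: mod_hom_smult_map cat_moduleD(1)[OF N])

lemma nat_trans_zero:
  assumes M: "cat_module C R M" and N: "cat_module C R N"
  shows "nt_restrict C M (\<lambda>x u. \<zero>\<^bsub>val N x\<^esub>) \<in> nat_trans C R M N"
proof (rule nt_restrict_nat_trans[OF M])
  fix x assume x: "x \<in> Obj C"
  interpret N: module R "val N x" by (rule cat_moduleD(1)[OF N x])
  show "(\<lambda>u. \<zero>\<^bsub>val N x\<^esub>) \<in> mod_hom R (val M x) (val N x)"
    by (rule mod_homI) auto
qed (simp add: mod_hom_zero[OF cat_moduleD(1)[OF N] cat_moduleD(1)[OF N] cat_moduleD(3)[OF N]])

lemma nat_trans_module_simps [simp]:
  "carrier (nat_trans_module C R M N) = nat_trans C R M N"
  "\<zero>\<^bsub>nat_trans_module C R M N\<^esub> = nt_restrict C M (\<lambda>x u. \<zero>\<^bsub>val N x\<^esub>)"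
  "\<eta> \<oplus>\<^bsub>nat_trans_module C R M N\<^esub> \<theta> = nt_restrict C M (\<lambda>x u. \<eta> x u \<oplus>\<^bsub>val N x\<^esub> \<theta> x u)"
  "r \<odot>\<^bsub>nat_trans_module C R M N\<^esub> \<eta> = nt_restrict C M (\<lambda>x u. r \<odot>\<^bsub>val N x\<^esub> \<eta> x u)"
  by (simp_all add: nat_trans_module_def nt_restrict_def)

lemma nat_trans_module_module:
  assumes R: "cring R" and M: "cat_module C R M" and N: "cat_module C R N"
  shows "module R (nat_trans_module C R M N)"
proof (rule module_if_separated[OF R, where K = "{(x, u). x \<in> Obj C \<and> u \<in> carrier (val M x)}"
      and \<pi> = "\<lambda>(x, u) \<eta>. \<eta> x u" and N = "\<lambda>(x, u). val N x"])
  fix k assume "k \<in> {(x, u). x \<in> Obj C \<and> u \<in> carrier (val M x)}"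
  then obtain x u where k: "k = (x, u)" "x \<in> Obj C" "u \<in> carrier (val M x)" by auto
  show "(case k of (x, u) \<Rightarrow> \<lambda>\<eta>. \<eta> x u) \<in> mod_hom R (nat_trans_module C R M N) (case k of (x, u) \<Rightarrow> val N x)"
    using k by (auto intro!: mod_homI simp: nat_transD(2))
next
  fix \<eta> \<theta>
  assume "\<eta> \<in> carrier (nat_trans_module C R M N)" "\<theta> \<in> carrier (nat_trans_module C R M N)"
    and eq: "\<And>k. k \<in> {(x, u). x \<in> Obj C \<and> u \<in> carrier (val M x)} \<Longrightarrow>
      (case k of (x, u) \<Rightarrow> \<lambda>\<eta>. \<eta> x u) \<eta> = (case k of (x, u) \<Rightarrow> \<lambda>\<eta>. \<eta> x u) \<theta>"
  then show "\<eta> = \<theta>"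
    by (intro nat_trans_eqI[of \<eta> C R M N \<theta> N]) (use eq[of "(_, _)"] in auto)
qed (auto simp: nat_trans_add[OF M N] nat_trans_smult[OF M N] nat_trans_zero[OF M N] cat_moduleD(1)[OF N])

lemma nat_trans_minus_apply:
  assumes R: "cring R" and M: "cat_module C R M" and N: "cat_module C R N"
    and f: "f \<in> nat_trans C R M N" and g: "g \<in> nat_trans C R M N"
    and x: "x \<in> Obj C" and u: "u \<in> carrier (val M x)"
  shows "(f \<ominus>\<^bsub>nat_trans_module C R M N\<^esub> g) x u = f x u \<ominus>\<^bsub>val N x\<^esub> g x u"
proof -
  have ev: "(\<lambda>\<eta>. \<eta> x u) \<in> mod_hom R (nat_trans_module C R M N) (val N x)"
    using x u by (auto intro!: mod_homI simp: nat_transD(2))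
  show ?thesis
    using mod_hom_minus[OF nat_trans_module_module[OF R M N] cat_moduleD(1)[OF N x] ev] f g by simp
qed

section \<open>Submodules and transport of structure\<close>

definition subfunctor ::
  "('o, 'a, 'r, 'm) cfunctor \<Rightarrow> ('o \<Rightarrow> 'm set) \<Rightarrow> ('o, 'a, 'r, 'm) cfunctor"
  where "subfunctor M A = \<lparr>val = (\<lambda>x. mod_restrict (val M x) (A x)), res = res M\<rparr>"

lemma subfunctor_simps [simp]:
  "val (subfunctor M A) x = mod_restrict (val M x) (A x)" "res (subfunctor M A) = res M"
  by (simp_all add: subfunctor_def)

lemma mod_hom_restrict:
  assumes "f \<in> mod_hom R M N" "A \<subseteq> carrier M" "\<And>u. u \<in> A \<Longrightarrow> f u \<in> B"
  shows "f \<in> mod_hom R (mod_restrict M A) (mod_restrict N B)"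
  using assms by (intro mod_homI) (auto simp: mod_hom_def subset_iff)

lemma subfunctor_cat_module:
  assumes M: "cat_module C R M"
    and A: "\<And>x. x \<in> Obj C \<Longrightarrow> submodule (A x) R (val M x)"
    and stable: "\<And>x y a u. x \<in> Obj C \<Longrightarrow> y \<in> Obj C \<Longrightarrow> a \<in> Hom C x y \<Longrightarrow> u \<in> A y \<Longrightarrow> res M x y a u \<in> A x"
  shows "cat_module C R (subfunctor M A)"
proof -
  have sub: "A x \<subseteq> carrier (val M x)" if "x \<in> Obj C" for x
    using module.submoduleE(1)[OF cat_moduleD(1)[OF M that] A[OF that]] .
  then have cl: "u \<in> carrier (val M x)" if "x \<in> Obj C" "u \<in> A x" for x u
    using that by blast
  show ?thesis
    unfolding cat_module_def
    using mod_restrict_module[OF cat_moduleD(1)[OF M] A] mod_hom_restrict[OF cat_moduleD(3)[OF M] sub stable]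
      cat_moduleD(2,5)[OF M] cl
    by simp
qed

lemma cat_kernel_cat_module:
  assumes M: "cat_module C R M" and N: "cat_module C R N" and f: "f \<in> nat_trans C R M N"
  shows "cat_module C R (subfunctor M (\<lambda>x. mod_kernel (val M x) (val N x) (f x)))"
proof (rule subfunctor_cat_module[OF M])
  show "submodule (mod_kernel (val M x) (val N x) (f x)) R (val M x)" if "x \<in> Obj C" for x
    using that by (intro submodule_kernel cat_moduleD(1)[OF M] cat_moduleD(1)[OF N] nat_transD(1)[OF f])
qed (auto simp: mod_kernel_def cat_moduleD(4)[OF M] nat_transD(3)[OF f]
      mod_hom_zero[OF cat_moduleD(1)[OF N] cat_moduleD(1)[OF N] cat_moduleD(3)[OF N]])

lemma cat_image_cat_module:
  assumes M: "cat_module C R M" and N: "cat_module C R N" and f: "f \<in> nat_trans C R M N"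
  shows "cat_module C R (subfunctor N (\<lambda>x. f x ` carrier (val M x)))"
proof (rule subfunctor_cat_module[OF N])
  show "submodule (f x ` carrier (val M x)) R (val N x)" if "x \<in> Obj C" for x
    using that by (intro submodule_image cat_moduleD(1)[OF M] cat_moduleD(1)[OF N] nat_transD(1)[OF f])
qed (auto simp: cat_moduleD(4)[OF M] simp flip: nat_transD(3)[OF f])

text \<open>
  Carrying a module along injections changes the type of its elements.  This is what lets the
  lifting property of \<^const>\<open>cat_projective\<close>, which speaks of two fixed types only, apply
  to modules with values in any type.
\<close>

definition transport ::
  "('o \<Rightarrow> 'm \<Rightarrow> 'n) \<Rightarrow> ('o, 'a, 'r, 'm) cfunctor \<Rightarrow> ('o, 'a, 'r, 'n) cfunctor"
  where "transport i M =
    (let j = (\<lambda>x. inv_into (carrier (val M x)) (i x)) in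
     \<lparr>val = (\<lambda>x. \<lparr>carrier = i x ` carrier (val M x), monoid.mult = undefined, one = undefined,
        zero = i x \<zero>\<^bsub>val M x\<^esub>, add = (\<lambda>u v. i x (j x u \<oplus>\<^bsub>val M x\<^esub> j x v)),
        smult = (\<lambda>r u. i x (r \<odot>\<^bsub>val M x\<^esub> j x u))\<rparr>),
      res = (\<lambda>x y a u. i x (res M x y a (j y u)))\<rparr>)"

lemma transport_iso:
  assumes R: "cring R" and M: "cat_module C R M"
    and inj: "\<And>x. x \<in> Obj C \<Longrightarrow> inj_on (i x) (carrier (val M x))"
  shows transport_cat_module: "cat_module C R (transport i M)"
    and transport_nat_trans: "nt_restrict C M i \<in> nat_trans C R M (transport i M)"
    and transport_inverse: "nt_restrict C (transport i M) (\<lambda>x. inv_into (carrier (val M x)) (i x))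
      \<in> nat_trans C R (transport i M) M"
proof -
  let ?j = "\<lambda>x. inv_into (carrier (val M x)) (i x)"
  have ji: "?j x (i x u) = u" if "x \<in> Obj C" "u \<in> carrier (val M x)" for x u
    using inj that by (simp add: inv_into_f_f)
  have add: "i x u \<oplus>\<^bsub>val (transport i M) x\<^esub> i x v = i x (u \<oplus>\<^bsub>val M x\<^esub> v)"
    if "x \<in> Obj C" "u \<in> carrier (val M x)" "v \<in> carrier (val M x)" for x u v
    using ji that by (simp add: transport_def)
  have smult: "r \<odot>\<^bsub>val (transport i M) x\<^esub> i x u = i x (r \<odot>\<^bsub>val M x\<^esub> u)"
    if "x \<in> Obj C" "u \<in> carrier (val M x)" for x u r
    using ji that by (simp add: transport_def)
  have carr: "carrier (val (transport i M) x) = i x ` carrier (val M x)" for x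
    by (simp add: transport_def)
  have zero: "\<zero>\<^bsub>val (transport i M) x\<^esub> = i x \<zero>\<^bsub>val M x\<^esub>" for x
    by (simp add: transport_def)
  have res: "res (transport i M) x y a (i y u) = i x (res M x y a u)"
    if "y \<in> Obj C" "u \<in> carrier (val M y)" for x y a u
    using ji that by (simp add: transport_def)
  have hom_i: "i x \<in> mod_hom R (val M x) (val (transport i M) x)" if "x \<in> Obj C" for x
    using that by (intro mod_homI) (auto simp: carr add smult)
  have ac: "u \<oplus>\<^bsub>val M x\<^esub> v \<in> carrier (val M x)"
    if "x \<in> Obj C" "u \<in> carrier (val M x)" "v \<in> carrier (val M x)" for x u v
    using cat_moduleD(1)[OF M that(1)] that(2,3) by (simp add: module_def abelian_group_def abelian_monoid.a_closed)
  have sc: "r \<odot>\<^bsub>val M x\<^esub> u \<in> carrier (val M x)"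
    if "x \<in> Obj C" "u \<in> carrier (val M x)" "r \<in> carrier R" for x u r
    using cat_moduleD(1)[OF M that(1)] that(2,3) by (simp add: module.smult_closed)
  have zc: "\<zero>\<^bsub>val M x\<^esub> \<in> carrier (val M x)" if "x \<in> Obj C" for x
    using cat_moduleD(1)[OF M that(1)] by (simp add: module_def abelian_group_def abelian_monoid.zero_closed)
  have hom_j: "?j x \<in> mod_hom R (val (transport i M) x) (val M x)" if x: "x \<in> Obj C" for x
    by (rule mod_homI) (auto simp: carr add smult ji ac sc x)
  have mod: "module R (val (transport i M) x)" if x: "x \<in> Obj C" for x
    by (rule module_if_separated[OF R, where K = UNIV and \<pi> = "\<lambda>_::unit. ?j x" and N = "\<lambda>_. val M x"])
      (auto simp: cat_moduleD(1)[OF M x] hom_j[OF x] carr add smult zero ac sc zc ji x)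
  show T: "cat_module C R (transport i M)"
    unfolding cat_module_def
  proof (intro conjI ballI)
    fix x y a assume x: "x \<in> Obj C" and y: "y \<in> Obj C" and a: "a \<in> Hom C x y"
    show "res (transport i M) x y a \<in> mod_hom R (val (transport i M) y) (val (transport i M) x)"
      by (rule mod_homI)
        (auto simp: carr add smult res ac sc x y cat_moduleD(4)[OF M x y a]
          mod_hom_add[OF cat_moduleD(3)[OF M x y a]] mod_hom_smult[OF cat_moduleD(3)[OF M x y a]])
  qed (auto simp: mod carr res cat_moduleD[OF M])
  show "nt_restrict C M i \<in> nat_trans C R M (transport i M)"
    by (rule nt_restrict_nat_trans[OF M]) (auto simp: hom_i res)
  show "nt_restrict C (transport i M) ?j \<in> nat_trans C R (transport i M) M"
    by (rule nt_restrict_nat_trans[OF T]) (auto simp: hom_j res carr ji cat_moduleD(4)[OF M])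
qed

lemma transport_carrier [simp]:
  "carrier (val (transport i M) x) = i x ` carrier (val M x)"
  by (simp add: transport_def)

section \<open>Lifting and comparison of projective resolutions\<close>

text \<open>
  Functions are sent to their indicators.  These distinguish them unless \<^typ>\<open>'r\<close> has a single
  element, and then there is only one function.
\<close>

lemma ex_inj_indicator:
  "\<exists>i :: ('l \<Rightarrow> 'r) \<Rightarrow> ('o \<times> 'a \<times> ('l \<Rightarrow> 'r) \<Rightarrow> 'r). inj i"
proof (cases "\<exists>r s :: 'r. r \<noteq> s")
  case True
  then obtain r s :: 'r where rs: "r \<noteq> s" by blast
  have "inj (\<lambda>(f :: 'l \<Rightarrow> 'r) (t :: 'o \<times> 'a \<times> ('l \<Rightarrow> 'r)). if snd (snd t) = f then r else s)"
  proof (rule injI)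
    fix f g :: "'l \<Rightarrow> 'r"
    assume "(\<lambda>t :: 'o \<times> 'a \<times> ('l \<Rightarrow> 'r). if snd (snd t) = f then r else s) = (\<lambda>t. if snd (snd t) = g then r else s)"
    from fun_cong[OF this, of "(undefined, undefined, f)"] show "f = g"
      using rs by (auto split: if_splits)
  qed
  then show ?thesis by blast
next
  case False
  then have "f = g" for f g :: "'l \<Rightarrow> 'r" by (auto simp: fun_eq_iff)
  then show ?thesis by (auto simp: inj_def)
qed

text \<open>
  The lifting property for a target \<open>X\<close> with values in any type.  The image of \<open>d\<close>, a quotient
  of \<open>Q\<close>, is moved into the type of \<open>Q\<close> by choosing a preimage of each of its elements, and \<open>Q\<close>
  itself is moved into the larger type by an injection; the lift is then moved back.
\<close>

lemma projective_lift:
  fixes P Q :: "('o, 'a, 'r, 'l \<Rightarrow> 'r) cfunctor" and X :: "('o, 'a, 'r, 'm) cfunctor"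
  assumes R: "cring R" and P: "cat_projective C R P"
    and Q: "cat_module C R Q" and X: "cat_module C R X"
    and d: "d \<in> nat_trans C R Q X" and h: "h \<in> nat_trans C R P X"
    and im: "\<And>x u. x \<in> Obj C \<Longrightarrow> u \<in> carrier (val P x) \<Longrightarrow> h x u \<in> d x ` carrier (val Q x)"
  shows "\<exists>g \<in> nat_trans C R P Q. \<forall>x\<in>Obj C. \<forall>u\<in>carrier (val P x). d x (g x u) = h x u"
proof -
  have PM: "cat_module C R P" using P by (simp add: cat_projective_def)
  obtain i :: "('l \<Rightarrow> 'r) \<Rightarrow> ('o \<times> 'a \<times> ('l \<Rightarrow> 'r) \<Rightarrow> 'r)" where i: "inj i"
    using ex_inj_indicator by blast
  define B where "B = transport (\<lambda>_. i) Q"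
  let ?j = "nt_restrict C B (\<lambda>x. inv_into (carrier (val Q x)) i)"
  have iQ: "inj_on i (carrier (val Q x))" for x using i by (rule inj_on_subset) simp
  note Bs = transport_iso[OF R Q, of "\<lambda>_. i", OF iQ, folded B_def]
  \<comment> \<open>The given property applies to \<open>B\<close>, a copy of \<open>Q\<close>, and \<open>N\<close>, a copy of the image \<open>?I\<close> of \<open>d\<close>.\<close>
  let ?I = "subfunctor X (\<lambda>x. d x ` carrier (val Q x))"
  let ?s = "\<lambda>x. inv_into (carrier (val Q x)) (d x)"
  have I: "cat_module C R ?I" by (rule cat_image_cat_module[OF Q X d])
  have sI: "inj_on (?s x) (carrier (val ?I x))" for x by (simp add: inj_on_inv_into)
  define N where "N = transport ?s ?I"
  note Ns = transport_iso[OF R I, of ?s, OF sI, folded N_def]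
  have dI: "d \<in> nat_trans C R Q ?I" and hI: "h \<in> nat_trans C R P ?I"
    using d h im by (auto simp: nat_trans_def mod_hom_def)
  let ?s' = "nt_restrict C ?I ?s"
  let ?dj = "nt_restrict C B (\<lambda>x b. d x (?j x b))"
  have dj: "?dj \<in> nat_trans C R B ?I"
    by (rule nat_trans_compose[OF Bs(1) Bs(3) dI])
  let ?e = "nt_restrict C B (\<lambda>x b. ?s' x (?dj x b))"
  have e: "?e \<in> nat_trans C R B N"
    by (rule nat_trans_compose[OF Bs(1) dj Ns(2)])
  have carB: "carrier (val B x) = i ` carrier (val Q x)" for x by (simp add: B_def)
  have e_apply: "?e x (i q) = ?s x (d x q)" if "x \<in> Obj C" "q \<in> carrier (val Q x)" for x q
    using that by (simp add: carB inv_into_f_f[OF iQ])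
  have epi: "nat_epi C R B N ?e"
    unfolding nat_epi_def
  proof (intro conjI ballI e)
    fix x assume x: "x \<in> Obj C"
    show "?e x ` carrier (val B x) = carrier (val N x)"
      by (auto simp: carB N_def image_image e_apply[OF x] simp del: nt_restrict_apply)
  qed
  let ?f = "nt_restrict C P (\<lambda>x u. ?s' x (h x u))"
  have f: "?f \<in> nat_trans C R P N"
    by (rule nat_trans_compose[OF PM hI Ns(2)])
  obtain g where g: "g \<in> nat_trans C R P B"
    and eg: "\<And>x u. x \<in> Obj C \<Longrightarrow> u \<in> carrier (val P x) \<Longrightarrow> ?e x (g x u) = ?f x u"
    using P Bs(1) Ns(1) epi f unfolding cat_projective_def by blast
  have "d x (?j x (g x u)) = h x u" if x: "x \<in> Obj C" and u: "u \<in> carrier (val P x)" for x u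
  proof -
    obtain q where q: "q \<in> carrier (val Q x)" "g x u = i q"
      using nat_transD(2)[OF g x u] by (auto simp: carB)
    have "?s x (d x q) = ?s x (h x u)"
      using eg[OF x u] e_apply[OF x q(1)] im[OF x u] x u unfolding q(2) by simp
    then have "d x q = h x u"
      by (rule inj_onD[OF sI]) (use q(1) im[OF x u] in simp_all)
    then show ?thesis using x q by (simp add: carB inv_into_f_f[OF iQ])
  qed
  with nat_trans_compose[OF PM g Bs(3)] show ?thesis
    by (intro bexI[where x = "nt_restrict C P (\<lambda>x u. ?j x (g x u))"]) auto
qed

lemma projective_resolutionD:
  assumes "projective_resolution C R M P d \<epsilon>"
  shows "cat_projective C R (P n)" "cat_module C R (P n)" "d n \<in> nat_trans C R (P (Suc n)) (P n)"
    "\<epsilon> \<in> nat_trans C R (P 0) M"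
    "x \<in> Obj C \<Longrightarrow> \<epsilon> x ` carrier (val (P 0) x) = carrier (val M x)"
    "x \<in> Obj C \<Longrightarrow> u \<in> carrier (val (P (Suc 0)) x) \<Longrightarrow> \<epsilon> x (d 0 x u) = \<zero>\<^bsub>val M x\<^esub>"
    "x \<in> Obj C \<Longrightarrow> u \<in> carrier (val (P (Suc (Suc n))) x) \<Longrightarrow>
      d n x (d (Suc n) x u) = \<zero>\<^bsub>val (P n) x\<^esub>"
    "x \<in> Obj C \<Longrightarrow> v \<in> carrier (val (P 0) x) \<Longrightarrow> \<epsilon> x v = \<zero>\<^bsub>val M x\<^esub> \<Longrightarrow>
      v \<in> d 0 x ` carrier (val (P (Suc 0)) x)"
    "x \<in> Obj C \<Longrightarrow> w \<in> carrier (val (P (Suc n)) x) \<Longrightarrow> d n x w = \<zero>\<^bsub>val (P n) x\<^esub> \<Longrightarrow>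
      w \<in> d (Suc n) x ` carrier (val (P (Suc (Suc n))) x)"
proof -
  have e0: "d 0 x ` carrier (val (P (Suc 0)) x) = mod_kernel (val (P 0) x) (val M x) (\<epsilon> x)"
    and e1: "d (Suc n) x ` carrier (val (P (Suc (Suc n))) x) = mod_kernel (val (P (Suc n)) x) (val (P n) x) (d n x)"
    if "x \<in> Obj C" for x n
    using assms that by (auto simp: projective_resolution_def)
  show "cat_projective C R (P n)" "d n \<in> nat_trans C R (P (Suc n)) (P n)" "\<epsilon> \<in> nat_trans C R (P 0) M"
    "x \<in> Obj C \<Longrightarrow> \<epsilon> x ` carrier (val (P 0) x) = carrier (val M x)"
    using assms by (auto simp: projective_resolution_def nat_epi_def)
  then show "cat_module C R (P n)" by (simp add: cat_projective_def)
  show "x \<in> Obj C \<Longrightarrow> u \<in> carrier (val (P (Suc 0)) x) \<Longrightarrow> \<epsilon> x (d 0 x u) = \<zero>\<^bsub>val M x\<^esub>"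
    using e0 by (fastforce simp: mod_kernel_def)
  show "x \<in> Obj C \<Longrightarrow> u \<in> carrier (val (P (Suc (Suc n))) x) \<Longrightarrow> d n x (d (Suc n) x u) = \<zero>\<^bsub>val (P n) x\<^esub>"
    using e1 by (fastforce simp: mod_kernel_def)
  show "x \<in> Obj C \<Longrightarrow> v \<in> carrier (val (P 0) x) \<Longrightarrow> \<epsilon> x v = \<zero>\<^bsub>val M x\<^esub> \<Longrightarrow>
      v \<in> d 0 x ` carrier (val (P (Suc 0)) x)"
    using e0 by (simp add: mod_kernel_def)
  show "x \<in> Obj C \<Longrightarrow> w \<in> carrier (val (P (Suc n)) x) \<Longrightarrow> d n x w = \<zero>\<^bsub>val (P n) x\<^esub> \<Longrightarrow>
      w \<in> d (Suc n) x ` carrier (val (P (Suc (Suc n))) x)"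
    using e1 by (simp add: mod_kernel_def)
qed

lemma module_minus_eq_zero_iff:
  assumes "module R M" "u \<in> carrier M" "v \<in> carrier M"
  shows "u \<ominus>\<^bsub>M\<^esub> v = \<zero>\<^bsub>M\<^esub> \<longleftrightarrow> u = v"
proof -
  interpret M: module R M by fact
  show ?thesis using assms(2,3) by (simp add: a_minus_def M.M.add.inv_solve_right')
qed

lemma nat_trans_at_zero:
  assumes "cat_module C R M" "cat_module C R N" "f \<in> nat_trans C R M N" "x \<in> Obj C"
  shows "f x \<zero>\<^bsub>val M x\<^esub> = \<zero>\<^bsub>val N x\<^esub>"
  using mod_hom_zero[OF cat_moduleD(1)[OF assms(1,4)] cat_moduleD(1)[OF assms(2,4)] nat_transD(1)[OF assms(3,4)]] .

lemma nat_trans_at_minus: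
  assumes "cat_module C R M" "cat_module C R N" "f \<in> nat_trans C R M N" "x \<in> Obj C"
    "u \<in> carrier (val M x)" "v \<in> carrier (val M x)"
  shows "f x (u \<ominus>\<^bsub>val M x\<^esub> v) = f x u \<ominus>\<^bsub>val N x\<^esub> f x v"
  using mod_hom_minus[OF cat_moduleD(1)[OF assms(1,4)] cat_moduleD(1)[OF assms(2,4)] nat_transD(1)[OF assms(3,4)] assms(5,6)] .

text \<open>
  The lifts are built one degree at a time.  For the next lift to exist, the composite of the
  present one with the differential has to land in the image of the differential of \<open>Q\<close>, so this
  is carried along as the invariant; exactness of \<open>Q\<close> reproduces it.
\<close>

lemma chain_map_exists:
  fixes P Q :: "nat \<Rightarrow> ('o, 'a, 'r, 'l \<Rightarrow> 'r) cfunctor" and M :: "('o, 'a, 'r, 'm) cfunctor"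
  assumes R: "cring R" and M: "cat_module C R M"
    and P: "projective_resolution C R M P d \<epsilon>" and Q: "projective_resolution C R M Q d' \<epsilon>'"
  shows "\<exists>f. (\<forall>n. f n \<in> nat_trans C R (P n) (Q n)) \<and>
    (\<forall>x\<in>Obj C. \<forall>u\<in>carrier (val (P 0) x). \<epsilon>' x (f 0 x u) = \<epsilon> x u) \<and>
    (\<forall>n. \<forall>x\<in>Obj C. \<forall>u\<in>carrier (val (P (Suc n)) x). d' n x (f (Suc n) x u) = f n x (d n x u))"
proof -
  note PD = projective_resolutionD[OF P] and QD = projective_resolutionD[OF Q]
  let ?A = "\<lambda>n f. f \<in> nat_trans C R (P n) (Q n) \<and>
    (\<forall>x\<in>Obj C. \<forall>u\<in>carrier (val (P (Suc n)) x). f x (d n x u) \<in> d' n x ` carrier (val (Q (Suc n)) x)) \<and>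
    (n = 0 \<longrightarrow> (\<forall>x\<in>Obj C. \<forall>u\<in>carrier (val (P 0) x). \<epsilon>' x (f x u) = \<epsilon> x u))"
  let ?B = "\<lambda>n f g. \<forall>x\<in>Obj C. \<forall>u\<in>carrier (val (P (Suc n)) x). d' n x (g x u) = f x (d n x u)"
  have "\<exists>f. \<forall>n. ?A n (f n) \<and> ?B n (f n) (f (Suc n))"
  proof (rule dependent_nat_choice)
    have "\<exists>f\<in>nat_trans C R (P 0) (Q 0). \<forall>x\<in>Obj C. \<forall>u\<in>carrier (val (P 0) x). \<epsilon>' x (f x u) = \<epsilon> x u"
      by (rule projective_lift[OF R PD(1) QD(2) M QD(4) PD(4)]) (simp add: QD(5) nat_transD(2)[OF PD(4)])
    then obtain f where f: "f \<in> nat_trans C R (P 0) (Q 0)"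
      and ef: "\<And>x u. x \<in> Obj C \<Longrightarrow> u \<in> carrier (val (P 0) x) \<Longrightarrow> \<epsilon>' x (f x u) = \<epsilon> x u" by blast
    have "f x (d 0 x u) \<in> d' 0 x ` carrier (val (Q (Suc 0)) x)"
      if "x \<in> Obj C" "u \<in> carrier (val (P (Suc 0)) x)" for x u
      using that by (intro QD(8)) (auto simp: ef PD(6) nat_transD(2)[OF f] nat_transD(2)[OF PD(3)])
    with f ef show "\<exists>f. ?A 0 f" by (intro exI[of _ f]) simp
  next
    fix f n assume A: "?A n f"
    let ?h = "nt_restrict C (P (Suc n)) (\<lambda>x u. f x (d n x u))"
    have f: "f \<in> nat_trans C R (P n) (Q n)" using A by blast
    have "\<exists>g\<in>nat_trans C R (P (Suc n)) (Q (Suc n)).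
        \<forall>x\<in>Obj C. \<forall>u\<in>carrier (val (P (Suc n)) x). d' n x (g x u) = ?h x u"
      by (rule projective_lift[OF R PD(1) QD(2) QD(2) QD(3) nat_trans_compose[OF PD(2,3) f]])
        (use A in simp)
    then obtain g where g: "g \<in> nat_trans C R (P (Suc n)) (Q (Suc n))"
      and dg: "\<And>x u. x \<in> Obj C \<Longrightarrow> u \<in> carrier (val (P (Suc n)) x) \<Longrightarrow> d' n x (g x u) = f x (d n x u)"
      by auto
    have "g x (d (Suc n) x u) \<in> d' (Suc n) x ` carrier (val (Q (Suc (Suc n))) x)"
      if "x \<in> Obj C" "u \<in> carrier (val (P (Suc (Suc n))) x)" for x u
      using that
      by (intro QD(9))
        (auto simp: dg PD(7) nat_transD(2)[OF g] nat_transD(2)[OF PD(3)] nat_trans_at_zero[OF PD(2) QD(2) f])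
    with g dg show "\<exists>g. ?A (Suc n) g \<and> ?B n f g" by (intro exI[of _ g]) simp
  qed
  then obtain f where f: "\<forall>n. ?A n (f n) \<and> ?B n (f n) (f (Suc n))" ..
  then show ?thesis using f[THEN spec, of 0] by (intro exI[of _ f]) simp
qed

text \<open>
  A chain map \<open>\<kappa>\<close> over the zero map of \<open>M\<close> is null homotopic.  The invariant says that
  \<open>\<kappa> n - d' n \<circ> h n\<close> vanishes on boundaries, which makes \<open>\<kappa> (Suc n) - h n \<circ> d n\<close> a map into cycles.
\<close>

lemma null_homotopy_exists:
  fixes P Q :: "nat \<Rightarrow> ('o, 'a, 'r, 'l \<Rightarrow> 'r) cfunctor" and M :: "('o, 'a, 'r, 'm) cfunctor"
  assumes R: "cring R" and M: "cat_module C R M"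
    and P: "projective_resolution C R M P d \<epsilon>" and Q: "projective_resolution C R M Q d' \<epsilon>'"
    and \<kappa>: "\<And>n. \<kappa> n \<in> nat_trans C R (P n) (Q n)"
    and \<epsilon>\<kappa>: "\<And>x u. x \<in> Obj C \<Longrightarrow> u \<in> carrier (val (P 0) x) \<Longrightarrow> \<epsilon>' x (\<kappa> 0 x u) = \<zero>\<^bsub>val M x\<^esub>"
    and d\<kappa>: "\<And>n x u. x \<in> Obj C \<Longrightarrow> u \<in> carrier (val (P (Suc n)) x) \<Longrightarrow>
      d' n x (\<kappa> (Suc n) x u) = \<kappa> n x (d n x u)"
  shows "\<exists>h. (\<forall>n. h n \<in> nat_trans C R (P n) (Q (Suc n))) \<and>
    (\<forall>n. \<forall>x\<in>Obj C. \<forall>u\<in>carrier (val (P (Suc n)) x).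
       d' (Suc n) x (h (Suc n) x u) = \<kappa> (Suc n) x u \<ominus>\<^bsub>val (Q (Suc n)) x\<^esub> h n x (d n x u))"
proof -
  note PD = projective_resolutionD[OF P] and QD = projective_resolutionD[OF Q]
  let ?A = "\<lambda>n h. h \<in> nat_trans C R (P n) (Q (Suc n)) \<and>
    (\<forall>x\<in>Obj C. \<forall>u\<in>carrier (val (P (Suc n)) x). d' n x (h x (d n x u)) = \<kappa> n x (d n x u))"
  let ?B = "\<lambda>n h h'. \<forall>x\<in>Obj C. \<forall>u\<in>carrier (val (P (Suc n)) x).
    d' (Suc n) x (h' x u) = \<kappa> (Suc n) x u \<ominus>\<^bsub>val (Q (Suc n)) x\<^esub> h x (d n x u)"
  have "\<exists>h. \<forall>n. ?A n (h n) \<and> ?B n (h n) (h (Suc n))"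
  proof (rule dependent_nat_choice)
    have "\<exists>h\<in>nat_trans C R (P 0) (Q (Suc 0)). \<forall>x\<in>Obj C. \<forall>u\<in>carrier (val (P 0) x). d' 0 x (h x u) = \<kappa> 0 x u"
      by (rule projective_lift[OF R PD(1) QD(2) QD(2) QD(3) \<kappa>])
        (simp add: QD(8) nat_transD(2)[OF \<kappa>] \<epsilon>\<kappa>)
    then show "\<exists>h. ?A 0 h" by (auto simp: nat_transD(2)[OF PD(3)])
  next
    fix h n assume A: "?A n h"
    then have h: "h \<in> nat_trans C R (P n) (Q (Suc n))" by blast
    let ?hd = "nt_restrict C (P (Suc n)) (\<lambda>x u. h x (d n x u))"
    let ?k = "nt_restrict C (P (Suc n)) (\<lambda>x u. \<kappa> (Suc n) x u \<ominus>\<^bsub>val (Q (Suc n)) x\<^esub> ?hd x u)"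
    have hd: "?hd \<in> nat_trans C R (P (Suc n)) (Q (Suc n))"
      by (rule nat_trans_compose[OF PD(2,3) h])
    have k: "?k \<in> nat_trans C R (P (Suc n)) (Q (Suc n))"
      by (rule nat_trans_minus[OF PD(2) QD(2) \<kappa> hd])
    have im: "?k x u \<in> d' (Suc n) x ` carrier (val (Q (Suc (Suc n))) x)"
      if x: "x \<in> Obj C" and u: "u \<in> carrier (val (P (Suc n)) x)" for x u
    proof (rule QD(9)[OF x nat_transD(2)[OF k x u]])
      have du: "d n x u \<in> carrier (val (P n) x)" using nat_transD(2)[OF PD(3) x u] .
      have "d' n x (?k x u) = \<kappa> n x (d n x u) \<ominus>\<^bsub>val (Q n) x\<^esub> \<kappa> n x (d n x u)"
        using x u A du
        by (simp add: nat_trans_at_minus[OF QD(2) QD(2) QD(3)] nat_transD(2)[OF \<kappa>] nat_transD(2)[OF h] d\<kappa>)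
      then show "d' n x (?k x u) = \<zero>\<^bsub>val (Q n) x\<^esub>"
        using nat_transD(2)[OF \<kappa> x du] by (simp add: module_minus_eq_zero_iff[OF cat_moduleD(1)[OF QD(2) x]])
    qed
    obtain h' where h': "h' \<in> nat_trans C R (P (Suc n)) (Q (Suc (Suc n)))"
      and dh': "\<And>x u. x \<in> Obj C \<Longrightarrow> u \<in> carrier (val (P (Suc n)) x) \<Longrightarrow>
        d' (Suc n) x (h' x u) = \<kappa> (Suc n) x u \<ominus>\<^bsub>val (Q (Suc n)) x\<^esub> h x (d n x u)"
      using projective_lift[OF R PD(1) QD(2) QD(2) QD(3) k im] by auto
    have "d' (Suc n) x (h' x (d (Suc n) x u)) = \<kappa> (Suc n) x (d (Suc n) x u)"
      if x: "x \<in> Obj C" and u: "u \<in> carrier (val (P (Suc (Suc n))) x)" for x u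
    proof -
      interpret q: module R "val (Q (Suc n)) x" by (rule cat_moduleD(1)[OF QD(2) x])
      have du: "d (Suc n) x u \<in> carrier (val (P (Suc n)) x)" using nat_transD(2)[OF PD(3) x u] .
      show ?thesis
        using nat_transD(2)[OF \<kappa> x du]
        by (simp add: dh'[OF x du] PD(7)[OF x u] nat_trans_at_zero[OF PD(2) QD(2) h x] a_minus_def)
    qed
    with h' dh' show "\<exists>h'. ?A (Suc n) h' \<and> ?B n h h'" by (intro exI[of _ h']) simp
  qed
  then obtain h where "\<forall>n. ?A n (h n) \<and> ?B n (h n) (h (Suc n))" ..
  then show ?thesis by (intro exI[of _ h]) simp
qed

text \<open>
  A chain map from a resolution to itself over the identity of \<open>M\<close> changes a cocycle only by a
  coboundary, namely the one obtained by composing the cocycle with a null homotopy of the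
  difference to the identity.
\<close>

lemma cocycle_pullback_cohomologous:
  fixes P :: "nat \<Rightarrow> ('o, 'a, 'r, 'l \<Rightarrow> 'r) cfunctor" and M :: "('o, 'a, 'r, 'm) cfunctor"
    and F :: "('o, 'a, 'r, 'n) cfunctor"
  assumes R: "cring R" and M: "cat_module C R M" and F: "cat_module C R F"
    and P: "projective_resolution C R M P d \<epsilon>"
    and c: "\<And>n. c n \<in> nat_trans C R (P n) (P n)"
    and \<epsilon>c: "\<And>x u. x \<in> Obj C \<Longrightarrow> u \<in> carrier (val (P 0) x) \<Longrightarrow> \<epsilon> x (c 0 x u) = \<epsilon> x u"
    and dc: "\<And>n x u. x \<in> Obj C \<Longrightarrow> u \<in> carrier (val (P (Suc n)) x) \<Longrightarrow>
      d n x (c (Suc n) x u) = c n x (d n x u)"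
    and \<phi>: "\<phi> \<in> nat_trans C R (P (Suc k)) F"
    and cocycle: "\<And>x u. x \<in> Obj C \<Longrightarrow> u \<in> carrier (val (P (Suc (Suc k))) x) \<Longrightarrow>
      \<phi> x (d (Suc k) x u) = \<zero>\<^bsub>val F x\<^esub>"
  shows "\<exists>\<theta>\<in>nat_trans C R (P k) F. \<forall>x\<in>Obj C. \<forall>u\<in>carrier (val (P (Suc k)) x).
    \<phi> x u \<ominus>\<^bsub>val F x\<^esub> \<phi> x (c (Suc k) x u) = \<theta> x (d k x u)"
proof -
  note PD = projective_resolutionD[OF P]
  define \<kappa> where "\<kappa> n = nt_restrict C (P n) (\<lambda>x u. nt_restrict C (P n) (\<lambda>x u. u) x u \<ominus>\<^bsub>val (P n) x\<^esub> c n x u)" for n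
  have \<kappa>: "\<kappa> n \<in> nat_trans C R (P n) (P n)" for n
    unfolding \<kappa>_def by (rule nat_trans_minus[OF PD(2) PD(2) nat_trans_id[OF PD(2)] c])
  have \<kappa>_apply: "\<kappa> n x u = u \<ominus>\<^bsub>val (P n) x\<^esub> c n x u"
    if "x \<in> Obj C" "u \<in> carrier (val (P n) x)" for n x u
    using that by (simp add: \<kappa>_def)
  have \<epsilon>\<kappa>: "\<epsilon> x (\<kappa> 0 x u) = \<zero>\<^bsub>val M x\<^esub>" if "x \<in> Obj C" "u \<in> carrier (val (P 0) x)" for x u
    using that
    by (simp add: \<kappa>_apply nat_trans_at_minus[OF PD(2) M PD(4)] nat_transD(2)[OF c] nat_transD(2)[OF PD(4)] \<epsilon>c
        module_minus_eq_zero_iff[OF cat_moduleD(1)[OF M]])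
  have d\<kappa>: "d n x (\<kappa> (Suc n) x u) = \<kappa> n x (d n x u)"
    if "x \<in> Obj C" "u \<in> carrier (val (P (Suc n)) x)" for n x u
    using that
    by (simp add: \<kappa>_apply nat_trans_at_minus[OF PD(2) PD(2) PD(3)] nat_transD(2)[OF c] nat_transD(2)[OF PD(3)] dc)
  obtain h where h: "\<And>n. h n \<in> nat_trans C R (P n) (P (Suc n))"
    and dh: "\<And>n x u. x \<in> Obj C \<Longrightarrow> u \<in> carrier (val (P (Suc n)) x) \<Longrightarrow>
       d (Suc n) x (h (Suc n) x u) = \<kappa> (Suc n) x u \<ominus>\<^bsub>val (P (Suc n)) x\<^esub> h n x (d n x u)"
    using null_homotopy_exists[where \<kappa> = \<kappa>, OF R M P P \<kappa> \<epsilon>\<kappa> d\<kappa>] by blast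
  have "\<phi> x u \<ominus>\<^bsub>val F x\<^esub> \<phi> x (c (Suc k) x u) = \<phi> x (h k x (d k x u))"
    if x: "x \<in> Obj C" and u: "u \<in> carrier (val (P (Suc k)) x)" for x u
  proof -
    note du = nat_transD(2)[OF PD(3) x u]
    note hdu = nat_transD(2)[OF h x du] and hu = nat_transD(2)[OF h x u]
      and cu = nat_transD(2)[OF c x u] and ku = nat_transD(2)[OF \<kappa> x u]
    note \<phi>m = nat_trans_at_minus[OF PD(2) F \<phi> x]
    note cl = nat_transD(2)[OF \<phi> x]
    have "\<phi> x (\<kappa> (Suc k) x u) \<ominus>\<^bsub>val F x\<^esub> \<phi> x (h k x (d k x u)) = \<phi> x (d (Suc k) x (h (Suc k) x u))"
      by (simp add: dh[OF x u] \<phi>m[OF ku hdu])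
    also have "\<dots> = \<zero>\<^bsub>val F x\<^esub>" by (rule cocycle[OF x hu])
    finally have "\<phi> x (\<kappa> (Suc k) x u) = \<phi> x (h k x (d k x u))"
      by (simp add: module_minus_eq_zero_iff[OF cat_moduleD(1)[OF F x]] cl ku hdu)
    then show ?thesis by (simp add: \<kappa>_apply[OF x u] \<phi>m[OF u cu])
  qed
  with nat_trans_compose[OF PD(2) h[of k] \<phi>] show ?thesis
    by (intro bexI[where x = "nt_restrict C (P k) (\<lambda>x u. \<phi> x (h k x u))"]) (auto simp: nat_transD(2)[OF PD(3)])
qed

lemma coboundary_eq_nt_restrict:
  "coboundary C P d n \<phi> = nt_restrict C (P (Suc n)) (\<lambda>x u. \<phi> x (d n x u))"
  by (simp add: coboundary_def nt_restrict_def)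

lemma coboundary_mod_hom:
  assumes P: "\<And>n. cat_module C R (P n)" and d: "\<And>n. d n \<in> nat_trans C R (P (Suc n)) (P n)"
    and F: "cat_module C R F"
  shows "coboundary C P d n \<in> mod_hom R (nat_trans_module C R (P n) F) (nat_trans_module C R (P (Suc n)) F)"
proof (rule mod_homI)
  fix \<phi> \<psi> assume "\<phi> \<in> carrier (nat_trans_module C R (P n) F)" "\<psi> \<in> carrier (nat_trans_module C R (P n) F)"
  show "coboundary C P d n (\<phi> \<oplus>\<^bsub>nat_trans_module C R (P n) F\<^esub> \<psi>) =
    coboundary C P d n \<phi> \<oplus>\<^bsub>nat_trans_module C R (P (Suc n)) F\<^esub> coboundary C P d n \<psi>"
    by (auto simp: coboundary_eq_nt_restrict nt_restrict_def nat_transD(2)[OF d] intro!: restrict_ext)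
next
  fix r \<phi>
  show "coboundary C P d n (r \<odot>\<^bsub>nat_trans_module C R (P n) F\<^esub> \<phi>) =
    r \<odot>\<^bsub>nat_trans_module C R (P (Suc n)) F\<^esub> coboundary C P d n \<phi>"
    by (auto simp: coboundary_eq_nt_restrict nt_restrict_def nat_transD(2)[OF d] intro!: restrict_ext)
qed (simp add: coboundary_eq_nt_restrict nat_trans_compose[OF P d])

lemma Hom_cocycles_iff:
  "\<phi> \<in> Hom_cocycles C R P d F n \<longleftrightarrow> \<phi> \<in> nat_trans C R (P n) F \<and>
    (\<forall>x\<in>Obj C. \<forall>u\<in>carrier (val (P (Suc n)) x). \<phi> x (d n x u) = \<zero>\<^bsub>val F x\<^esub>)"
  by (simp add: Hom_cocycles_def mod_kernel_def coboundary_eq_nt_restrict nt_restrict_def restrict_eq_iff)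

lemma Hom_coboundaries_Suc_iff:
  assumes P: "\<And>n. cat_module C R (P n)" and d: "\<And>n. d n \<in> nat_trans C R (P (Suc n)) (P n)"
  shows "\<phi> \<in> Hom_coboundaries C R P d F (Suc k) \<longleftrightarrow> \<phi> \<in> nat_trans C R (P (Suc k)) F \<and>
    (\<exists>\<theta>\<in>nat_trans C R (P k) F. \<forall>x\<in>Obj C. \<forall>u\<in>carrier (val (P (Suc k)) x). \<phi> x u = \<theta> x (d k x u))"
    (is "_ \<longleftrightarrow> ?r")
proof
  assume "\<phi> \<in> Hom_coboundaries C R P d F (Suc k)"
  then show ?r
    by (auto simp: Hom_coboundaries_def coboundary_eq_nt_restrict nat_trans_compose[OF P d])
next
  assume ?r
  then obtain \<theta> where \<phi>: "\<phi> \<in> nat_trans C R (P (Suc k)) F" and \<theta>: "\<theta> \<in> nat_trans C R (P k) F"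
    and eq: "\<And>x u. x \<in> Obj C \<Longrightarrow> u \<in> carrier (val (P (Suc k)) x) \<Longrightarrow> \<phi> x u = \<theta> x (d k x u)" by blast
  have "\<phi> = coboundary C P d k \<theta>"
    unfolding coboundary_eq_nt_restrict
    by (rule nat_trans_eqI[OF \<phi> nat_trans_compose[OF P d \<theta>]]) (simp add: eq)
  with \<theta> show "\<phi> \<in> Hom_coboundaries C R P d F (Suc k)" by (simp add: Hom_coboundaries_def)
qed

lemma Hom_cohomology_submodules:
  assumes R: "cring R" and P: "\<And>n. cat_module C R (P n)" and F: "cat_module C R F"
    and d: "\<And>n. d n \<in> nat_trans C R (P (Suc n)) (P n)"
    and dd: "\<And>n x u. x \<in> Obj C \<Longrightarrow> u \<in> carrier (val (P (Suc (Suc n))) x) \<Longrightarrow>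
      d n x (d (Suc n) x u) = \<zero>\<^bsub>val (P n) x\<^esub>"
  shows "module R (mod_restrict (nat_trans_module C R (P (Suc k)) F) (Hom_cocycles C R P d F (Suc k)))"
    and "submodule (Hom_coboundaries C R P d F (Suc k)) R
      (mod_restrict (nat_trans_module C R (P (Suc k)) F) (Hom_cocycles C R P d F (Suc k)))"
proof -
  note nm = nat_trans_module_module[OF R P F]
    and ch = coboundary_mod_hom[where P = P and d = d, OF P d F]
  have Z: "submodule (Hom_cocycles C R P d F (Suc k)) R (nat_trans_module C R (P (Suc k)) F)"
    unfolding Hom_cocycles_def by (rule submodule_kernel[OF nm nm ch])
  then show "module R (mod_restrict (nat_trans_module C R (P (Suc k)) F) (Hom_cocycles C R P d F (Suc k)))"
    by (rule mod_restrict_module[OF nm])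
  have B: "submodule (Hom_coboundaries C R P d F (Suc k)) R (nat_trans_module C R (P (Suc k)) F)"
    using submodule_image[OF nm nm ch] by (simp add: Hom_coboundaries_def)
  have "Hom_coboundaries C R P d F (Suc k) \<subseteq> Hom_cocycles C R P d F (Suc k)"
    by (auto simp: Hom_coboundaries_Suc_iff[where P = P and d = d, OF P d] Hom_cocycles_iff nat_transD(2)[OF d] dd nat_trans_at_zero[OF P F])
  with B show "submodule (Hom_coboundaries C R P d F (Suc k)) R
      (mod_restrict (nat_trans_module C R (P (Suc k)) F) (Hom_cocycles C R P d F (Suc k)))"
    by (intro submodule_restrict[OF nm Z])
qed

text \<open>
  Composition with a comparison map \<open>f\<close> is a bijection on classes, with inverse composition with a
  comparison map \<open>g\<close> in the other direction: both \<open>f \<circ> g\<close> and \<open>g \<circ> f\<close> lie over the identity of \<open>M\<close>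
  and so change cocycles by coboundaries only.
\<close>

theorem Hom_cohomology_independent:
  fixes P Q :: "nat \<Rightarrow> ('o, 'a, 'r, 'l \<Rightarrow> 'r) cfunctor" and M :: "('o, 'a, 'r, 'm) cfunctor"
    and F :: "('o, 'a, 'r, 'n) cfunctor"
  assumes R: "cring R" and M: "cat_module C R M" and F: "cat_module C R F"
    and P: "projective_resolution C R M P d \<epsilon>" and Q: "projective_resolution C R M Q d' \<epsilon>'"
  shows "mod_iso R (Hom_cohomology C R Q d' F (Suc k)) (Hom_cohomology C R P d F (Suc k))"
proof -
  note PD = projective_resolutionD[OF P] and QD = projective_resolutionD[OF Q]
  obtain f where f: "\<And>n. f n \<in> nat_trans C R (P n) (Q n)"
    and \<epsilon>f: "\<And>x u. x \<in> Obj C \<Longrightarrow> u \<in> carrier (val (P 0) x) \<Longrightarrow> \<epsilon>' x (f 0 x u) = \<epsilon> x u"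
    and df: "\<And>n x u. x \<in> Obj C \<Longrightarrow> u \<in> carrier (val (P (Suc n)) x) \<Longrightarrow>
      d' n x (f (Suc n) x u) = f n x (d n x u)"
    using chain_map_exists[OF R M P Q] by blast
  obtain g where g: "\<And>n. g n \<in> nat_trans C R (Q n) (P n)"
    and \<epsilon>g: "\<And>x u. x \<in> Obj C \<Longrightarrow> u \<in> carrier (val (Q 0) x) \<Longrightarrow> \<epsilon> x (g 0 x u) = \<epsilon>' x u"
    and dg: "\<And>n x u. x \<in> Obj C \<Longrightarrow> u \<in> carrier (val (Q (Suc n)) x) \<Longrightarrow>
      d n x (g (Suc n) x u) = g n x (d' n x u)"
    using chain_map_exists[OF R M Q P] by blast
  note fc = nat_transD(2)[OF f] and gc = nat_transD(2)[OF g]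
    and dc = nat_transD(2)[OF PD(3)] and dc' = nat_transD(2)[OF QD(3)]
  have coQ: "\<exists>\<theta>\<in>nat_trans C R (Q k) F. \<forall>x\<in>Obj C. \<forall>u\<in>carrier (val (Q (Suc k)) x).
      \<phi> x u \<ominus>\<^bsub>val F x\<^esub> \<phi> x (f (Suc k) x (g (Suc k) x u)) = \<theta> x (d' k x u)"
    if \<phi>: "\<phi> \<in> Hom_cocycles C R Q d' F (Suc k)" for \<phi>
    using cocycle_pullback_cohomologous[OF R M F Q, of "\<lambda>n. nt_restrict C (Q n) (\<lambda>x u. f n x (g n x u))" \<phi> k] \<phi>
    by (simp add: nat_trans_compose[OF QD(2) g f] gc fc dc' \<epsilon>f \<epsilon>g df dg Hom_cocycles_iff)
  have coP: "\<exists>\<theta>\<in>nat_trans C R (P k) F. \<forall>x\<in>Obj C. \<forall>u\<in>carrier (val (P (Suc k)) x).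
      \<phi> x u \<ominus>\<^bsub>val F x\<^esub> \<phi> x (g (Suc k) x (f (Suc k) x u)) = \<theta> x (d k x u)"
    if \<phi>: "\<phi> \<in> Hom_cocycles C R P d F (Suc k)" for \<phi>
    using cocycle_pullback_cohomologous[OF R M F P, of "\<lambda>n. nt_restrict C (P n) (\<lambda>x u. g n x (f n x u))" \<phi> k] \<phi>
    by (simp add: nat_trans_compose[OF PD(2) f g] gc fc dc \<epsilon>f \<epsilon>g df dg Hom_cocycles_iff)
  let ?ZQ = "mod_restrict (nat_trans_module C R (Q (Suc k)) F) (Hom_cocycles C R Q d' F (Suc k))"
  let ?ZP = "mod_restrict (nat_trans_module C R (P (Suc k)) F) (Hom_cocycles C R P d F (Suc k))"
  note sQ = Hom_cohomology_submodules[where P = Q and d = d', OF R QD(2) F QD(3) QD(7)]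
    and sP = Hom_cohomology_submodules[where P = P and d = d, OF R PD(2) F PD(3) PD(7)]
  note BQ = Hom_coboundaries_Suc_iff[where P = Q and d = d', OF QD(2,3)] and BP = Hom_coboundaries_Suc_iff[where P = P and d = d, OF PD(2,3)]
  let ?\<Phi> = "\<lambda>\<phi>. nt_restrict C (P (Suc k)) (\<lambda>x u. \<phi> x (f (Suc k) x u))"
  have \<Phi>nat: "?\<Phi> \<phi> \<in> nat_trans C R (P (Suc k)) F" if "\<phi> \<in> nat_trans C R (Q (Suc k)) F" for \<phi>
    by (rule nat_trans_compose[OF PD(2) f that])
  have \<Phi>: "?\<Phi> \<in> mod_hom R ?ZQ ?ZP"
  proof (rule mod_homI)
    fix \<phi> assume "\<phi> \<in> carrier ?ZQ"
    then show "?\<Phi> \<phi> \<in> carrier ?ZP"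
      by (auto simp: Hom_cocycles_iff \<Phi>nat dc fc simp flip: df)
  qed (auto simp: nt_restrict_def fc intro!: restrict_ext)
  have min: "\<phi> \<ominus>\<^bsub>?ZP\<^esub> \<psi> = \<phi> \<ominus>\<^bsub>nat_trans_module C R (P (Suc k)) F\<^esub> \<psi>"
    if "\<phi> \<in> carrier ?ZP" "\<psi> \<in> carrier ?ZP" for \<phi> \<psi>
  proof -
    have "(\<lambda>u. u) \<in> mod_hom R ?ZP (nat_trans_module C R (P (Suc k)) F)"
      by (rule mod_homI) (auto simp: Hom_cocycles_iff)
    from mod_hom_minus[OF sP(1) nat_trans_module_module[OF R PD(2) F] this that] show ?thesis .
  qed
  show ?thesis
    unfolding Hom_cohomology_def
  proof (rule mod_quotient_iso[OF sQ(1) sP(1) sQ(2) sP(2) \<Phi>])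
    fix \<phi> assume \<phi>: "\<phi> \<in> Hom_coboundaries C R Q d' F (Suc k)"
    then obtain \<theta> where \<theta>: "\<theta> \<in> nat_trans C R (Q k) F"
      "\<And>x u. x \<in> Obj C \<Longrightarrow> u \<in> carrier (val (Q (Suc k)) x) \<Longrightarrow> \<phi> x u = \<theta> x (d' k x u)"
      by (auto simp: BQ)
    show "?\<Phi> \<phi> \<in> Hom_coboundaries C R P d F (Suc k)"
      unfolding BP
    proof (intro conjI bexI ballI)
      show "nt_restrict C (P k) (\<lambda>x u. \<theta> x (f k x u)) \<in> nat_trans C R (P k) F"
        by (rule nat_trans_compose[OF PD(2) f \<theta>(1)])
    qed (use \<phi> in \<open>auto simp: BQ \<Phi>nat fc dc \<theta>(2) df\<close>)
  next
    fix \<phi> assume \<phi>: "\<phi> \<in> carrier ?ZQ" and B: "?\<Phi> \<phi> \<in> Hom_coboundaries C R P d F (Suc k)"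
    then have \<phi>n: "\<phi> \<in> nat_trans C R (Q (Suc k)) F" by (simp add: Hom_cocycles_iff)
    obtain \<theta> where \<theta>: "\<theta> \<in> nat_trans C R (P k) F"
      "\<And>x u. x \<in> Obj C \<Longrightarrow> u \<in> carrier (val (P (Suc k)) x) \<Longrightarrow> \<phi> x (f (Suc k) x u) = \<theta> x (d k x u)"
      using B by (auto simp: BP)
    obtain \<rho> where \<rho>: "\<rho> \<in> nat_trans C R (Q k) F"
      "\<And>x u. x \<in> Obj C \<Longrightarrow> u \<in> carrier (val (Q (Suc k)) x) \<Longrightarrow>
        \<phi> x u \<ominus>\<^bsub>val F x\<^esub> \<phi> x (f (Suc k) x (g (Suc k) x u)) = \<rho> x (d' k x u)"
      using coQ[of \<phi>] \<phi> by auto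
    let ?\<theta>g = "nt_restrict C (Q k) (\<lambda>x u. \<theta> x (g k x u))"
    have \<theta>g: "?\<theta>g \<in> nat_trans C R (Q k) F" by (rule nat_trans_compose[OF QD(2) g \<theta>(1)])
    show "\<phi> \<in> Hom_coboundaries C R Q d' F (Suc k)"
      unfolding BQ
    proof (intro conjI bexI ballI \<phi>n)
      show "nt_restrict C (Q k) (\<lambda>x u. \<rho> x u \<oplus>\<^bsub>val F x\<^esub> ?\<theta>g x u) \<in> nat_trans C R (Q k) F"
        by (rule nat_trans_add[OF QD(2) F \<rho>(1) \<theta>g])
      fix x u assume x: "x \<in> Obj C" and u: "u \<in> carrier (val (Q (Suc k)) x)"
      interpret Fx: module R "val F x" by (rule cat_moduleD(1)[OF F x])
      note gu = gc[OF x u] and pu = nat_transD(2)[OF \<phi>n x u]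
      note pfg = nat_transD(2)[OF \<phi>n x fc[OF x gu]]
      have "\<phi> x u = (\<phi> x u \<ominus>\<^bsub>val F x\<^esub> \<phi> x (f (Suc k) x (g (Suc k) x u))) \<oplus>\<^bsub>val F x\<^esub> \<phi> x (f (Suc k) x (g (Suc k) x u))"
        using pu pfg by (simp add: a_minus_def Fx.M.a_assoc Fx.M.l_neg)
      also have "\<dots> = \<rho> x (d' k x u) \<oplus>\<^bsub>val F x\<^esub> \<theta> x (g k x (d' k x u))"
        unfolding \<rho>(2)[OF x u] by (simp only: \<theta>(2)[OF x gu] dg[OF x u])
      finally show "\<phi> x u = nt_restrict C (Q k) (\<lambda>x u. \<rho> x u \<oplus>\<^bsub>val F x\<^esub> ?\<theta>g x u) x (d' k x u)"
        using x dc'[OF x u] by simp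
    qed
  next
    fix \<phi> assume \<phi>: "\<phi> \<in> carrier ?ZP"
    then have \<phi>n: "\<phi> \<in> nat_trans C R (P (Suc k)) F"
      and cocycle: "\<And>x u. x \<in> Obj C \<Longrightarrow> u \<in> carrier (val (P (Suc (Suc k))) x) \<Longrightarrow> \<phi> x (d (Suc k) x u) = \<zero>\<^bsub>val F x\<^esub>"
      by (auto simp: Hom_cocycles_iff)
    let ?\<psi> = "nt_restrict C (Q (Suc k)) (\<lambda>x u. \<phi> x (g (Suc k) x u))"
    have \<psi>: "?\<psi> \<in> nat_trans C R (Q (Suc k)) F" by (rule nat_trans_compose[OF QD(2) g \<phi>n])
    have \<psi>Z: "?\<psi> \<in> carrier ?ZQ"
      using \<psi> by (auto simp: Hom_cocycles_iff dc' gc cocycle simp flip: dg)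
    have eq: "(\<phi> \<ominus>\<^bsub>?ZP\<^esub> ?\<Phi> ?\<psi>) = \<phi> \<ominus>\<^bsub>nat_trans_module C R (P (Suc k)) F\<^esub> ?\<Phi> ?\<psi>"
      by (rule min[OF \<phi> mod_hom_closed[OF \<Phi> \<psi>Z]])
    interpret nm: module R "nat_trans_module C R (P (Suc k)) F"
      by (rule nat_trans_module_module[OF R PD(2) F])
    have "\<phi> \<ominus>\<^bsub>?ZP\<^esub> ?\<Phi> ?\<psi> \<in> Hom_coboundaries C R P d F (Suc k)"
      unfolding BP eq
    proof (intro conjI)
      show "\<phi> \<ominus>\<^bsub>nat_trans_module C R (P (Suc k)) F\<^esub> ?\<Phi> ?\<psi> \<in> nat_trans C R (P (Suc k)) F"
        using nm.minus_closed[of \<phi> "?\<Phi> ?\<psi>"] \<phi>n \<Phi>nat[OF \<psi>] by simp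
      show "\<exists>\<theta>\<in>nat_trans C R (P k) F. \<forall>x\<in>Obj C. \<forall>u\<in>carrier (val (P (Suc k)) x).
          (\<phi> \<ominus>\<^bsub>nat_trans_module C R (P (Suc k)) F\<^esub> ?\<Phi> ?\<psi>) x u = \<theta> x (d k x u)"
        using coP[of \<phi>] \<phi> by (simp add: nat_trans_minus_apply[OF R PD(2) F \<phi>n \<Phi>nat[OF \<psi>]] fc)
    qed
    with \<psi>Z show "\<exists>\<psi>\<in>carrier ?ZQ. \<phi> \<ominus>\<^bsub>?ZP\<^esub> ?\<Phi> \<psi> \<in> Hom_coboundaries C R P d F (Suc k)" by blast
  qed
qed

section \<open>Free modules on finite sets\<close>

definition free_module :: "('r, 's) ring_scheme \<Rightarrow> 'i set \<Rightarrow> ('r, 'i \<Rightarrow> 'r) module"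
  where "free_module R I =
    \<lparr>carrier = I \<rightarrow>\<^sub>E carrier R, monoid.mult = undefined, one = undefined,
     zero = (\<lambda>i\<in>I. \<zero>\<^bsub>R\<^esub>), add = (\<lambda>u v. \<lambda>i\<in>I. u i \<oplus>\<^bsub>R\<^esub> v i),
     smult = (\<lambda>r u. \<lambda>i\<in>I. r \<otimes>\<^bsub>R\<^esub> u i)\<rparr>"

definition unit_vector :: "('r, 's) ring_scheme \<Rightarrow> 'i set \<Rightarrow> 'i \<Rightarrow> 'i \<Rightarrow> 'r"
  where "unit_vector R I i = (\<lambda>j\<in>I. if j = i then \<one>\<^bsub>R\<^esub> else \<zero>\<^bsub>R\<^esub>)"

definition linear_combination ::
  "('r, 'm) module \<Rightarrow> 'i set \<Rightarrow> ('i \<Rightarrow> 'm) \<Rightarrow> ('i \<Rightarrow> 'r) \<Rightarrow> 'm"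
  where "linear_combination M I b u = (\<Oplus>\<^bsub>M\<^esub>i\<in>I. u i \<odot>\<^bsub>M\<^esub> b i)"

lemma free_module_simps [simp]:
  "carrier (free_module R I) = I \<rightarrow>\<^sub>E carrier R"
  "\<zero>\<^bsub>free_module R I\<^esub> = (\<lambda>i\<in>I. \<zero>\<^bsub>R\<^esub>)"
  "u \<oplus>\<^bsub>free_module R I\<^esub> v = (\<lambda>i\<in>I. u i \<oplus>\<^bsub>R\<^esub> v i)"
  "r \<odot>\<^bsub>free_module R I\<^esub> u = (\<lambda>i\<in>I. r \<otimes>\<^bsub>R\<^esub> u i)"
  by (simp_all add: free_module_def)

lemma free_module_module:
  assumes R: "cring R" shows "module R (free_module R I)"
proof -
  interpret R: cring R by fact
  show ?thesis
  proof (rule module_if_separated[OF R, where K = I and \<pi> = "\<lambda>i u. u i" and N = "\<lambda>_. regular_module R"])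
    show "(\<lambda>u. u i) \<in> mod_hom R (free_module R I) (regular_module R)" if "i \<in> I" for i
      using that by (intro mod_homI) (auto simp: regular_module_def)
    show "u = v" if "u \<in> carrier (free_module R I)" "v \<in> carrier (free_module R I)" "\<And>i. i \<in> I \<Longrightarrow> u i = v i" for u v
      using that by (auto intro: PiE_ext)
    show "module R (regular_module R)" by (rule regular_module_module[OF R])
  qed (auto simp: regular_module_def)
qed

lemma unit_vector_carrier:
  assumes "cring R" shows "unit_vector R I i \<in> carrier (free_module R I)"
proof -
  interpret R: cring R by fact
  show ?thesis by (auto simp: unit_vector_def)
qed

lemma linear_combination_mod_hom:
  assumes M: "module R M" and b: "\<And>i. i \<in> I \<Longrightarrow> b i \<in> carrier M"
  shows "linear_combination M I b \<in> mod_hom R (free_module R I) M"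
proof -
  interpret M: module R M by fact
  show ?thesis
  proof (rule mod_homI)
    fix u assume u: "u \<in> carrier (free_module R I)"
    then have uc: "u i \<in> carrier R" if "i \<in> I" for i using that by auto
    show "linear_combination M I b u \<in> carrier M"
      using uc b by (auto simp: linear_combination_def intro!: M.M.finsum_closed)
    { fix v assume v: "v \<in> carrier (free_module R I)"
      then have vc: "v i \<in> carrier R" if "i \<in> I" for i using that by auto
      have "linear_combination M I b (u \<oplus>\<^bsub>free_module R I\<^esub> v) =
          (\<Oplus>\<^bsub>M\<^esub>i\<in>I. u i \<odot>\<^bsub>M\<^esub> b i \<oplus>\<^bsub>M\<^esub> v i \<odot>\<^bsub>M\<^esub> b i)"
        unfolding linear_combination_def using uc vc b
        by (intro M.M.finsum_cong') (auto simp: M.smult_l_distr)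
      also have "\<dots> = linear_combination M I b u \<oplus>\<^bsub>M\<^esub> linear_combination M I b v"
        unfolding linear_combination_def using uc vc b by (intro M.M.finsum_addf) auto
      finally show "linear_combination M I b (u \<oplus>\<^bsub>free_module R I\<^esub> v) =
        linear_combination M I b u \<oplus>\<^bsub>M\<^esub> linear_combination M I b v" . }
    { fix r assume r: "r \<in> carrier R"
      have "linear_combination M I b (r \<odot>\<^bsub>free_module R I\<^esub> u) =
          (\<Oplus>\<^bsub>M\<^esub>i\<in>I. r \<odot>\<^bsub>M\<^esub> (u i \<odot>\<^bsub>M\<^esub> b i))"
        unfolding linear_combination_def using uc r b
        by (intro M.M.finsum_cong') (auto simp: M.smult_assoc1)
      also have "\<dots> = r \<odot>\<^bsub>M\<^esub> linear_combination M I b u"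
      proof (cases "finite I")
        case True
        then show ?thesis unfolding linear_combination_def
          using uc r b by (intro M.finsum_smult_ldistr[symmetric]) auto
      next
        case False
        then show ?thesis using r by (simp add: linear_combination_def)
      qed
      finally show "linear_combination M I b (r \<odot>\<^bsub>free_module R I\<^esub> u) = r \<odot>\<^bsub>M\<^esub> linear_combination M I b u" . }
  qed
qed

lemma linear_combination_unit_vector:
  assumes M: "module R M" and I: "finite I" "i \<in> I" and b: "\<And>i. i \<in> I \<Longrightarrow> b i \<in> carrier M"
  shows "linear_combination M I b (unit_vector R I i) = b i"
proof -
  interpret M: module R M by fact
  have "linear_combination M I b (unit_vector R I i) = (\<Oplus>\<^bsub>M\<^esub>j\<in>I. if i = j then b j else \<zero>\<^bsub>M\<^esub>)"
    unfolding linear_combination_def using b by (intro M.M.finsum_cong') (auto simp: unit_vector_def)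
  also have "\<dots> = b i"
    using M.M.finsum_singleton[OF I(2,1), of b] b by auto
  finally show ?thesis .
qed

text \<open>
  A linear map out of a free module is determined by its values on unit vectors.  All
  identities between maps of free modules below are checked in this way.
\<close>

lemma free_module_hom_eqI:
  assumes R: "cring R" and I: "finite I"
    and f: "f \<in> mod_hom R (free_module R I) M" and g: "g \<in> mod_hom R (free_module R I) M"
    and M: "module R M"
    and eq: "\<And>i. i \<in> I \<Longrightarrow> f (unit_vector R I i) = g (unit_vector R I i)"
    and u: "u \<in> carrier (free_module R I)"
  shows "f u = g u"
proof -
  interpret R: cring R by fact
  note F = free_module_module[OF R, of I]
  have "\<forall>u\<in>carrier (free_module R I). (\<forall>i\<in>I - J. u i = \<zero>\<^bsub>R\<^esub>) \<longrightarrow> f u = g u" if "J \<subseteq> I" for J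
    using finite_subset[OF that I] that
  proof (induction J)
    case empty
    have "u = \<zero>\<^bsub>free_module R I\<^esub>" if "u \<in> carrier (free_module R I)" "\<forall>i\<in>I. u i = \<zero>\<^bsub>R\<^esub>" for u
      using that by (auto intro!: PiE_ext)
    then show ?case using mod_hom_zero[OF F M f] mod_hom_zero[OF F M g] by auto
  next
    case (insert j J)
    show ?case
    proof (intro ballI impI)
      fix u assume u: "u \<in> carrier (free_module R I)" and sup: "\<forall>i\<in>I - insert j J. u i = \<zero>\<^bsub>R\<^esub>"
      have j: "j \<in> I" and uj: "u j \<in> carrier R" and uc: "\<And>i. i \<in> I \<Longrightarrow> u i \<in> carrier R"
        using insert.prems u by auto
      define w where "w = (\<lambda>i\<in>I. if i = j then \<zero>\<^bsub>R\<^esub> else u i)"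
      have w: "w \<in> carrier (free_module R I)" using u by (auto simp: w_def)
      let ?e = "unit_vector R I j"
      note e = unit_vector_carrier[OF R, of I j]
      have ue: "u = w \<oplus>\<^bsub>free_module R I\<^esub> u j \<odot>\<^bsub>free_module R I\<^esub> ?e"
        using u uj uc by (intro PiE_ext[where k = I and s = "\<lambda>_. carrier R"]) (auto simp: w_def unit_vector_def)
      have ec: "u j \<odot>\<^bsub>free_module R I\<^esub> ?e \<in> carrier (free_module R I)"
        using module.smult_closed[OF F uj e] .
      have "f w = g w" using insert sup w by (auto simp: w_def)
      then show "f u = g u"
        by (subst (1 2) ue)
          (simp only: mod_hom_add[OF f w ec] mod_hom_add[OF g w ec] mod_hom_smult[OF f uj e]
            mod_hom_smult[OF g uj e] eq[OF j])
    qed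
  qed
  from this[of I] u show ?thesis by auto
qed

section \<open>Projective resolutions over a finite category\<close>

locale finite_cat =
  fixes C :: "('o, 'a) cat"
  assumes finite_Obj: "finite (Obj C)"
    and finite_Hom: "x \<in> Obj C \<Longrightarrow> y \<in> Obj C \<Longrightarrow> finite (Hom C x y)"
    and Idn_Hom: "x \<in> Obj C \<Longrightarrow> Idn C x \<in> Hom C x x"
    and Cmp_Hom: "x \<in> Obj C \<Longrightarrow> y \<in> Obj C \<Longrightarrow> z \<in> Obj C \<Longrightarrow> a \<in> Hom C x y \<Longrightarrow> b \<in> Hom C y z \<Longrightarrow>
      Cmp C b a \<in> Hom C x z"
    and Cmp_Idn_left: "x \<in> Obj C \<Longrightarrow> y \<in> Obj C \<Longrightarrow> a \<in> Hom C x y \<Longrightarrow> Cmp C (Idn C y) a = a"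
    and Cmp_Idn_right: "x \<in> Obj C \<Longrightarrow> y \<in> Obj C \<Longrightarrow> a \<in> Hom C x y \<Longrightarrow> Cmp C a (Idn C x) = a"
    and Cmp_assoc: "w \<in> Obj C \<Longrightarrow> x \<in> Obj C \<Longrightarrow> y \<in> Obj C \<Longrightarrow> z \<in> Obj C \<Longrightarrow>
      a \<in> Hom C w x \<Longrightarrow> b \<in> Hom C x y \<Longrightarrow> c \<in> Hom C y z \<Longrightarrow>
      Cmp C c (Cmp C b a) = Cmp C (Cmp C c b) a"
begin

text \<open>
  The generators at \<open>x\<close> of the free module on generators \<open>s \<in> S y\<close> placed at \<open>y\<close> are the formal
  restrictions of \<open>s\<close> along arrows \<open>x \<rightarrow> y\<close>.  Recording them as lists lets the construction be
  iterated without leaving the type of lists.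
\<close>

definition gens :: "('o \<Rightarrow> ('o \<times> 'a) list set) \<Rightarrow> 'o \<Rightarrow> ('o \<times> 'a) list set"
  where "gens S x = {(y, a) # s | y a s. y \<in> Obj C \<and> a \<in> Hom C x y \<and> s \<in> S y}"

definition gen_act :: "'a \<Rightarrow> ('o \<times> 'a) list \<Rightarrow> ('o \<times> 'a) list"
  where "gen_act c w = (fst (hd w), Cmp C (snd (hd w)) c) # tl w"

definition free_functor ::
  "('r, 's) ring_scheme \<Rightarrow> ('o \<Rightarrow> ('o \<times> 'a) list set) \<Rightarrow> ('o, 'a, 'r, ('o \<times> 'a) list \<Rightarrow> 'r) cfunctor"
  where "free_functor R S =
    \<lparr>val = (\<lambda>x. free_module R (gens S x)),
     res = (\<lambda>x y c. linear_combination (free_module R (gens S x)) (gens S y)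
       (\<lambda>w. unit_vector R (gens S x) (gen_act c w)))\<rparr>"

lemma gensE:
  assumes "w \<in> gens S x"
  obtains y a s where "w = (y, a) # s" "y \<in> Obj C" "a \<in> Hom C x y" "s \<in> S y"
  using assms by (auto simp: gens_def)

lemma gensI: "y \<in> Obj C \<Longrightarrow> a \<in> Hom C x y \<Longrightarrow> s \<in> S y \<Longrightarrow> (y, a) # s \<in> gens S x"
  by (auto simp: gens_def)

lemma gen_act_Cons [simp]: "gen_act c ((y, a) # s) = (y, Cmp C a c) # s"
  by (simp add: gen_act_def)

lemma finite_gens:
  assumes S: "\<And>y. y \<in> Obj C \<Longrightarrow> finite (S y)" and x: "x \<in> Obj C"
  shows "finite (gens S x)"
proof -
  have "gens S x = (\<Union>y\<in>Obj C. \<Union>a\<in>Hom C x y. (#) (y, a) ` S y)"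
    by (auto simp: gens_def)
  then show ?thesis using S x finite_Obj finite_Hom by auto
qed

lemma free_functor_simps [simp]: "val (free_functor R S) x = free_module R (gens S x)"
  by (simp add: free_functor_def)

context
  fixes R :: "('r, 's) ring_scheme" and S :: "'o \<Rightarrow> ('o \<times> 'a) list set"
  assumes R: "cring R" and S: "\<And>y. y \<in> Obj C \<Longrightarrow> finite (S y)"
begin

lemma free_functor_res_hom:
  "res (free_functor R S) x y c \<in> mod_hom R (free_module R (gens S y)) (free_module R (gens S x))"
  unfolding free_functor_def
  by (simp del: free_module_simps)
    (intro linear_combination_mod_hom free_module_module[OF R] unit_vector_carrier[OF R])

lemma free_functor_res_unit:
  assumes "y \<in> Obj C" "w \<in> gens S y"
  shows "res (free_functor R S) x y c (unit_vector R (gens S y) w) = unit_vector R (gens S x) (gen_act c w)"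
  unfolding free_functor_def
  by (simp del: free_module_simps)
    (intro linear_combination_unit_vector free_module_module[OF R] unit_vector_carrier[OF R]
      finite_gens S assms; assumption)

lemma free_hom_eqI:
  assumes x: "x \<in> Obj C" and M: "module R M"
    and "f \<in> mod_hom R (free_module R (gens S x)) M" "g \<in> mod_hom R (free_module R (gens S x)) M"
    and "\<And>y a s. y \<in> Obj C \<Longrightarrow> a \<in> Hom C x y \<Longrightarrow> s \<in> S y \<Longrightarrow>
      f (unit_vector R (gens S x) ((y, a) # s)) = g (unit_vector R (gens S x) ((y, a) # s))"
    and "u \<in> carrier (free_module R (gens S x))"
  shows "f u = g u"
  by (rule free_module_hom_eqI[OF R finite_gens[OF S x] assms(3,4) M _ assms(6)]) (auto elim!: gensE simp: assms(5))

lemma free_functor_cat_module: "cat_module C R (free_functor R S)"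
  unfolding cat_module_def
proof (intro conjI ballI)
  fix x u assume x: "x \<in> Obj C" and u: "u \<in> carrier (val (free_functor R S) x)"
  show "res (free_functor R S) x x (Idn C x) u = u"
    by (rule free_hom_eqI[OF x free_module_module[OF R] free_functor_res_hom, where g = "\<lambda>u. u"])
      (use u x in \<open>auto simp: free_functor_res_unit gensI Cmp_Idn_right intro: mod_homI\<close>)
next
  fix x y z a b u
  assume x: "x \<in> Obj C" and y: "y \<in> Obj C" and z: "z \<in> Obj C" and a: "a \<in> Hom C x y" and b: "b \<in> Hom C y z"
    and u: "u \<in> carrier (val (free_functor R S) z)"
  show "res (free_functor R S) x z (Cmp C b a) u = res (free_functor R S) x y a (res (free_functor R S) y z b u)"
  proof (rule free_hom_eqI[OF z free_module_module[OF R] free_functor_res_hom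
        mod_hom_compose[OF free_functor_res_hom free_functor_res_hom]])
    fix w c s assume w: "w \<in> Obj C" and c: "c \<in> Hom C z w" and s: "s \<in> S w"
    show "res (free_functor R S) x z (Cmp C b a) (unit_vector R (gens S z) ((w, c) # s)) =
      res (free_functor R S) x y a (res (free_functor R S) y z b (unit_vector R (gens S z) ((w, c) # s)))"
      by (simp add: free_functor_res_unit gensI x y z w c s a b Cmp_Hom[OF y z w b c] Cmp_assoc[OF x y z w a b c])
  qed (use u in simp)
qed (auto simp: free_module_module[OF R] free_functor_res_hom simp del: free_module_simps)

text \<open>
  By the Yoneda lemma, maps out of the free module correspond to arbitrary choices of values for the
  generators, each sitting at its own object with the identity arrow.
\<close>

lemma free_functor_map_exists:
  fixes N :: "('o, 'a, 'r, 'n) cfunctor"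
  assumes N: "cat_module C R N" and b: "\<And>y s. y \<in> Obj C \<Longrightarrow> s \<in> S y \<Longrightarrow> b y s \<in> carrier (val N y)"
  shows "\<exists>g\<in>nat_trans C R (free_functor R S) N. \<forall>y\<in>Obj C. \<forall>s\<in>S y.
    g y (unit_vector R (gens S y) ((y, Idn C y) # s)) = b y s"
proof -
  define v where "v x w = res N x (fst (hd w)) (snd (hd w)) (b (fst (hd w)) (tl w))" for x w
  define g where "g x = linear_combination (val N x) (gens S x) (v x)" for x
  have v_Cons: "v x ((y, a) # s) = res N x y a (b y s)" for x y a s by (simp add: v_def)
  have v: "v x w \<in> carrier (val N x)" if "x \<in> Obj C" "w \<in> gens S x" for x w
    using that(2) by (elim gensE) (simp add: v_Cons cat_moduleD(4)[OF N that(1)] b)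
  have g: "g x \<in> mod_hom R (free_module R (gens S x)) (val N x)" if x: "x \<in> Obj C" for x
    unfolding g_def by (rule linear_combination_mod_hom[OF cat_moduleD(1)[OF N x] v[OF x]])
  have g_unit: "g x (unit_vector R (gens S x) ((y, a) # s)) = res N x y a (b y s)"
    if x: "x \<in> Obj C" and "y \<in> Obj C" "a \<in> Hom C x y" "s \<in> S y" for x y a s
    unfolding g_def v_Cons[symmetric]
    by (rule linear_combination_unit_vector[OF cat_moduleD(1)[OF N x] finite_gens[OF S x] _ v[OF x]])
      (use that in \<open>auto intro: gensI\<close>)
  have "nt_restrict C (free_functor R S) g \<in> nat_trans C R (free_functor R S) N"
  proof (rule nt_restrict_nat_trans[OF free_functor_cat_module])
    fix x y c u assume x: "x \<in> Obj C" and y: "y \<in> Obj C" and c: "c \<in> Hom C x y"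
      and u: "u \<in> carrier (val (free_functor R S) y)"
    show "g x (res (free_functor R S) x y c u) = res N x y c (g y u)"
    proof (rule free_hom_eqI[OF y cat_moduleD(1)[OF N x] mod_hom_compose[OF free_functor_res_hom g[OF x]]
          mod_hom_compose[OF g[OF y] cat_moduleD(3)[OF N x y c]]])
      fix z a s assume z: "z \<in> Obj C" and a: "a \<in> Hom C y z" and s: "s \<in> S z"
      show "g x (res (free_functor R S) x y c (unit_vector R (gens S y) ((z, a) # s))) =
        res N x y c (g y (unit_vector R (gens S y) ((z, a) # s)))"
        by (simp add: free_functor_res_unit gensI x y z a s g_unit Cmp_Hom[OF x y z c a]
            cat_moduleD(5)[OF N x y z c a b[OF z s]])
    qed (use u in simp)
  qed (simp add: g)
  moreover have "nt_restrict C (free_functor R S) g y (unit_vector R (gens S y) ((y, Idn C y) # s)) = b y s"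
    if "y \<in> Obj C" "s \<in> S y" for y s
    using that unit_vector_carrier[OF R, of "gens S y" "(y, Idn C y) # s"]
    by (simp add: g_unit Idn_Hom cat_moduleD(2)[OF N] b del: free_module_simps)
  ultimately show ?thesis by blast
qed

lemma free_functor_map_eqI:
  fixes N :: "('o, 'a, 'r, 'n) cfunctor"
  assumes N: "cat_module C R N"
    and f: "f \<in> nat_trans C R (free_functor R S) N" and g: "g \<in> nat_trans C R (free_functor R S) N"
    and eq: "\<And>y s. y \<in> Obj C \<Longrightarrow> s \<in> S y \<Longrightarrow>
      f y (unit_vector R (gens S y) ((y, Idn C y) # s)) = g y (unit_vector R (gens S y) ((y, Idn C y) # s))"
  shows "f = g"
proof (rule nat_trans_eqI[OF f g])
  fix x u assume x: "x \<in> Obj C" and u: "u \<in> carrier (val (free_functor R S) x)"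
  have expand: "h x (unit_vector R (gens S x) ((y, a) # s)) =
      res N x y a (h y (unit_vector R (gens S y) ((y, Idn C y) # s)))"
    if h: "h \<in> nat_trans C R (free_functor R S) N" and y: "y \<in> Obj C" and a: "a \<in> Hom C x y" and s: "s \<in> S y"
    for h y a s
    using nat_transD(3)[OF h x y a, of "unit_vector R (gens S y) ((y, Idn C y) # s)"]
      unit_vector_carrier[OF R, of "gens S y" "(y, Idn C y) # s"]
    by (simp add: free_functor_res_unit gensI Idn_Hom x y a s Cmp_Idn_left[OF x y a] del: free_module_simps)
  show "f x u = g x u"
    by (rule free_hom_eqI[OF x cat_moduleD(1)[OF N x]])
      (use u nat_transD(1)[OF f x] nat_transD(1)[OF g x] in \<open>auto simp: expand f g eq\<close>)
qed

text \<open>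
  Lift the images of the generators and extend.
\<close>

lemma free_functor_projective: "cat_projective C R (free_functor R S)"
  unfolding cat_projective_def
proof (intro conjI allI impI free_functor_cat_module)
  fix B :: "('o, 'a, 'r, 'o \<times> 'a \<times> (('o \<times> 'a) list \<Rightarrow> 'r) \<Rightarrow> 'r) cfunctor"
    and N :: "('o, 'a, 'r, ('o \<times> 'a) list \<Rightarrow> 'r) cfunctor" and e f
  assume B: "cat_module C R B" and N: "cat_module C R N" and e: "nat_epi C R B N e"
    and f: "f \<in> nat_trans C R (free_functor R S) N"
  have e': "e \<in> nat_trans C R B N" using e by (simp add: nat_epi_def)
  let ?v = "\<lambda>y s. unit_vector R (gens S y) ((y, Idn C y) # s)"
  have vc: "?v y s \<in> carrier (val (free_functor R S) y)" for y s
    using unit_vector_carrier[OF R, of "gens S y" "(y, Idn C y) # s"] by simp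
  define b where "b y s = inv_into (carrier (val B y)) (e y) (f y (?v y s))" for y s
  have im: "f y (?v y s) \<in> e y ` carrier (val B y)" if "y \<in> Obj C" for y s
    using e that nat_transD(2)[OF f that vc] by (simp add: nat_epi_def)
  have b: "b y s \<in> carrier (val B y)" and eb: "e y (b y s) = f y (?v y s)" if "y \<in> Obj C" for y s
    unfolding b_def using im[OF that] by (rule inv_into_into, rule f_inv_into_f)
  obtain g where g: "g \<in> nat_trans C R (free_functor R S) B"
    and gv: "\<And>y s. y \<in> Obj C \<Longrightarrow> s \<in> S y \<Longrightarrow> g y (?v y s) = b y s"
    using free_functor_map_exists[of B b] B b by blast
  have "nt_restrict C (free_functor R S) (\<lambda>x u. e x (g x u)) = f"
  proof (rule free_functor_map_eqI[OF N nat_trans_compose[OF free_functor_cat_module g e'] f])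
    fix y s assume y: "y \<in> Obj C" and s: "s \<in> S y"
    show "nt_restrict C (free_functor R S) (\<lambda>x u. e x (g x u)) y (?v y s) = f y (?v y s)"
      by (simp only: nt_restrict_apply[OF y vc] gv[OF y s] eb[OF y])
  qed
  then have "e x (g x u) = f x u" if "x \<in> Obj C" "u \<in> carrier (val (free_functor R S) x)" for x u
    using that nt_restrict_apply[of x C u "free_functor R S" "\<lambda>x u. e x (g x u)"] by simp
  with g show "\<exists>g\<in>nat_trans C R (free_functor R S) B. \<forall>x\<in>Obj C. \<forall>u\<in>carrier (val (free_functor R S) x).
      e x (g x u) = f x u" by blast
qed

end

text \<open>
  Objectwise, \<open>M\<close> is a direct summand of a free module on finitely many lists.  Unlike being
  finitely generated, this passes to the kernel of a free cover, since the cover then splits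
  objectwise.
\<close>

definition objectwise_summand :: "('r, 's) ring_scheme \<Rightarrow> ('o, 'a, 'r, 'm) cfunctor \<Rightarrow> bool"
  where "objectwise_summand R M \<longleftrightarrow> (\<exists>S :: 'o \<Rightarrow> ('o \<times> 'a) list set. \<forall>x\<in>Obj C. finite (S x) \<and>
    (\<exists>p\<in>mod_hom R (free_module R (S x)) (val M x). \<exists>i\<in>mod_hom R (val M x) (free_module R (S x)).
      \<forall>m\<in>carrier (val M x). p (i m) = m))"

text \<open>
  The constant functor is at every object the free module on the empty list.
\<close>

lemma objectwise_summand_const:
  assumes "cring R" shows "objectwise_summand R (const_functor R)"
proof -
  have p: "(\<lambda>u. u []) \<in> mod_hom R (free_module R {[] :: ('o \<times> 'a) list}) (regular_module R)"
    by (rule mod_homI) (auto simp: regular_module_def)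
  have i: "(\<lambda>r. \<lambda>_\<in>{[] :: ('o \<times> 'a) list}. r) \<in> mod_hom R (regular_module R) (free_module R {[] :: ('o \<times> 'a) list})"
    by (rule mod_homI) (auto simp: regular_module_def fun_eq_iff)
  have "\<exists>p\<in>mod_hom R (free_module R {[] :: ('o \<times> 'a) list}) (regular_module R).
      \<exists>i\<in>mod_hom R (regular_module R) (free_module R {[] :: ('o \<times> 'a) list}). \<forall>m\<in>carrier (regular_module R). p (i m) = m"
    by (rule bexI[OF bexI[OF _ i] p]) simp
  then show ?thesis
    unfolding objectwise_summand_def
    by (intro exI[where x = "\<lambda>_. {[]}"]) (simp add: const_functor_def)
qed

text \<open>
  A generating element of \<open>M x\<close> is the image of the generator of the cover with the identity arrow at
  \<open>x\<close>.  Combined with the given inclusion \<open>i\<close>, this yields at each object a linear section \<open>\<sigma>\<close> of the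
  cover \<open>e\<close>; it is not natural, but \<open>u - \<sigma> (e u)\<close> is a projection onto the kernel at that object.
\<close>

lemma objectwise_summand_cover:
  fixes M :: "('o, 'a, 'r, 'm) cfunctor"
  assumes R: "cring R" and M: "cat_module C R M" and sM: "objectwise_summand R M"
  shows "\<exists>(P :: ('o, 'a, 'r, ('o \<times> 'a) list \<Rightarrow> 'r) cfunctor) e. cat_projective C R P \<and> nat_epi C R P M e \<and>
    objectwise_summand R (subfunctor P (\<lambda>x. mod_kernel (val P x) (val M x) (e x)))"
proof -
  obtain S :: "'o \<Rightarrow> ('o \<times> 'a) list set" where "\<forall>x\<in>Obj C. finite (S x) \<and>
    (\<exists>p\<in>mod_hom R (free_module R (S x)) (val M x). \<exists>i\<in>mod_hom R (val M x) (free_module R (S x)).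
      \<forall>m\<in>carrier (val M x). p (i m) = m)"
    using sM unfolding objectwise_summand_def by blast
  then obtain p i where S: "\<And>x. x \<in> Obj C \<Longrightarrow> finite (S x)"
    and p: "\<And>x. x \<in> Obj C \<Longrightarrow> p x \<in> mod_hom R (free_module R (S x)) (val M x)"
    and i: "\<And>x. x \<in> Obj C \<Longrightarrow> i x \<in> mod_hom R (val M x) (free_module R (S x))"
    and pi: "\<And>x m. x \<in> Obj C \<Longrightarrow> m \<in> carrier (val M x) \<Longrightarrow> p x (i x m) = m"
    by metis
  let ?P = "free_functor R S"
  note PM = free_functor_cat_module[where S = S, OF R S]
  let ?v = "\<lambda>y s. unit_vector R (gens S y) ((y, Idn C y) # s)"
  obtain e where e: "e \<in> nat_trans C R ?P M"
    and ev: "\<And>y s. y \<in> Obj C \<Longrightarrow> s \<in> S y \<Longrightarrow> e y (?v y s) = p y (unit_vector R (S y) s)"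
    using free_functor_map_exists[where S = S and b = "\<lambda>y s. p y (unit_vector R (S y) s)", OF R S M]
      mod_hom_closed[OF p unit_vector_carrier[OF R]] by blast
  define l where "l x = linear_combination (free_module R (gens S x)) (S x) (?v x)" for x
  have l: "l x \<in> mod_hom R (free_module R (S x)) (free_module R (gens S x))" for x
    unfolding l_def by (intro linear_combination_mod_hom free_module_module R unit_vector_carrier)
  have el: "e x (l x u) = p x u" if x: "x \<in> Obj C" and u: "u \<in> carrier (free_module R (S x))" for x u
  proof (rule free_module_hom_eqI[OF R S[OF x] _ p[OF x] cat_moduleD(1)[OF M x] _ u])
    show "(\<lambda>u. e x (l x u)) \<in> mod_hom R (free_module R (S x)) (val M x)"
      using mod_hom_compose[OF l nat_transD(1)[OF e x, simplified free_functor_simps]] .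
    fix s assume s: "s \<in> S x"
    have "l x (unit_vector R (S x) s) = ?v x s"
      unfolding l_def
      by (rule linear_combination_unit_vector[OF free_module_module[OF R] S[OF x] s unit_vector_carrier[OF R]])
    then show "e x (l x (unit_vector R (S x) s)) = p x (unit_vector R (S x) s)"
      by (simp add: ev[OF x s])
  qed
  define \<sigma> where "\<sigma> x m = l x (i x m)" for x m
  have \<sigma>: "\<sigma> x \<in> mod_hom R (val M x) (free_module R (gens S x))" if "x \<in> Obj C" for x
    unfolding \<sigma>_def by (rule mod_hom_compose[OF i[OF that] l])
  have e\<sigma>: "e x (\<sigma> x m) = m" if "x \<in> Obj C" "m \<in> carrier (val M x)" for x m
    using that el[OF that(1) mod_hom_closed[OF i]] by (simp add: \<sigma>_def pi)
  have epi: "nat_epi C R ?P M e"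
    unfolding nat_epi_def
  proof (intro conjI ballI e equalityI subsetI)
    fix x m assume x: "x \<in> Obj C" and "m \<in> carrier (val M x)"
    then show "m \<in> e x ` carrier (val ?P x)"
      using e\<sigma> mod_hom_closed[OF \<sigma>[OF x]] by (metis free_functor_simps imageI)
  qed (auto intro: nat_transD(2)[OF e])
  let ?K = "\<lambda>x. mod_kernel (val ?P x) (val M x) (e x)"
  have "\<exists>q\<in>mod_hom R (free_module R (gens S x)) (val (subfunctor ?P ?K) x).
      \<exists>j\<in>mod_hom R (val (subfunctor ?P ?K) x) (free_module R (gens S x)).
      \<forall>m\<in>carrier (val (subfunctor ?P ?K) x). q (j m) = m" if x: "x \<in> Obj C" for x
  proof (intro bexI ballI)
    interpret F: module R "free_module R (gens S x)" by (rule free_module_module[OF R])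
    note ex = nat_transD(1)[OF e x, simplified free_functor_simps]
    let ?q = "\<lambda>u. u \<ominus>\<^bsub>free_module R (gens S x)\<^esub> \<sigma> x (e x u)"
    show "(\<lambda>u. u) \<in> mod_hom R (val (subfunctor ?P ?K) x) (free_module R (gens S x))"
      by (rule mod_homI) (auto simp: mod_kernel_def simp del: free_module_simps)
    have hom: "?q \<in> mod_hom R (free_module R (gens S x)) (free_module R (gens S x))"
      by (intro mod_hom_minus_maps F.module_axioms mod_hom_compose[OF ex \<sigma>[OF x]])
        (auto simp: mod_hom_def simp del: free_module_simps)
    have ker: "?q u \<in> ?K x" if u: "u \<in> carrier (free_module R (gens S x))" for u
    proof -
      note eu = mod_hom_closed[OF ex u]
      have "e x (?q u) = e x u \<ominus>\<^bsub>val M x\<^esub> e x (\<sigma> x (e x u))"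
        by (rule mod_hom_minus[OF F.module_axioms cat_moduleD(1)[OF M x] ex u mod_hom_closed[OF \<sigma>[OF x] eu]])
      also have "\<dots> = \<zero>\<^bsub>val M x\<^esub>"
        by (simp add: e\<sigma>[OF x eu] module_minus_eq_zero_iff[OF cat_moduleD(1)[OF M x] eu eu])
      finally show ?thesis using mod_hom_closed[OF hom u] by (simp add: mod_kernel_def del: free_module_simps)
    qed
    show "?q \<in> mod_hom R (free_module R (gens S x)) (val (subfunctor ?P ?K) x)"
      by (rule mod_homI)
        (simp_all add: ker[simplified free_functor_simps] mod_hom_add[OF hom] mod_hom_smult[OF hom] del: free_module_simps)
    fix m assume "m \<in> carrier (val (subfunctor ?P ?K) x)"
    then have m: "m \<in> carrier (free_module R (gens S x))" "e x m = \<zero>\<^bsub>val M x\<^esub>"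
      by (auto simp: mod_kernel_def simp del: free_module_simps)
    have "\<sigma> x \<zero>\<^bsub>val M x\<^esub> = \<zero>\<^bsub>free_module R (gens S x)\<^esub>"
      by (rule mod_hom_zero[OF cat_moduleD(1)[OF M x] F.module_axioms \<sigma>[OF x]])
    then show "?q m = m" using m by (simp add: a_minus_def del: free_module_simps)
  qed
  then have "objectwise_summand R (subfunctor ?P ?K)"
    unfolding objectwise_summand_def using finite_gens[where S = S, OF S] by (intro exI[of _ "gens S"]) blast
  then show ?thesis using free_functor_projective[where S = S, OF R S] epi by blast
qed

text \<open>
  Covers are iterated, each one covering the kernel of the one before.  All of them are modules of
  functions on lists, so they fit into one type.
\<close>

theorem projective_resolution_exists:
  fixes M :: "('o, 'a, 'r, 'm) cfunctor"
  assumes R: "cring R" and M: "cat_module C R M" and sM: "objectwise_summand R M"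
  shows "\<exists>(P :: nat \<Rightarrow> ('o, 'a, 'r, ('o \<times> 'a) list \<Rightarrow> 'r) cfunctor) d \<epsilon>. projective_resolution C R M P d \<epsilon>"
proof -
  let ?ker = "\<lambda>P M e x. mod_kernel (val P x) (val M x) (e x)"
  let ?A = "\<lambda>(n :: nat) (P :: ('o, 'a, 'r, ('o \<times> 'a) list \<Rightarrow> 'r) cfunctor, K). cat_projective C R P \<and>
    cat_module C R (subfunctor P K) \<and> objectwise_summand R (subfunctor P K) \<and>
    (n = 0 \<longrightarrow> (\<exists>\<epsilon>. nat_epi C R P M \<epsilon> \<and> K = ?ker P M \<epsilon>))"
  let ?B = "\<lambda>(n :: nat) (P :: ('o, 'a, 'r, ('o \<times> 'a) list \<Rightarrow> 'r) cfunctor, K)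
      (P' :: ('o, 'a, 'r, ('o \<times> 'a) list \<Rightarrow> 'r) cfunctor, K'). \<exists>e. nat_epi C R P' (subfunctor P K) e \<and> K' = ?ker P' (subfunctor P K) e"
  have "\<exists>s. \<forall>n. ?A n (s n) \<and> ?B n (s n) (s (Suc n))"
  proof (rule dependent_nat_choice)
    obtain P :: "('o, 'a, 'r, ('o \<times> 'a) list \<Rightarrow> 'r) cfunctor" and e
      where P: "cat_projective C R P" "nat_epi C R P M e" "objectwise_summand R (subfunctor P (?ker P M e))"
      using objectwise_summand_cover[OF R M sM] by blast
    have "cat_module C R (subfunctor P (?ker P M e))"
      using P by (intro cat_kernel_cat_module M) (auto simp: cat_projective_def nat_epi_def)
    with P show "\<exists>s. ?A 0 s" by (intro exI[of _ "(P, ?ker P M e)"]) auto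
  next
    fix s n assume A: "?A n s"
    obtain P K where s: "s = (P, K)" by (cases s)
    obtain P' :: "('o, 'a, 'r, ('o \<times> 'a) list \<Rightarrow> 'r) cfunctor" and e
      where P': "cat_projective C R P'" "nat_epi C R P' (subfunctor P K) e"
        "objectwise_summand R (subfunctor P' (?ker P' (subfunctor P K) e))"
      using objectwise_summand_cover[OF R, of "subfunctor P K"] A s by auto
    have "cat_module C R (subfunctor P' (?ker P' (subfunctor P K) e))"
      using P' A s by (intro cat_kernel_cat_module) (auto simp: cat_projective_def nat_epi_def)
    with P' show "\<exists>s'. ?A (Suc n) s' \<and> ?B n s s'"
      unfolding s by (intro exI[of _ "(P', ?ker P' (subfunctor P K) e)"]) auto
  qed
  then obtain s where s: "\<forall>n. ?A n (s n) \<and> ?B n (s n) (s (Suc n))" ..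
  define P where "P n = fst (s n)" for n
  define K where "K n = snd (s n)" for n
  have sPK: "s n = (P n, K n)" for n by (simp add: P_def K_def)
  have A: "cat_projective C R (P n)" and B: "\<exists>e. nat_epi C R (P (Suc n)) (subfunctor (P n) (K n)) e \<and>
      K (Suc n) = ?ker (P (Suc n)) (subfunctor (P n) (K n)) e" for n
    using s[THEN spec, of n] unfolding sPK by auto
  obtain \<epsilon> where \<epsilon>: "nat_epi C R (P 0) M \<epsilon>" "K 0 = ?ker (P 0) M \<epsilon>"
    using s[THEN spec, of 0] unfolding sPK by auto
  obtain d where "\<forall>n. nat_epi C R (P (Suc n)) (subfunctor (P n) (K n)) (d n) \<and>
      K (Suc n) = ?ker (P (Suc n)) (subfunctor (P n) (K n)) (d n)"
    using choice[OF allI, OF B] ..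
  then have d: "nat_epi C R (P (Suc n)) (subfunctor (P n) (K n)) (d n)"
    and Kd: "K (Suc n) = ?ker (P (Suc n)) (subfunctor (P n) (K n)) (d n)" for n
    by simp_all
  have Kc: "K n x \<subseteq> carrier (val (P n) x)" for n x
    by (cases n) (auto simp: \<epsilon> Kd mod_kernel_def)
  have "d n \<in> nat_trans C R (P (Suc n)) (P n)" for n
    using d[of n] Kc[of n] by (auto simp: nat_epi_def nat_trans_def mod_hom_def Pi_iff subset_iff)
  moreover have "d n x ` carrier (val (P (Suc n)) x) = K n x" if "x \<in> Obj C" for n x
    using d[of n] that by (simp add: nat_epi_def)
  ultimately have "projective_resolution C R M P d \<epsilon>"
    using A \<epsilon> by (auto simp: projective_resolution_def Kd mod_kernel_def)
  then show ?thesis by blast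
qed

end

section \<open>Cohomology of a reflective subcategory\<close>

lemma cat_lim_simps [simp]:
  "carrier (cat_lim C F) = {s \<in> (\<Pi>\<^sub>E x\<in>Obj C. carrier (val F x)).
    \<forall>x\<in>Obj C. \<forall>y\<in>Obj C. \<forall>a\<in>Hom C x y. res F x y a (s y) = s x}"
  "\<zero>\<^bsub>cat_lim C F\<^esub> = (\<lambda>x\<in>Obj C. \<zero>\<^bsub>val F x\<^esub>)"
  "s \<oplus>\<^bsub>cat_lim C F\<^esub> t = (\<lambda>x\<in>Obj C. s x \<oplus>\<^bsub>val F x\<^esub> t x)"
  "r \<odot>\<^bsub>cat_lim C F\<^esub> s = (\<lambda>x\<in>Obj C. r \<odot>\<^bsub>val F x\<^esub> s x)"
  by (simp_all add: cat_lim_def)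

lemma cat_lim_module:
  assumes R: "cring R" and F: "cat_module C R F"
  shows "module R (cat_lim C F)"
proof (rule module_if_separated[OF R, where K = "Obj C" and \<pi> = "\<lambda>x s. s x" and N = "val F"])
  show "module R (val F x)" if "x \<in> Obj C" for x by (rule cat_moduleD(1)[OF F that])
  have ac: "u \<oplus>\<^bsub>val F x\<^esub> v \<in> carrier (val F x)"
    if "x \<in> Obj C" "u \<in> carrier (val F x)" "v \<in> carrier (val F x)" for x u v
    using cat_moduleD(1)[OF F that(1)] that(2,3) by (simp add: module_def abelian_group_def abelian_monoid.a_closed)
  have zc: "\<zero>\<^bsub>val F x\<^esub> \<in> carrier (val F x)" if "x \<in> Obj C" for x
    using cat_moduleD(1)[OF F that(1)] by (simp add: module_def abelian_group_def abelian_monoid.zero_closed)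
  note sc = module.smult_closed[OF cat_moduleD(1)[OF F]]
  note h = cat_moduleD(3)[OF F]
  have lim_mem: "s x \<in> carrier (val F x)" if "s \<in> carrier (cat_lim C F)" "x \<in> Obj C" for s x
    using that by auto
  show "s \<oplus>\<^bsub>cat_lim C F\<^esub> t \<in> carrier (cat_lim C F)" if "s \<in> carrier (cat_lim C F)" "t \<in> carrier (cat_lim C F)" for s t
    using that lim_mem[OF that(1)] lim_mem[OF that(2)] by (auto simp: ac mod_hom_add[OF h])
  show "r \<odot>\<^bsub>cat_lim C F\<^esub> s \<in> carrier (cat_lim C F)" if "r \<in> carrier R" "s \<in> carrier (cat_lim C F)" for r s
    using that lim_mem[OF that(2)] by (auto simp: sc mod_hom_smult[OF h])
  show "\<zero>\<^bsub>cat_lim C F\<^esub> \<in> carrier (cat_lim C F)"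
    by (auto simp: zc mod_hom_zero[OF cat_moduleD(1)[OF F] cat_moduleD(1)[OF F] h])
  show "(\<lambda>s. s x) \<in> mod_hom R (cat_lim C F) (val F x)" if "x \<in> Obj C" for x
    using that by (intro mod_homI) auto
  show "s = t" if "s \<in> carrier (cat_lim C F)" "t \<in> carrier (cat_lim C F)" "\<And>x. x \<in> Obj C \<Longrightarrow> s x = t x" for s t
    using that by (auto intro: PiE_ext)
qed simp

definition full_subcat :: "('o, 'a) cat \<Rightarrow> 'o set \<Rightarrow> ('o, 'a) cat"
  where "full_subcat C D = C\<lparr>Obj := D\<rparr>"

lemma full_subcat_simps [simp]:
  "Obj (full_subcat C D) = D" "Hom (full_subcat C D) = Hom C"
  "Cmp (full_subcat C D) = Cmp C" "Idn (full_subcat C D) = Idn C"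
  by (simp_all add: full_subcat_def)

lemma full_subcat_cat_module:
  "D \<subseteq> Obj C \<Longrightarrow> cat_module C R F \<Longrightarrow> cat_module (full_subcat C D) R F"
  unfolding cat_module_def full_subcat_simps by (intro conjI; blast)

text \<open>
  The full subcategory on \<open>D\<close> is reflective, with reflector \<open>L\<close> and unit \<open>\<eta>\<close>, and the reflector is
  the identity on it.  Being strict in this sense makes restriction to \<open>D\<close> undo \<open>pullback\<close> below
  on the nose.  The value \<open>La y a\<close> of the reflector on an arrow \<open>a\<close> from \<open>x\<close> to \<open>y\<close> does not
  depend on \<open>x\<close>.
\<close>

locale reflective_subcat =
  fixes C :: "('o, 'a) cat" and D :: "'o set"
    and L :: "'o \<Rightarrow> 'o" and La :: "'o \<Rightarrow> 'a \<Rightarrow> 'a" and \<eta> :: "'o \<Rightarrow> 'a"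
  assumes D: "D \<subseteq> Obj C"
    and L_closed: "x \<in> Obj C \<Longrightarrow> L x \<in> D"
    and L_id: "x \<in> D \<Longrightarrow> L x = x"
    and La_Hom: "x \<in> Obj C \<Longrightarrow> y \<in> Obj C \<Longrightarrow> a \<in> Hom C x y \<Longrightarrow> La y a \<in> Hom C (L x) (L y)"
    and La_Idn: "x \<in> Obj C \<Longrightarrow> La x (Idn C x) = Idn C (L x)"
    and La_Cmp: "x \<in> Obj C \<Longrightarrow> y \<in> Obj C \<Longrightarrow> z \<in> Obj C \<Longrightarrow> a \<in> Hom C x y \<Longrightarrow> b \<in> Hom C y z \<Longrightarrow>
      La z (Cmp C b a) = Cmp C (La z b) (La y a)"
    and La_id: "x \<in> D \<Longrightarrow> y \<in> D \<Longrightarrow> a \<in> Hom C x y \<Longrightarrow> La y a = a"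
    and \<eta>_Hom: "x \<in> Obj C \<Longrightarrow> \<eta> x \<in> Hom C x (L x)"
    and \<eta>_natural: "x \<in> Obj C \<Longrightarrow> y \<in> Obj C \<Longrightarrow> a \<in> Hom C x y \<Longrightarrow>
      Cmp C (\<eta> y) a = Cmp C (La y a) (\<eta> x)"
    and \<eta>_id: "x \<in> D \<Longrightarrow> \<eta> x = Idn C x"
    and La_\<eta>: "x \<in> Obj C \<Longrightarrow> La (L x) (\<eta> x) = Idn C (L x)"
begin

abbreviation "C' \<equiv> full_subcat C D"

lemma D_Obj: "x \<in> D \<Longrightarrow> x \<in> Obj C" using D by blast

lemma L_Obj: "x \<in> Obj C \<Longrightarrow> L x \<in> Obj C" using L_closed D by blast

definition pullback :: "('o, 'a, 'r, 'm) cfunctor \<Rightarrow> ('o, 'a, 'r, 'm) cfunctor"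
  where "pullback M = \<lparr>val = (\<lambda>x. val M (L x)), res = (\<lambda>x y a. res M (L x) (L y) (La y a))\<rparr>"

lemma pullback_simps [simp]:
  "val (pullback M) x = val M (L x)" "res (pullback M) x y a = res M (L x) (L y) (La y a)"
  by (simp_all add: pullback_def)

lemma pullback_const: "pullback (const_functor R) = const_functor R"
  by (simp add: pullback_def const_functor_def)

lemma pullback_cat_module:
  assumes M: "cat_module C' R M" shows "cat_module C R (pullback M)"
proof -
  note MD = cat_moduleD[OF M, unfolded full_subcat_simps]
  show ?thesis
    unfolding cat_module_def
    by (auto simp: MD L_closed La_Hom La_Idn La_Cmp)
qed

lemma pullback_nat_trans:
  assumes M: "cat_module C' R M" and f: "f \<in> nat_trans C' R M N"
  shows "nt_restrict C (pullback M) (\<lambda>x. f (L x)) \<in> nat_trans C R (pullback M) (pullback N)"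
  using nat_transD[OF f]
  by (intro nt_restrict_nat_trans[OF pullback_cat_module[OF M]]) (auto simp: L_closed La_Hom)

text \<open>
  The unit makes any map \<open>P \<rightarrow> B\<close> on the subcategory into a map \<open>P \<circ> L \<rightarrow> B\<close>: pullback along
  \<open>L\<close> is left adjoint to restriction.
\<close>

lemma extend_nat_trans:
  assumes P: "cat_module C' R P" and B: "cat_module C R B" and g: "g \<in> nat_trans C' R P B"
  shows "nt_restrict C (pullback P) (\<lambda>x u. res B x (L x) (\<eta> x) (g (L x) u)) \<in> nat_trans C R (pullback P) B"
proof (rule nt_restrict_nat_trans[OF pullback_cat_module[OF P]])
  fix x assume x: "x \<in> Obj C"
  show "(\<lambda>u. res B x (L x) (\<eta> x) (g (L x) u)) \<in> mod_hom R (val (pullback P) x) (val B x)"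
    using mod_hom_compose[OF nat_transD(1)[OF g] cat_moduleD(3)[OF B x L_Obj[OF x] \<eta>_Hom[OF x]]] L_closed[OF x]
    by simp
next
  fix x y a u assume x: "x \<in> Obj C" and y: "y \<in> Obj C" and a: "a \<in> Hom C x y"
    and u: "u \<in> carrier (val (pullback P) y)"
  have gu: "g (L y) u \<in> carrier (val B (L y))"
    using nat_transD(2)[OF g] L_closed[OF y] u by simp
  have "g (L x) (res P (L x) (L y) (La y a) u) = res B (L x) (L y) (La y a) (g (L y) u)"
    using nat_transD(3)[OF g] L_closed x y La_Hom[OF x y a] u by simp
  then have "res B x (L x) (\<eta> x) (g (L x) (res (pullback P) x y a u)) = res B x (L y) (Cmp C (La y a) (\<eta> x)) (g (L y) u)"
    using cat_moduleD(5)[OF B x L_Obj[OF x] L_Obj[OF y] \<eta>_Hom[OF x] La_Hom[OF x y a] gu] by simp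
  also have "\<dots> = res B x y a (res B y (L y) (\<eta> y) (g (L y) u))"
    using cat_moduleD(5)[OF B x y L_Obj[OF y] a \<eta>_Hom[OF y] gu] \<eta>_natural[OF x y a] by simp
  finally show "res B x (L x) (\<eta> x) (g (L x) (res (pullback P) x y a u)) = res B x y a (res B y (L y) (\<eta> y) (g (L y) u))" .
qed

lemma restrict_nat_trans:
  assumes P: "cat_module C' R P" and f: "f \<in> nat_trans C R (pullback P) N"
  shows "nt_restrict C' P f \<in> nat_trans C' R P N"
proof (rule nt_restrict_nat_trans[OF P])
  show "f x \<in> mod_hom R (val P x) (val N x)" if "x \<in> Obj C'" for x
    using nat_transD(1)[OF f D_Obj, of x] that by (simp add: L_id)
  show "f x (res P x y a u) = res N x y a (f y u)"
    if "x \<in> Obj C'" "y \<in> Obj C'" "a \<in> Hom C' x y" "u \<in> carrier (val P y)" for x y a u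
    using nat_transD(3)[OF f D_Obj D_Obj, of x y a u] that by (simp add: L_id La_id)
qed

text \<open>
  The reflector sends the unit to an identity, so naturality along the unit computes a map out of
  \<open>P \<circ> L\<close> at \<open>x\<close> from its value at \<open>L x\<close>.
\<close>

lemma nat_trans_pullback_unit:
  assumes P: "cat_module C' R P" and f: "f \<in> nat_trans C R (pullback P) N"
    and x: "x \<in> Obj C" and u: "u \<in> carrier (val P (L x))"
  shows "res N x (L x) (\<eta> x) (f (L x) u) = f x u"
proof -
  have "f x (res (pullback P) x (L x) (\<eta> x) u) = res N x (L x) (\<eta> x) (f (L x) u)"
    using nat_transD(3)[OF f x L_Obj[OF x] \<eta>_Hom[OF x], of u] u by (simp add: L_id L_closed[OF x])
  moreover have "res (pullback P) x (L x) (\<eta> x) u = u"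
    using cat_moduleD(2)[OF P, of "L x" u] u by (simp add: L_id L_closed[OF x] La_\<eta>[OF x])
  ultimately show ?thesis by simp
qed

text \<open>
  A left adjoint preserves projectives when its right adjoint is exact, and restriction to \<open>D\<close> is:
  a lift is found over \<open>D\<close> and extended along the unit.
\<close>

lemma pullback_projective:
  fixes P :: "('o, 'a, 'r, 'p) cfunctor"
  assumes P: "cat_projective C' R P"
  shows "cat_projective C R (pullback P)"
proof -
  have PM: "cat_module C' R P" using P by (simp add: cat_projective_def)
  show ?thesis
    unfolding cat_projective_def
  proof (intro conjI allI impI pullback_cat_module PM)
    fix B :: "('o, 'a, 'r, 'o \<times> 'a \<times> 'p \<Rightarrow> 'r) cfunctor" and N :: "('o, 'a, 'r, 'p) cfunctor" and e f
    assume B: "cat_module C R B" and N: "cat_module C R N" and e: "nat_epi C R B N e"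
      and f: "f \<in> nat_trans C R (pullback P) N"
    have e': "e \<in> nat_trans C R B N" using e by (simp add: nat_epi_def)
    note B' = full_subcat_cat_module[OF D B] and N' = full_subcat_cat_module[OF D N]
    let ?e = "nt_restrict C' B e"
    have "?e \<in> nat_trans C' R B N"
      using nat_transD[OF e'] by (intro nt_restrict_nat_trans[OF B']) (auto simp: D_Obj)
    then have epi: "nat_epi C' R B N ?e"
      using e by (simp add: nat_epi_def D_Obj image_def)
    obtain g where g: "g \<in> nat_trans C' R P B"
      and eg: "\<And>x u. x \<in> D \<Longrightarrow> u \<in> carrier (val P x) \<Longrightarrow> e x (g x u) = f x u"
    proof -
      have "\<exists>g\<in>nat_trans C' R P B. \<forall>x\<in>Obj C'. \<forall>u\<in>carrier (val P x). ?e x (g x u) = nt_restrict C' P f x u"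
        using P B' N' epi restrict_nat_trans[OF PM f] unfolding cat_projective_def by blast
      then show ?thesis using that by (auto simp: nat_transD(2))
    qed
    have "e x (res B x (L x) (\<eta> x) (g (L x) u)) = f x u"
      if x: "x \<in> Obj C" and u: "u \<in> carrier (val P (L x))" for x u
    proof -
      have "g (L x) u \<in> carrier (val B (L x))"
        using nat_transD(2)[OF g] L_closed[OF x] u by simp
      then have "e x (res B x (L x) (\<eta> x) (g (L x) u)) = res N x (L x) (\<eta> x) (e (L x) (g (L x) u))"
        by (rule nat_transD(3)[OF e' x L_Obj[OF x] \<eta>_Hom[OF x]])
      then show ?thesis by (simp add: eg[OF L_closed[OF x] u] nat_trans_pullback_unit[OF PM f x u])
    qed
    with extend_nat_trans[OF PM B g] show "\<exists>g\<in>nat_trans C R (pullback P) B. \<forall>x\<in>Obj C. \<forall>u\<in>carrier (val (pullback P) x).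
        e x (g x u) = f x u"
      by (intro bexI[where x = "nt_restrict C (pullback P) (\<lambda>x u. res B x (L x) (\<eta> x) (g (L x) u))"]) auto
  qed
qed

text \<open>
  Exactness is tested at objects, and the value of a pullback at \<open>x\<close> is the value at \<open>L x\<close>.
\<close>

lemma pullback_resolution:
  assumes P: "projective_resolution C' R M P d \<epsilon>"
  shows "projective_resolution C R (pullback M) (\<lambda>n. pullback (P n))
    (\<lambda>n. nt_restrict C (pullback (P (Suc n))) (\<lambda>x. d n (L x))) (nt_restrict C (pullback (P 0)) (\<lambda>x. \<epsilon> (L x)))"
proof -
  note PD = projective_resolutionD[OF P]
  have im: "nt_restrict C (pullback K) (\<lambda>x. f (L x)) x ` carrier (val K (L x)) = f (L x) ` carrier (val K (L x))"
    if "x \<in> Obj C" for x f K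
    using that by (auto simp: image_def)
  have ker: "mod_kernel A B (nt_restrict C (pullback K) (\<lambda>x. f (L x)) x) = mod_kernel A B (f (L x))"
    if "x \<in> Obj C" "A = val K (L x)" for x f K A B
    using that by (auto simp: mod_kernel_def)
  show ?thesis
    using P pullback_nat_trans[OF PD(2) PD(3)] pullback_nat_trans[OF PD(2) PD(4)]
    unfolding projective_resolution_def nat_epi_def
    by (auto simp: pullback_projective L_closed im ker simp del: nt_restrict_apply)
qed

text \<open>
  The adjunction is an isomorphism of cochain complexes, natural maps out of \<open>P n \<circ> L\<close> over \<open>C\<close>
  being the same as natural maps out of \<open>P n\<close> over \<open>D\<close>.
\<close>

lemma Hom_cohomology_pullback_iso:
  fixes P :: "nat \<Rightarrow> ('o, 'a, 'r, 'p) cfunctor" and F :: "('o, 'a, 'r, 'm) cfunctor"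
  assumes R: "cring R" and F: "cat_module C R F" and P: "projective_resolution C' R M P d \<epsilon>"
  shows "mod_iso R
    (Hom_cohomology C R (\<lambda>n. pullback (P n)) (\<lambda>n. nt_restrict C (pullback (P (Suc n))) (\<lambda>x. d n (L x))) F (Suc k))
    (Hom_cohomology C' R P d F (Suc k))"
proof -
  let ?Q = "\<lambda>n. pullback (P n)" and ?d = "\<lambda>n. nt_restrict C (pullback (P (Suc n))) (\<lambda>x. d n (L x))"
  note PD = projective_resolutionD[OF P] and QD = projective_resolutionD[OF pullback_resolution[OF P]]
  note F' = full_subcat_cat_module[OF D F]
  let ?ZQ = "mod_restrict (nat_trans_module C R (?Q (Suc k)) F) (Hom_cocycles C R ?Q ?d F (Suc k))"
  let ?ZP = "mod_restrict (nat_trans_module C' R (P (Suc k)) F) (Hom_cocycles C' R P d F (Suc k))"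
  note sQ = Hom_cohomology_submodules[where P = ?Q and d = ?d, OF R QD(2) F QD(3) QD(7)]
    and sP = Hom_cohomology_submodules[where P = P and d = d, OF R PD(2) F' PD(3) PD(7)]
  note BQ = Hom_coboundaries_Suc_iff[where P = ?Q and d = ?d, OF QD(2,3)]
    and BP = Hom_coboundaries_Suc_iff[where P = P and d = d, OF PD(2,3)]
  note dc = nat_transD(2)[OF PD(3), unfolded full_subcat_simps]
  let ?\<Phi> = "\<lambda>\<phi>. nt_restrict C' (P (Suc k)) \<phi>"
  note \<Phi>nat = restrict_nat_trans[OF PD(2)]
  have \<Phi>: "?\<Phi> \<in> mod_hom R ?ZQ ?ZP"
  proof (rule mod_homI)
    fix \<phi> assume "\<phi> \<in> carrier ?ZQ"
    then have \<phi>: "\<phi> \<in> nat_trans C R (?Q (Suc k)) F"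
      and z: "\<And>x u. x \<in> Obj C \<Longrightarrow> u \<in> carrier (val (P (Suc (Suc k))) (L x)) \<Longrightarrow> \<phi> x (d (Suc k) (L x) u) = \<zero>\<^bsub>val F x\<^esub>"
      by (auto simp: Hom_cocycles_iff)
    show "?\<Phi> \<phi> \<in> carrier ?ZP"
      using z[OF D_Obj] by (auto simp: Hom_cocycles_iff \<Phi>nat[OF \<phi>] dc L_id)
  qed (auto simp: nt_restrict_def L_id D_Obj intro!: restrict_ext)
  note ext = extend_nat_trans[OF PD(2) F]
  show ?thesis
    unfolding Hom_cohomology_def
  proof (rule mod_quotient_iso[OF sQ(1) sP(1) sQ(2) sP(2) \<Phi>])
    fix \<phi> assume \<phi>: "\<phi> \<in> Hom_coboundaries C R ?Q ?d F (Suc k)"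
    then obtain \<theta> where \<theta>: "\<theta> \<in> nat_trans C R (?Q k) F"
      "\<And>x u. x \<in> Obj C \<Longrightarrow> u \<in> carrier (val (P (Suc k)) (L x)) \<Longrightarrow> \<phi> x u = \<theta> x (d k (L x) u)"
      by (auto simp: BQ)
    have \<phi>n: "\<phi> \<in> nat_trans C R (?Q (Suc k)) F" using \<phi> by (simp add: BQ)
    show "?\<Phi> \<phi> \<in> Hom_coboundaries C' R P d F (Suc k)"
      unfolding BP
      using \<Phi>nat[OF \<theta>(1)] \<Phi>nat[OF \<phi>n]
      by (intro conjI bexI[where x = "nt_restrict C' (P k) \<theta>"]) (auto simp: \<theta>(2) dc L_id D_Obj)
  next
    fix \<phi> assume \<phi>: "\<phi> \<in> carrier ?ZQ" and B: "?\<Phi> \<phi> \<in> Hom_coboundaries C' R P d F (Suc k)"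
    then have \<phi>n: "\<phi> \<in> nat_trans C R (?Q (Suc k)) F" by (simp add: Hom_cocycles_iff)
    obtain \<theta> where \<theta>: "\<theta> \<in> nat_trans C' R (P k) F"
      "\<And>x u. x \<in> D \<Longrightarrow> u \<in> carrier (val (P (Suc k)) x) \<Longrightarrow> \<phi> x u = \<theta> x (d k x u)"
      using B by (auto simp: BP)
    show "\<phi> \<in> Hom_coboundaries C R ?Q ?d F (Suc k)"
      unfolding BQ
    proof (intro conjI bexI ballI \<phi>n)
      show "nt_restrict C (?Q k) (\<lambda>x u. res F x (L x) (\<eta> x) (\<theta> (L x) u)) \<in> nat_trans C R (?Q k) F"
        by (rule ext[OF \<theta>(1)])
      fix x u assume x: "x \<in> Obj C" and u: "u \<in> carrier (val (?Q (Suc k)) x)"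
      show "\<phi> x u = nt_restrict C (?Q k) (\<lambda>x u. res F x (L x) (\<eta> x) (\<theta> (L x) u)) x (?d k x u)"
        using x u nat_trans_pullback_unit[OF PD(2) \<phi>n x, of u] by (simp add: dc L_closed \<theta>(2))
    qed
  next
    fix \<psi> assume \<psi>: "\<psi> \<in> carrier ?ZP"
    then have \<psi>n: "\<psi> \<in> nat_trans C' R (P (Suc k)) F"
      and z: "\<And>x u. x \<in> D \<Longrightarrow> u \<in> carrier (val (P (Suc (Suc k))) x) \<Longrightarrow> \<psi> x (d (Suc k) x u) = \<zero>\<^bsub>val F x\<^esub>"
      by (auto simp: Hom_cocycles_iff)
    let ?\<phi> = "nt_restrict C (?Q (Suc k)) (\<lambda>x u. res F x (L x) (\<eta> x) (\<psi> (L x) u))"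
    have \<phi>Z: "?\<phi> \<in> carrier ?ZQ"
      using ext[OF \<psi>n]
      by (auto simp: Hom_cocycles_iff dc L_closed z
          mod_hom_zero[OF cat_moduleD(1)[OF F] cat_moduleD(1)[OF F] cat_moduleD(3)[OF F]] L_Obj \<eta>_Hom)
    have "?\<Phi> ?\<phi> = \<psi>"
    proof (rule nat_trans_eqI[OF \<Phi>nat[OF ext[OF \<psi>n]] \<psi>n])
      fix x u assume x: "x \<in> Obj C'" and u: "u \<in> carrier (val (P (Suc k)) x)"
      then show "?\<Phi> ?\<phi> x u = \<psi> x u"
        using nat_transD(2)[OF \<psi>n x u] by (simp add: D_Obj L_id \<eta>_id cat_moduleD(2)[OF F])
    qed
    moreover have "\<psi> \<ominus>\<^bsub>?ZP\<^esub> \<psi> = \<zero>\<^bsub>?ZP\<^esub>"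
      using module_minus_eq_zero_iff[OF sP(1) \<psi> \<psi>] by simp
    moreover have "\<zero>\<^bsub>?ZP\<^esub> \<in> Hom_coboundaries C' R P d F (Suc k)"
      using submodule.axioms(1)[OF sP(2)[of k]] by (auto dest: subgroup.one_closed)
    ultimately show "\<exists>\<phi>\<in>carrier ?ZQ. \<psi> \<ominus>\<^bsub>?ZP\<^esub> ?\<Phi> \<phi> \<in> Hom_coboundaries C' R P d F (Suc k)"
      using \<phi>Z by (intro bexI[of _ ?\<phi>]) simp_all
  qed
qed

theorem Ext_reflective_iso:
  fixes F :: "('o, 'a, 'r, 'm) cfunctor" and R :: "('r, 's) ring_scheme"
  assumes fin: "finite_cat C" and R: "cring R" and F: "cat_module C R F" and n: "n \<ge> 1"
  shows "mod_iso R (Ext C R n (const_functor R) F) (Ext C' R n (const_functor R) F)"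
proof -
  obtain k where k: "n = Suc k" using n by (cases n) auto
  interpret C: finite_cat C by fact
  interpret C': finite_cat C'
    unfolding finite_cat_def full_subcat_simps
    using finite_subset[OF D C.finite_Obj] C.finite_Hom[OF D_Obj D_Obj] C.Idn_Hom[OF D_Obj]
      C.Cmp_Hom[OF D_Obj D_Obj D_Obj] C.Cmp_Idn_left[OF D_Obj D_Obj] C.Cmp_Idn_right[OF D_Obj D_Obj]
      C.Cmp_assoc[OF D_Obj D_Obj D_Obj D_Obj]
    by (intro conjI allI impI; assumption?)
  have const: "cat_module A R (const_functor R)" for A :: "('o, 'a) cat"
    by (auto simp: cat_module_def const_functor_def regular_module_module[OF R] mod_hom_def)
  have chosen: "\<exists>P d \<epsilon>. chosen_resolution A R (const_functor R) = (P, d, \<epsilon>) \<and>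
      projective_resolution A R (const_functor R) P d \<epsilon>" if "finite_cat A" for A :: "('o, 'a) cat"
  proof -
    have "\<exists>t :: (nat \<Rightarrow> ('o, 'a, 'r, ('o \<times> 'a) list \<Rightarrow> 'r) cfunctor) \<times> _.
        case t of (P, d, \<epsilon>) \<Rightarrow> projective_resolution A R (const_functor R) P d \<epsilon>"
      using finite_cat.projective_resolution_exists[OF that R const finite_cat.objectwise_summand_const[OF that R]]
      by auto
    from someI_ex[OF this] show ?thesis
      unfolding chosen_resolution_def by (auto split: prod.splits)
  qed
  obtain Q dQ \<epsilon>Q where Q: "chosen_resolution C R (const_functor R) = (Q, dQ, \<epsilon>Q)"
    "projective_resolution C R (const_functor R) Q dQ \<epsilon>Q"
    using chosen[OF C.finite_cat_axioms] by blast
  obtain P d \<epsilon> where P: "chosen_resolution C' R (const_functor R) = (P, d, \<epsilon>)"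
    "projective_resolution C' R (const_functor R) P d \<epsilon>"
    using chosen[OF C'.finite_cat_axioms] by blast
  have "mod_iso R (Hom_cohomology C R Q dQ F (Suc k)) (Hom_cohomology C' R P d F (Suc k))"
    using mod_iso_trans[OF
        Hom_cohomology_independent[OF R const F pullback_resolution[OF P(2), unfolded pullback_const] Q(2)]
        Hom_cohomology_pullback_iso[OF R F P(2)]] .
  then show ?thesis by (simp add: Ext_def Q(1) P(1) k)
qed

text \<open>
  A compatible family is determined by its members at the objects of \<open>D\<close>, its member at \<open>x\<close> being the
  restriction along the unit of the one at \<open>L x\<close>; this also extends families from \<open>D\<close> to \<open>C\<close>.
\<close>

lemma cat_lim_quotient_iso:
  assumes R: "cring R" and F: "cat_module C R F" and A: "submodule A R (cat_lim C F)"
  shows "mod_iso R (mod_quotient (cat_lim C F) A) (mod_quotient (cat_lim C' F) ((\<lambda>s. restrict s D) ` A))"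
proof -
  note F' = full_subcat_cat_module[OF D F]
  note m = cat_lim_module[OF R F] and m' = cat_lim_module[OF R F']
  let ?f = "\<lambda>s. restrict s D"
  have Ac: "A \<subseteq> carrier (cat_lim C F)" by (rule module.submoduleE(1)[OF m A])
  have f: "?f \<in> mod_hom R (cat_lim C F) (cat_lim C' F)"
    by (rule mod_homI) (auto simp: D_Obj intro!: restrict_ext)
  have determined: "s x = res F x (L x) (\<eta> x) (s (L x))" if "s \<in> carrier (cat_lim C F)" "x \<in> Obj C" for s x
    using that by (simp add: L_Obj \<eta>_Hom)
  have inj: "s = t" if s: "s \<in> carrier (cat_lim C F)" and t: "t \<in> carrier (cat_lim C F)" and eq: "?f s = ?f t" for s t
  proof (rule PiE_ext)
    show "s \<in> (\<Pi>\<^sub>E x\<in>Obj C. carrier (val F x))" "t \<in> (\<Pi>\<^sub>E x\<in>Obj C. carrier (val F x))" using s t by auto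
    fix x assume x: "x \<in> Obj C"
    have "s (L x) = t (L x)" using fun_cong[OF eq, of "L x"] L_closed[OF x] by simp
    then show "s x = t x" using determined[OF s x] determined[OF t x] by simp
  qed
  have mA: "module R (mod_restrict (cat_lim C F) A)" by (rule mod_restrict_module[OF m A])
  have "?f \<in> mod_hom R (mod_restrict (cat_lim C F) A) (cat_lim C' F)"
    by (rule mod_homI)
      (simp_all add: mod_hom_closed[OF f] mod_hom_add[OF f] mod_hom_smult[OF f] subsetD[OF Ac] del: cat_lim_simps)
  from submodule_image[OF mA m' this] have fA: "submodule (?f ` A) R (cat_lim C' F)" by simp
  show ?thesis
  proof (rule mod_quotient_iso[OF m m' A fA f])
    show "s \<in> A" if s: "s \<in> carrier (cat_lim C F)" and fs: "?f s \<in> ?f ` A" for s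
    proof -
      obtain t where t: "t \<in> A" "?f s = ?f t" using fs by (rule imageE)
      then show ?thesis using inj[OF s subsetD[OF Ac t(1)] t(2)] by simp
    qed
    fix t assume t: "t \<in> carrier (cat_lim C' F)"
    define s where "s = (\<lambda>x\<in>Obj C. res F x (L x) (\<eta> x) (t (L x)))"
    have tc: "t x \<in> carrier (val F x)" if "x \<in> D" for x using t that by auto
    have tr: "res F x y a (t y) = t x" if "x \<in> D" "y \<in> D" "a \<in> Hom C x y" for x y a
      using t that by simp
    have "s \<in> carrier (cat_lim C F)"
    proof -
      have "res F x y a (s y) = s x" if x: "x \<in> Obj C" and y: "y \<in> Obj C" and a: "a \<in> Hom C x y" for x y a
      proof -
        note tL = tc[OF L_closed[OF y]]
        have "res F x y a (s y) = res F x (L y) (Cmp C (\<eta> y) a) (t (L y))"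
          using y cat_moduleD(5)[OF F x y L_Obj[OF y] a \<eta>_Hom[OF y] tL] by (simp add: s_def)
        also have "\<dots> = res F x (L x) (\<eta> x) (res F (L x) (L y) (La y a) (t (L y)))"
          using cat_moduleD(5)[OF F x L_Obj[OF x] L_Obj[OF y] \<eta>_Hom[OF x] La_Hom[OF x y a] tL]
          by (simp add: \<eta>_natural[OF x y a])
        also have "\<dots> = s x"
          using x tr[OF L_closed[OF x] L_closed[OF y] La_Hom[OF x y a]] by (simp add: s_def)
        finally show ?thesis .
      qed
      then show ?thesis
        using cat_moduleD(4)[OF F _ L_Obj \<eta>_Hom tc[OF L_closed]] by (auto simp: s_def)
    qed
    moreover have "?f s = t"
    proof (rule PiE_ext)
      show "?f s \<in> (\<Pi>\<^sub>E x\<in>D. carrier (val F x))" "t \<in> (\<Pi>\<^sub>E x\<in>D. carrier (val F x))"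
        using mod_hom_closed[OF f \<open>s \<in> carrier (cat_lim C F)\<close>] t by auto
      show "?f s x = t x" if "x \<in> D" for x
        using that tc by (simp add: s_def D_Obj L_id \<eta>_id cat_moduleD(2)[OF F])
    qed
    moreover have "t \<ominus>\<^bsub>cat_lim C' F\<^esub> t = \<zero>\<^bsub>cat_lim C' F\<^esub>"
      using module_minus_eq_zero_iff[OF m' t t] by simp
    moreover have "\<zero>\<^bsub>cat_lim C' F\<^esub> \<in> ?f ` A"
      using submodule.axioms(1)[OF fA] by (auto dest: subgroup.one_closed)
    ultimately show "\<exists>s\<in>carrier (cat_lim C F). t \<ominus>\<^bsub>cat_lim C' F\<^esub> ?f s \<in> ?f ` A"
      by (intro bexI[of _ s]) simp_all
  qed auto
qed

end

section \<open>Nontrivial normal subgroups of a finite p-group meet the centre\<close>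

context group
begin

lemma cancel_inv:
  assumes "x \<in> carrier G" "y \<in> carrier G"
  shows "x \<otimes> (inv x \<otimes> y) = y" "inv x \<otimes> (x \<otimes> y) = y"
  using assms by (simp_all flip: m_assoc)

lemma conjugation_action:
  assumes U: "subgroup U G" and V: "V \<subseteq> carrier G"
    and normal: "\<And>u v. u \<in> U \<Longrightarrow> v \<in> V \<Longrightarrow> u \<otimes> v \<otimes> inv u \<in> V"
  shows "group_action (G\<lparr>carrier := U\<rparr>) V (\<lambda>u. \<lambda>v\<in>V. u \<otimes> v \<otimes> inv u)"
proof -
  have Uc: "u \<in> carrier G" if "u \<in> U" for u using subgroup.subset[OF U] that by blast
  have Vc: "v \<in> carrier G" if "v \<in> V" for v using V that by blast
  note iU = subgroup.m_inv_closed[OF U]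
  have bij: "(\<lambda>v\<in>V. u \<otimes> v \<otimes> inv u) \<in> Bij V" if u: "u \<in> U" for u
  proof -
    have "bij_betw (\<lambda>v. u \<otimes> v \<otimes> inv u) V V"
    proof (rule bij_betw_byWitness[where f' = "\<lambda>v. inv u \<otimes> v \<otimes> inv (inv u)"])
      show "(\<lambda>v. u \<otimes> v \<otimes> inv u) ` V \<subseteq> V" using normal[OF u] by auto
      show "(\<lambda>v. inv u \<otimes> v \<otimes> inv (inv u)) ` V \<subseteq> V" using normal[OF iU[OF u]] by auto
    qed (auto simp: m_assoc cancel_inv Vc Uc[OF u])
    then show ?thesis by (simp add: Bij_def bij_betw_restrict_eq)
  qed
  have "(\<lambda>v\<in>V. u \<otimes> w \<otimes> v \<otimes> inv (u \<otimes> w)) = compose V (\<lambda>v\<in>V. u \<otimes> v \<otimes> inv u) (\<lambda>v\<in>V. w \<otimes> v \<otimes> inv w)"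
    if "u \<in> U" "w \<in> U" for u w
    using that normal by (auto simp: compose_def fun_eq_iff Uc Vc inv_mult_group m_assoc)
  then show ?thesis
    unfolding group_action_def group_hom_def group_hom_axioms_def
    using subgroup_imp_group[OF U] group_BijGroup
    by (auto simp: hom_def BijGroup_def bij)
qed

text \<open>
  The class equation: let \<open>U\<close> act on \<open>V\<close> by conjugation.  Orbit lengths divide a power of \<open>p\<close>, so if
  \<open>1\<close> were the only fixed point, all other orbits would have length divisible by \<open>p\<close> and \<open>card V\<close>
  would be \<open>1\<close> modulo \<open>p\<close>.
\<close>

lemma p_group_central_element:
  assumes p: "Factorial_Ring.prime p" and fin: "finite (carrier G)" and order: "order G = p ^ k"
    and U: "subgroup U G" and V: "subgroup V G"
    and normal: "\<And>u v. u \<in> U \<Longrightarrow> v \<in> V \<Longrightarrow> u \<otimes> v \<otimes> inv u \<in> V"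
    and nontriv: "V \<noteq> {\<one>}"
  shows "\<exists>x\<in>V. x \<noteq> \<one> \<and> (\<forall>u\<in>U. x \<otimes> u = u \<otimes> x)"
proof (rule ccontr)
  assume no: "\<not> ?thesis"
  let ?H = "G\<lparr>carrier := U\<rparr>" and ?\<phi> = "\<lambda>u. \<lambda>v\<in>V. u \<otimes> v \<otimes> inv u"
  note Uc = subgroup.mem_carrier[OF U] and Vc = subgroup.mem_carrier[OF V]
  interpret A: group_action ?H V ?\<phi>
    using conjugation_action[OF U subgroup.subset[OF V] normal] .
  have finV: "finite V" using finite_subset[OF subgroup.subset[OF V] fin] .
  have card_pow: "\<exists>i. card W = p ^ i" if "subgroup W G" for W
    using lagrange[OF that] order divides_primepow_nat[OF p, of "card W" k] by (metis dvd_triv_right)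
  have p_dvd: "p dvd n" if "n dvd p ^ i" "n \<noteq> 1" for n i
    using divides_primepow_nat[OF p, of n i] that by (metis dvd_power gr0I power_0)
  have "card V \<noteq> 1"
    using nontriv subgroup.one_closed[OF V] by (auto simp: card_1_singleton_iff)
  then have pV: "p dvd card V"
    using card_pow[OF V] p_dvd by auto
  let ?O = "orbits ?H V ?\<phi>"
  have orbit_one: "orbit ?H ?\<phi> \<one> = {\<one>}"
    using subgroup.one_closed[OF U] subgroup.one_closed[OF V] Uc
    by (auto simp: orbit_def intro!: exI[of _ \<one>])
  have one: "{\<one>} \<in> ?O"
    using subgroup.one_closed[OF V] unfolding orbits_def by (intro CollectI exI[of _ \<one>]) (simp only: orbit_one)
  have "?O \<subseteq> Pow V" using A.orbits_coverture by blast
  then have finO: "finite ?O" by (rule finite_subset) (simp add: finV)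
  have "p dvd card orb" if orb: "orb \<in> ?O - {{\<one>}}" for orb
  proof -
    obtain x where x: "x \<in> V" "orb = orbit ?H ?\<phi> x" using orb by (auto simp: orbits_def)
    have "card orb dvd order ?H"
      unfolding x(2) by (rule dvdI[OF A.orbit_stabilizer_theorem[OF x(1), symmetric]])
    then obtain i where dvd: "card orb dvd p ^ i"
      using card_pow[OF U] by (auto simp: order_def)
    have "card orb \<noteq> 1"
    proof
      assume "card orb = 1"
      then obtain y where y: "orb = {y}" by (auto simp: card_1_singleton_iff)
      have xy: "y = x" using A.orbit_refl[OF x(1)] unfolding x(2)[symmetric] y by simp
      have "u \<otimes> x \<otimes> inv u = x" if "u \<in> U" for u
      proof -
        have "?\<phi> u x \<in> orb" unfolding x(2) orbit_def using that by auto
        then show ?thesis using xy y x(1) by simp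
      qed
      then have "x \<otimes> u = u \<otimes> x" if "u \<in> U" for u
        using that Uc Vc x(1) by (simp add: inv_solve_right')
      moreover have "x \<noteq> \<one>" using orb x(2) orbit_one by auto
      ultimately show False using no x(1) by blast
    qed
    then show ?thesis using p_dvd[OF dvd] by blast
  qed
  then have "p dvd (\<Sum>orb\<in>?O - {{\<one>}}. card orb)" by (rule dvd_sum)
  moreover have "card V = 1 + (\<Sum>orb\<in>?O - {{\<one>}}. card orb)"
    using A.disjoint_sum[OF finV, of "\<lambda>_. 1::nat"] sum.remove[OF finO one, of card] by simp
  ultimately have "p dvd 1" using pV dvd_add_left_iff[of p _ 1] by simp
  then show False using p by simp
qed

text \<open>
  Repeatedly raising \<open>x\<close> to the power \<open>p\<close> leads to an element of order \<open>p\<close> just before reaching \<open>1\<close>.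
\<close>

lemma pow_prime_power_descent:
  assumes x: "x \<in> carrier G" "x \<noteq> \<one>" "x [^] (p ^ k :: nat) = \<one>"
  shows "\<exists>i. x [^] (p ^ i :: nat) \<noteq> \<one> \<and> (x [^] (p ^ i :: nat)) [^] p = \<one>"
proof -
  let ?m = "LEAST m. x [^] (p ^ m :: nat) = \<one>"
  have m: "x [^] (p ^ ?m :: nat) = \<one>" by (rule LeastI[of _ k]) (rule x(3))
  then obtain i where i: "?m = Suc i" using x by (cases ?m) auto
  have "x [^] (p ^ i :: nat) \<noteq> \<one>" using not_less_Least[of i "\<lambda>m. x [^] (p ^ m :: nat) = \<one>"] i by auto
  moreover have "(x [^] (p ^ i :: nat)) [^] p = \<one>"
    using m x(1) unfolding i by (simp add: nat_pow_pow mult.commute)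
  ultimately show ?thesis by blast
qed

section \<open>The orbit category of sections\<close>

lemma sectionsD:
  assumes "s \<in> sections G"
  shows "subgroup (fst s) G" "subgroup (snd s) G" "snd s \<subseteq> fst s"
    "u \<in> fst s \<Longrightarrow> v \<in> snd s \<Longrightarrow> u \<otimes> v \<otimes> inv u \<in> snd s"
proof -
  obtain U V where s: "s = (U, V)" by (cases s)
  have U: "subgroup U G" and V: "subgroup V G" and n: "V \<lhd> G\<lparr>carrier := U\<rparr>"
    using assms s by (auto simp: sections_def)
  show "subgroup (fst s) G" "subgroup (snd s) G" using U V s by auto
  show "snd s \<subseteq> fst s"
    using subgroup.subset[OF normal_imp_subgroup[OF n]] s by simp
  show "u \<in> fst s \<Longrightarrow> v \<in> snd s \<Longrightarrow> u \<otimes> v \<otimes> inv u \<in> snd s"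
    using normal.inv_op_closed2[OF n, of u v] m_inv_consistent[OF U, of u] s by simp
qed

lemma conj_set_eq: "conj_set G g X = (\<lambda>x. g \<otimes> x \<otimes> inv g) ` X"
  by (auto simp: conj_set_def l_coset_def r_coset_def)

lemma conj_set_mult:
  assumes "g \<in> carrier G" "h \<in> carrier G" "X \<subseteq> carrier G"
  shows "conj_set G (h \<otimes> g) X = conj_set G h (conj_set G g X)"
  unfolding conj_set_eq image_image
  using assms by (intro image_cong) (auto simp: inv_mult_group m_assoc subset_iff)

lemma conj_set_one: "X \<subseteq> carrier G \<Longrightarrow> conj_set G \<one> X = X"
  by (force simp: conj_set_eq)

lemma conj_section_le_iff:
  assumes "s \<in> sections G"
  shows "conj_section G g s \<preceq> t \<longleftrightarrow> snd t \<subseteq> conj_set G g (snd s) \<and> conj_set G g (fst s) \<subseteq> fst t"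
  using sectionsD(3)[OF assms] by (auto simp: section_le_def conj_section_def conj_set_eq)

lemma orbit_cat_simps [simp]:
  "Obj (section_orbit_cat G \<C>) = \<C>"
  "Cmp (section_orbit_cat G \<C>) b a = b <#> a"
  "Idn (section_orbit_cat G \<C>) s = fst s #> \<one>"
  by (simp_all add: section_orbit_cat_def)

lemma orbit_cat_HomI:
  assumes "s \<in> sections G" "g \<in> carrier G" "snd t \<subseteq> conj_set G g (snd s)" "conj_set G g (fst s) \<subseteq> fst t"
  shows "fst t #> g \<in> Hom (section_orbit_cat G \<C>) s t"
  using assms conj_section_le_iff[OF assms(1)] by (auto simp: section_orbit_cat_def)

lemma orbit_cat_HomE:
  assumes "a \<in> Hom (section_orbit_cat G \<C>) s t" "s \<in> sections G"
  obtains g where "g \<in> carrier G" "a = fst t #> g" "snd t \<subseteq> conj_set G g (snd s)" "conj_set G g (fst s) \<subseteq> fst t"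
  using assms conj_section_le_iff[OF assms(2)] by (auto simp: section_orbit_cat_def)

text \<open>
  This is the composition law of the orbit category in terms of representatives.
\<close>

lemma coset_product:
  assumes N: "subgroup N G" and M: "subgroup M G" and gh: "g \<in> carrier G" "h \<in> carrier G"
    and hM: "conj_set G h M \<subseteq> N"
  shows "(N #> h) <#> (M #> g) = N #> (h \<otimes> g)"
proof (intro equalityI subsetI)
  note Nc = subgroup.mem_carrier[OF N] and Mc = subgroup.mem_carrier[OF M]
  fix x assume "x \<in> (N #> h) <#> (M #> g)"
  then obtain n m where nm: "n \<in> N" "m \<in> M" "x = (n \<otimes> h) \<otimes> (m \<otimes> g)"
    by (auto simp: set_mult_def r_coset_def)
  have "x = (n \<otimes> (h \<otimes> m \<otimes> inv h)) \<otimes> (h \<otimes> g)"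
    using nm gh Nc Mc by (simp add: m_assoc cancel_inv)
  moreover have "n \<otimes> (h \<otimes> m \<otimes> inv h) \<in> N"
    using hM nm(2) by (intro subgroup.m_closed[OF N nm(1)]) (auto simp: conj_set_eq)
  ultimately show "x \<in> N #> (h \<otimes> g)" by (auto simp: r_coset_def)
next
  fix x assume "x \<in> N #> (h \<otimes> g)"
  then obtain n where "n \<in> N" "x = n \<otimes> (h \<otimes> g)" by (auto simp: r_coset_def)
  then have "x = (n \<otimes> h) \<otimes> (\<one> \<otimes> g)" using gh subgroup.mem_carrier[OF N] by (simp add: m_assoc)
  then show "x \<in> (N #> h) <#> (M #> g)"
    using \<open>n \<in> N\<close> subgroup.one_closed[OF M] by (auto simp: set_mult_def r_coset_def)
qed

lemma orbit_cat_finite_cat: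
  assumes fin: "finite (carrier G)" and \<C>: "\<C> \<subseteq> sections G"
  shows "finite_cat (section_orbit_cat G \<C>)"
proof -
  have sec: "s \<in> sections G" if "s \<in> \<C>" for s using \<C> that by blast
  have fc: "fst s \<subseteq> carrier G" and sc: "snd s \<subseteq> carrier G" if "s \<in> \<C>" for s
    using sectionsD(1,2)[OF sec[OF that]] subgroup.subset by auto
  have HomC: "a \<subseteq> carrier G" if s: "s \<in> \<C>" and t: "t \<in> \<C>" and a: "a \<in> Hom (section_orbit_cat G \<C>) s t" for s t a
  proof -
    obtain g where "g \<in> carrier G" "a = fst t #> g"
      using orbit_cat_HomE[OF a sec[OF s]] by blast
    then show ?thesis using r_coset_subset_G[OF fc[OF t]] by simp
  qed
  show ?thesis
  proof
    show "finite (Obj (section_orbit_cat G \<C>))"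
      by (rule finite_subset[of _ "Pow (carrier G) \<times> Pow (carrier G)"])
        (simp_all add: fin subset_iff[of \<C>] mem_Times_iff fc sc)
    show "finite (Hom (section_orbit_cat G \<C>) s t)" for s t
      by (rule finite_subset[of _ "(\<lambda>g. fst t #> g) ` carrier G"]) (auto simp: section_orbit_cat_def fin)
  next
    fix s assume "s \<in> Obj (section_orbit_cat G \<C>)"
    then show "Idn (section_orbit_cat G \<C>) s \<in> Hom (section_orbit_cat G \<C>) s s"
      using orbit_cat_HomI[OF sec one_closed, of s s] by (simp add: conj_set_one fc sc)
  next
    fix x y z a b
    assume xyz: "x \<in> Obj (section_orbit_cat G \<C>)" "y \<in> Obj (section_orbit_cat G \<C>)" "z \<in> Obj (section_orbit_cat G \<C>)"
      and a: "a \<in> Hom (section_orbit_cat G \<C>) x y" and b: "b \<in> Hom (section_orbit_cat G \<C>) y z"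
    have x: "x \<in> \<C>" and y: "y \<in> \<C>" and z: "z \<in> \<C>" using xyz by simp_all
    obtain g where g: "g \<in> carrier G" "a = fst y #> g" "snd y \<subseteq> conj_set G g (snd x)" "conj_set G g (fst x) \<subseteq> fst y"
      using orbit_cat_HomE[OF a sec[OF x]] .
    obtain h where h: "h \<in> carrier G" "b = fst z #> h" "snd z \<subseteq> conj_set G h (snd y)" "conj_set G h (fst y) \<subseteq> fst z"
      using orbit_cat_HomE[OF b sec[OF y]] .
    have "b <#> a = fst z #> (h \<otimes> g)"
      unfolding g(2) h(2)
      by (rule coset_product[OF sectionsD(1)[OF sec[OF z]] sectionsD(1)[OF sec[OF y]] g(1) h(1,4)])
    moreover have "conj_set G h (snd y) \<subseteq> conj_set G h (conj_set G g (snd x))"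
      "conj_set G h (conj_set G g (fst x)) \<subseteq> conj_set G h (fst y)"
      using g(3,4) by (auto simp: conj_set_eq[of h])
    ultimately show "Cmp (section_orbit_cat G \<C>) b a \<in> Hom (section_orbit_cat G \<C>) x z"
      using orbit_cat_HomI[OF sec[OF x], of "h \<otimes> g" z] g(1) h conj_set_mult[OF g(1) h(1)] fc[OF x] sc[OF x]
      by auto
  next
    fix x y a assume xy: "x \<in> Obj (section_orbit_cat G \<C>)" "y \<in> Obj (section_orbit_cat G \<C>)"
      and a: "a \<in> Hom (section_orbit_cat G \<C>) x y"
    have x: "x \<in> \<C>" and y: "y \<in> \<C>" using xy by simp_all
    obtain g where g: "g \<in> carrier G" "a = fst y #> g" "conj_set G g (fst x) \<subseteq> fst y"
      using orbit_cat_HomE[OF a sec[OF x]] by metis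
    note sx = sectionsD(1)[OF sec[OF x]] and sy = sectionsD(1)[OF sec[OF y]]
    show "Cmp (section_orbit_cat G \<C>) (Idn (section_orbit_cat G \<C>) y) a = a"
      using coset_product[OF sy sy g(1) one_closed] g by (simp add: conj_set_one fc[OF y])
    show "Cmp (section_orbit_cat G \<C>) a (Idn (section_orbit_cat G \<C>) x) = a"
      using coset_product[OF sy sx one_closed g(1)] g by simp
  next
    fix w x y z a b c
    assume "w \<in> Obj (section_orbit_cat G \<C>)" "x \<in> Obj (section_orbit_cat G \<C>)"
      "y \<in> Obj (section_orbit_cat G \<C>)" "z \<in> Obj (section_orbit_cat G \<C>)"
      and "a \<in> Hom (section_orbit_cat G \<C>) w x" "b \<in> Hom (section_orbit_cat G \<C>) x y"
      "c \<in> Hom (section_orbit_cat G \<C>) y z"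
    then show "Cmp (section_orbit_cat G \<C>) c (Cmp (section_orbit_cat G \<C>) b a) =
      Cmp (section_orbit_cat G \<C>) (Cmp (section_orbit_cat G \<C>) c b) a"
      using HomC by (simp add: set_mult_assoc)
  qed
qed

end

section \<open>Reflecting sections onto centralizer sections\<close>

text \<open>
  For a section \<open>(U, V)\<close> this is the largest elementary abelian \<open>p\<close>-subgroup of the intersection of
  \<open>V\<close> with the centre of \<open>U\<close>.
\<close>

definition central_torsion :: "nat \<Rightarrow> ('g, 'h) monoid_scheme \<Rightarrow> 'g section_pair \<Rightarrow> 'g set"
  where "central_torsion p G s =
    {x \<in> snd s. (\<forall>u\<in>fst s. x \<otimes>\<^bsub>G\<^esub> u = u \<otimes>\<^bsub>G\<^esub> x) \<and> x [^]\<^bsub>G\<^esub> p = \<one>\<^bsub>G\<^esub>}"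

definition centralizer_reflection ::
  "nat \<Rightarrow> ('g, 'h) monoid_scheme \<Rightarrow> 'g section_pair \<Rightarrow> 'g section_pair"
  where "centralizer_reflection p G s = (centralizer G (central_torsion p G s), central_torsion p G s)"

locale finite_p_group = group G for G :: "('g, 'h) monoid_scheme" (structure) +
  fixes p k :: nat
  assumes prime: "Factorial_Ring.prime p" and finite_carrier: "finite (carrier G)" and order: "order G = p ^ k"
begin

abbreviation "\<Omega> \<equiv> central_torsion p G"
abbreviation "L \<equiv> centralizer_reflection p G"
abbreviation "\<N> \<equiv> nontrivial_sections G"
abbreviation "\<Z> \<equiv> centralizer_sections p G"

lemma nontrivial_sections:
  assumes "s \<in> \<N>" shows "s \<in> sections G" "snd s \<noteq> {\<one>}"
  using assms unfolding nontrivial_sections_def by (simp_all add: split_beta)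

lemma centralizer_subgroup:
  assumes "E \<subseteq> carrier G" shows "subgroup (centralizer G E) G"
proof (rule subgroupI)
  show "centralizer G E \<noteq> {}" using assms by (auto simp: centralizer_def intro!: exI[of _ \<one>])
  show "inv a \<in> centralizer G E" if "a \<in> centralizer G E" for a
  proof -
    have a: "a \<in> carrier G" "\<And>x. x \<in> E \<Longrightarrow> a \<otimes> x = x \<otimes> a" using that by (auto simp: centralizer_def)
    have "inv a \<otimes> x = x \<otimes> inv a" if x: "x \<in> E" for x
    proof -
      have xc: "x \<in> carrier G" using x assms by blast
      have "inv a \<otimes> x = inv a \<otimes> (x \<otimes> a) \<otimes> inv a" using a(1) xc by (simp add: m_assoc)
      also have "\<dots> = inv a \<otimes> (a \<otimes> x) \<otimes> inv a" by (simp only: a(2)[OF x])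
      also have "\<dots> = x \<otimes> inv a" using a(1) xc by (simp add: m_assoc cancel_inv)
      finally show ?thesis .
    qed
    then show ?thesis using a by (simp add: centralizer_def)
  qed
  show "a \<otimes> b \<in> centralizer G E" if "a \<in> centralizer G E" "b \<in> centralizer G E" for a b
  proof -
    have a: "a \<in> carrier G" "\<And>x. x \<in> E \<Longrightarrow> a \<otimes> x = x \<otimes> a"
      and b: "b \<in> carrier G" "\<And>x. x \<in> E \<Longrightarrow> b \<otimes> x = x \<otimes> b" using that by (auto simp: centralizer_def)
    have "a \<otimes> b \<otimes> x = x \<otimes> (a \<otimes> b)" if x: "x \<in> E" for x
    proof -
      have xc: "x \<in> carrier G" using x assms by blast
      have "a \<otimes> b \<otimes> x = a \<otimes> x \<otimes> b" using a(1) b(1) xc b(2)[OF x] by (simp add: m_assoc)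
      also have "\<dots> = x \<otimes> (a \<otimes> b)" using a(1) b(1) xc by (simp add: a(2)[OF x] m_assoc)
      finally show ?thesis .
    qed
    then show ?thesis using a b by (simp add: centralizer_def)
  qed
qed (auto simp: centralizer_def)

lemma central_torsion_elementary_abelian:
  assumes s: "s \<in> sections G" shows "elementary_abelian_subgroup p G (\<Omega> s)"
proof -
  note U = sectionsD(1)[OF s] and V = sectionsD(2)[OF s] and VU = sectionsD(3)[OF s]
  note Vc = subgroup.mem_carrier[OF V]
  have comm: "x \<otimes> y = y \<otimes> x" if "x \<in> \<Omega> s" "y \<in> \<Omega> s" for x y
    using that VU by (auto simp: central_torsion_def)
  have C: "subgroup (centralizer G (fst s)) G"
    by (rule centralizer_subgroup[OF subgroup.subset[OF U]])
  have iff: "x \<in> \<Omega> s \<longleftrightarrow> x \<in> snd s \<and> x \<in> centralizer G (fst s) \<and> x [^] p = \<one>" for x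
    using Vc by (auto simp: central_torsion_def centralizer_def)
  have "subgroup (\<Omega> s) G"
  proof (rule subgroupI)
    show "\<Omega> s \<subseteq> carrier G" using Vc by (auto simp: iff)
    show "\<Omega> s \<noteq> {}"
      using subgroup.one_closed[OF V] subgroup.one_closed[OF C] nat_pow_one iff by blast
    show "inv x \<in> \<Omega> s" if "x \<in> \<Omega> s" for x
      using that subgroup.m_inv_closed[OF V] subgroup.m_inv_closed[OF C] Vc by (auto simp: iff nat_pow_inv)
    show "x \<otimes> y \<in> \<Omega> s" if "x \<in> \<Omega> s" "y \<in> \<Omega> s" for x y
      using that subgroup.m_closed[OF V] subgroup.m_closed[OF C] Vc comm[OF that]
      by (auto simp: iff pow_mult_distrib)
  qed
  then show ?thesis using comm by (auto simp: elementary_abelian_subgroup_def iff)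
qed

text \<open>
  Since \<open>V\<close> is a nontrivial normal subgroup of the \<open>p\<close>-group \<open>U\<close>, it contains a nontrivial central
  element of \<open>U\<close>, and some power of that element has order \<open>p\<close>.
\<close>

lemma central_torsion_nontrivial:
  assumes s: "s \<in> \<N>" shows "\<Omega> s \<noteq> {\<one>}"
proof -
  note S = nontrivial_sections[OF s]
  note Vc = subgroup.mem_carrier[OF sectionsD(2)[OF S(1)]]
    and Uc = subgroup.mem_carrier[OF sectionsD(1)[OF S(1)]]
  obtain x where x: "x \<in> snd s" "x \<noteq> \<one>" "\<And>u. u \<in> fst s \<Longrightarrow> x \<otimes> u = u \<otimes> x"
    using p_group_central_element[OF prime finite_carrier order sectionsD(1)[OF S(1)] sectionsD(2)[OF S(1)]
        sectionsD(4)[OF S(1)] S(2)] by blast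
  have "x [^] (p ^ k) = \<one>" using pow_order_eq_1[OF Vc[OF x(1)]] order by simp
  then obtain i where i: "x [^] (p ^ i) \<noteq> \<one>" "(x [^] (p ^ i)) [^] p = \<one>"
    using pow_prime_power_descent[OF Vc[OF x(1)] x(2)] by blast
  have mem: "x [^] n \<in> snd s" for n :: nat
    using subgroup.m_closed[OF sectionsD(2)[OF S(1)]] subgroup.one_closed[OF sectionsD(2)[OF S(1)]] x(1)
    by (induction n) auto
  have "x [^] n \<otimes> u = u \<otimes> x [^] n" if "u \<in> fst s" for u and n :: nat
  proof (induction n)
    case (Suc n)
    have "x [^] n \<otimes> x \<otimes> u = x [^] n \<otimes> u \<otimes> x"
      using that Uc Vc x by (simp add: m_assoc)
    then show ?case using Suc that Uc Vc x by (simp add: m_assoc)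
  qed (use that Uc in simp)
  then have "x [^] (p ^ i) \<in> \<Omega> s" using mem i(2) by (simp add: central_torsion_def)
  then show ?thesis using i(1) by blast
qed

lemma reflection_centralizer_section: "s \<in> \<N> \<Longrightarrow> L s \<in> \<Z>"
  using central_torsion_elementary_abelian central_torsion_nontrivial nontrivial_sections(1)
  by (auto simp: centralizer_sections_def centralizer_reflection_def)

lemma centralizer_sections_nontrivial: "\<Z> \<subseteq> \<N>"
proof
  fix s assume "s \<in> \<Z>"
  then obtain E where s: "s = (centralizer G E, E)" and E: "elementary_abelian_subgroup p G E" "E \<noteq> {\<one>}"
    by (auto simp: centralizer_sections_def)
  have sub: "subgroup E G" using E by (simp add: elementary_abelian_subgroup_def)
  have C: "subgroup (centralizer G E) G" by (rule centralizer_subgroup[OF subgroup.subset[OF sub]])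
  have "E \<subseteq> centralizer G E"
    using E subgroup.subset[OF sub] by (auto simp: elementary_abelian_subgroup_def centralizer_def)
  then have EC: "subgroup E (G\<lparr>carrier := centralizer G E\<rparr>)" by (rule subgroup_incl[OF sub C])
  have "E \<lhd> G\<lparr>carrier := centralizer G E\<rparr>"
  proof (rule group.normal_invI[OF subgroup_imp_group[OF C] EC])
    fix g x assume g: "g \<in> carrier (G\<lparr>carrier := centralizer G E\<rparr>)" and x: "x \<in> E"
    have "g \<otimes> x \<otimes> inv g = x"
      using g x subgroup.mem_carrier[OF sub x] by (auto simp: centralizer_def m_assoc)
    then show "g \<otimes>\<^bsub>G\<lparr>carrier := centralizer G E\<rparr>\<^esub> x \<otimes>\<^bsub>G\<lparr>carrier := centralizer G E\<rparr>\<^esub>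
        inv\<^bsub>G\<lparr>carrier := centralizer G E\<rparr>\<^esub> g \<in> E"
      using g x m_inv_consistent[OF C, of g] by simp
  qed
  then show "s \<in> \<N>" using s sub C E by (simp add: nontrivial_sections_def sections_def)
qed

lemma reflection_id: "s \<in> \<Z> \<Longrightarrow> L s = s"
proof -
  assume "s \<in> \<Z>"
  then obtain E where s: "s = (centralizer G E, E)" and E: "elementary_abelian_subgroup p G E"
    by (auto simp: centralizer_sections_def)
  have "\<Omega> s = E"
    using E by (auto simp: s central_torsion_def elementary_abelian_subgroup_def centralizer_def)
  then show ?thesis by (simp add: centralizer_reflection_def s)
qed

lemma le_reflection:
  assumes s: "s \<in> sections G" shows "fst s \<subseteq> fst (L s)" "snd (L s) \<subseteq> snd s"
  using subgroup.mem_carrier[OF sectionsD(1)[OF s]]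
  by (auto simp: centralizer_reflection_def centralizer_def central_torsion_def)

lemma conj_mult:
  assumes "g \<in> carrier G" "x \<in> carrier G" "y \<in> carrier G"
  shows "(g \<otimes> x \<otimes> inv g) \<otimes> (g \<otimes> y \<otimes> inv g) = g \<otimes> (x \<otimes> y) \<otimes> inv g"
  using assms by (simp add: m_assoc cancel_inv)

lemma conj_pow:
  assumes "g \<in> carrier G" "x \<in> carrier G"
  shows "(g \<otimes> x \<otimes> inv g) [^] (n :: nat) = g \<otimes> x [^] n \<otimes> inv g"
  using assms by (induction n) (simp_all add: conj_mult)

lemma conj_eq_iff:
  assumes "g \<in> carrier G" "x \<in> carrier G" "y \<in> carrier G"
  shows "g \<otimes> x \<otimes> inv g = g \<otimes> y \<otimes> inv g \<longleftrightarrow> x = y"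
  using assms by simp

text \<open>
  If \<open>g\<close> represents an arrow from \<open>s\<close> to \<open>t\<close>, then conjugating \<open>\<Omega> t\<close> back by \<open>g\<close> gives elements of
  \<open>snd s\<close> that commute with \<open>fst s\<close>, hence elements of \<open>\<Omega> s\<close>.  Passing to centralizers reverses
  the inclusion, so \<open>g\<close> represents an arrow between the reflections as well.
\<close>

lemma reflection_arrow:
  assumes s: "s \<in> sections G" and t: "t \<in> sections G" and g: "g \<in> carrier G"
    and V: "snd t \<subseteq> conj_set G g (snd s)" and U: "conj_set G g (fst s) \<subseteq> fst t"
  shows "snd (L t) \<subseteq> conj_set G g (snd (L s))" "conj_set G g (fst (L s)) \<subseteq> fst (L t)"
proof -
  note Uc = subgroup.mem_carrier[OF sectionsD(1)[OF s]] and Vc = subgroup.mem_carrier[OF sectionsD(2)[OF s]]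
  show 1: "snd (L t) \<subseteq> conj_set G g (snd (L s))"
  proof
    fix x assume "x \<in> snd (L t)"
    then have x: "x \<in> snd t" "\<And>u. u \<in> fst t \<Longrightarrow> x \<otimes> u = u \<otimes> x" "x [^] p = \<one>"
      by (auto simp: centralizer_reflection_def central_torsion_def)
    obtain v where v: "v \<in> snd s" "x = g \<otimes> v \<otimes> inv g" using V x(1) by (auto simp: conj_set_eq)
    have "v \<otimes> u = u \<otimes> v" if u: "u \<in> fst s" for u
    proof -
      have "g \<otimes> u \<otimes> inv g \<in> fst t" using U u by (auto simp: conj_set_eq)
      from x(2)[OF this] have "g \<otimes> (v \<otimes> u) \<otimes> inv g = g \<otimes> (u \<otimes> v) \<otimes> inv g"
        unfolding v(2) by (simp add: conj_mult g Uc[OF u] Vc[OF v(1)])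
      then show ?thesis using conj_eq_iff[OF g] Uc[OF u] Vc[OF v(1)] by simp
    qed
    moreover have "v [^] p = \<one>"
    proof -
      have "g \<otimes> v [^] p \<otimes> inv g = g \<otimes> \<one> \<otimes> inv g"
        using x(3) conj_pow[OF g Vc[OF v(1)]] g v(2) by simp
      then show ?thesis using conj_eq_iff[OF g] Vc[OF v(1)] by simp
    qed
    ultimately have "v \<in> snd (L s)" using v(1) by (simp add: centralizer_reflection_def central_torsion_def)
    then show "x \<in> conj_set G g (snd (L s))" using v(2) by (auto simp: conj_set_eq)
  qed
  show "conj_set G g (fst (L s)) \<subseteq> fst (L t)"
  proof
    fix x assume "x \<in> conj_set G g (fst (L s))"
    then obtain c where c: "c \<in> centralizer G (\<Omega> s)" "x = g \<otimes> c \<otimes> inv g"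
      by (auto simp: conj_set_eq centralizer_reflection_def)
    then have cc: "c \<in> carrier G" "\<And>w. w \<in> \<Omega> s \<Longrightarrow> c \<otimes> w = w \<otimes> c" by (auto simp: centralizer_def)
    have "x \<otimes> y = y \<otimes> x" if y: "y \<in> \<Omega> t" for y
    proof -
      obtain w where w: "w \<in> \<Omega> s" "y = g \<otimes> w \<otimes> inv g"
        using 1 y by (auto simp: conj_set_eq centralizer_reflection_def)
      have "w \<in> carrier G" using w(1) Vc by (simp add: central_torsion_def)
      then show ?thesis by (simp add: w(2) c(2) conj_mult g cc(1) cc(2)[OF w(1)])
    qed
    then show "x \<in> fst (L t)" using cc(1) c(2) g by (simp add: centralizer_reflection_def centralizer_def)
  qed
qed

text \<open>
  Multiplication by the group \<open>fst (L t)\<close>, which contains \<open>fst t\<close>, thus keeps the representatives of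
  an arrow to \<open>t\<close>.  This describes the reflector on arrows without choosing a representative.
\<close>

lemma reflection_on_coset:
  assumes t: "t \<in> sections G" and g: "g \<in> carrier G"
  shows "fst (L t) <#> (fst t #> g) = fst (L t) #> g"
proof -
  have C: "subgroup (fst (L t)) G"
    using subgroup.subset[OF sectionsD(2)[OF t]]
    by (auto simp: centralizer_reflection_def central_torsion_def intro!: centralizer_subgroup)
  have "(fst (L t) #> \<one>) <#> (fst t #> g) = fst (L t) #> (\<one> \<otimes> g)"
    by (rule coset_product[OF C sectionsD(1)[OF t] g one_closed])
      (simp add: conj_set_one subgroup.subset[OF sectionsD(1)[OF t]] le_reflection[OF t])
  then show ?thesis using g by (simp add: subgroup.subset[OF C])
qed

text \<open>
  Every arrow from \<open>s\<close> to a section \<open>(C\<^sub>G(E), E)\<close> factors uniquely through the unit from \<open>s\<close> to \<open>L s\<close>: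
  if \<open>g\<close> represents it, then \<open>g\<^sup>-\<^sup>1 E g\<close> is elementary abelian, lies in \<open>snd s\<close> and is centralized by
  \<open>fst s\<close>, so it is contained in \<open>\<Omega> s\<close>.  In the equational form below, the coset representatives
  are simply multiplied.
\<close>

theorem centralizer_sections_reflective:
  "reflective_subcat (section_orbit_cat G \<N>) \<Z> L (\<lambda>t a. fst (L t) <#> a) (\<lambda>s. fst (L s) #> \<one>)"
proof -
  have sec: "s \<in> sections G" if "s \<in> \<N>" for s using nontrivial_sections that by blast
  have LN: "L s \<in> \<N>" if "s \<in> \<N>" for s
    using reflection_centralizer_section[OF that] centralizer_sections_nontrivial by blast
  have LL: "L (L s) = L s" if "s \<in> \<N>" for s by (rule reflection_id[OF reflection_centralizer_section[OF that]])
  have sub: "subgroup (fst s) G" if "s \<in> \<N>" for s by (rule sectionsD(1)[OF sec[OF that]])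
  note subL = sub[OF LN]
  note ref = reflection_on_coset[OF sec]
  have conj1: "conj_set G \<one> (fst s) = fst s" "conj_set G \<one> (snd s) = snd s" if "s \<in> \<N>" for s
    using sectionsD(1,2)[OF sec[OF that]] subgroup.subset by (auto intro!: conj_set_one)
  let ?C = "section_orbit_cat G \<N>"
  have HomE: "\<exists>g\<in>carrier G. a = fst y #> g \<and> snd (L y) \<subseteq> conj_set G g (snd (L x)) \<and>
      conj_set G g (fst (L x)) \<subseteq> fst (L y) \<and> conj_set G g (fst x) \<subseteq> fst y"
    if x: "x \<in> \<N>" and y: "y \<in> \<N>" and a: "a \<in> Hom ?C x y" for x y a
  proof -
    obtain g where g: "g \<in> carrier G" "a = fst y #> g" "snd y \<subseteq> conj_set G g (snd x)" "conj_set G g (fst x) \<subseteq> fst y"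
      using orbit_cat_HomE[OF a sec[OF x]] .
    with reflection_arrow[OF sec[OF x] sec[OF y] g(1,3,4)] show ?thesis by blast
  qed
  show ?thesis
  proof (unfold_locales, unfold orbit_cat_simps)
    show "\<Z> \<subseteq> \<N>" by (rule centralizer_sections_nontrivial)
    show "L x \<in> \<Z>" if "x \<in> \<N>" for x using reflection_centralizer_section[OF that] .
    show "L x = x" if "x \<in> \<Z>" for x using reflection_id[OF that] .
    show "fst (L x) <#> (fst x #> \<one>) = fst (L x) #> \<one>" if "x \<in> \<N>" for x
      using ref[OF that] by simp
    show "fst (L x) #> \<one> = fst x #> \<one>" if "x \<in> \<Z>" for x using reflection_id[OF that] by simp
    show "fst (L (L x)) <#> (fst (L x) #> \<one>) = fst (L x) #> \<one>" if "x \<in> \<N>" for x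
      using ref[OF LN[OF that]] LL[OF that] by simp
    show "fst (L x) #> \<one> \<in> Hom ?C x (L x)" if x: "x \<in> \<N>" for x
      using orbit_cat_HomI[OF sec[OF x] one_closed] le_reflection[OF sec[OF x]] conj1[OF x] by simp
  next
    fix x y a assume x: "x \<in> \<N>" and y: "y \<in> \<N>" and a: "a \<in> Hom ?C x y"
    obtain g where g: "g \<in> carrier G" "a = fst y #> g" "snd (L y) \<subseteq> conj_set G g (snd (L x))"
      "conj_set G g (fst (L x)) \<subseteq> fst (L y)" using HomE[OF x y a] by blast
    show "fst (L y) <#> a \<in> Hom ?C (L x) (L y)"
      unfolding g(2) ref[OF y g(1)] by (rule orbit_cat_HomI[OF sec[OF LN[OF x]] g(1,3,4)])
    have "(fst (L y) #> \<one>) <#> a = fst (L y) #> g"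
      using coset_product[OF subL[OF y] sub[OF y] g(1) one_closed] conj1[OF y] le_reflection[OF sec[OF y]] g
      by simp
    moreover have "(fst (L y) <#> a) <#> (fst (L x) #> \<one>) = fst (L y) #> g"
      unfolding g(2) ref[OF y g(1)]
      using coset_product[OF subL[OF y] subL[OF x] one_closed g(1,4)] g(1) by simp
    ultimately show "(fst (L y) #> \<one>) <#> a = (fst (L y) <#> a) <#> (fst (L x) #> \<one>)" by simp
  next
    fix x y z a b assume x: "x \<in> \<N>" and y: "y \<in> \<N>" and z: "z \<in> \<N>" and a: "a \<in> Hom ?C x y" and b: "b \<in> Hom ?C y z"
    obtain g where g: "g \<in> carrier G" "a = fst y #> g" using HomE[OF x y a] by blast
    obtain h where h: "h \<in> carrier G" "b = fst z #> h" "conj_set G h (fst (L y)) \<subseteq> fst (L z)"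
      "conj_set G h (fst y) \<subseteq> fst z" using HomE[OF y z b] by blast
    have ba: "b <#> a = fst z #> (h \<otimes> g)"
      unfolding g(2) h(2) by (rule coset_product[OF sub[OF z] sub[OF y] g(1) h(1,4)])
    have "fst (L z) <#> (b <#> a) = fst (L z) #> (h \<otimes> g)"
      unfolding ba by (rule ref[OF z]) (simp add: g h)
    also have "\<dots> = (fst (L z) <#> b) <#> (fst (L y) <#> a)"
      unfolding g(2) h(2) ref[OF y g(1)] ref[OF z h(1)]
      by (rule coset_product[OF subL[OF z] subL[OF y] g(1) h(1,3), symmetric])
    finally show "fst (L z) <#> (b <#> a) = (fst (L z) <#> b) <#> (fst (L y) <#> a)" .
  next
    fix x y a assume x: "x \<in> \<Z>" and y: "y \<in> \<Z>" and a: "a \<in> Hom ?C x y"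
    have xN: "x \<in> \<N>" and yN: "y \<in> \<N>" using x y centralizer_sections_nontrivial by auto
    obtain g where g: "g \<in> carrier G" "a = fst y #> g" using HomE[OF xN yN a] by blast
    show "fst (L y) <#> a = a" unfolding g(2) ref[OF yN g(1)] by (simp add: reflection_id[OF y])
  qed
qed

end

section \<open>Reduced cohomology\<close>

lemma section_orbit_cat_full_subcat:
  "section_orbit_cat G \<D> = full_subcat (section_orbit_cat G \<C>) \<D>"
  by (simp add: section_orbit_cat_def full_subcat_def)

lemma (in group) top_section: "top_section G \<in> sections G"
  using subgroup_self triv_subgroup one_is_normal
  by (simp add: top_section_def sections_def)

text \<open>
  The only right coset of \<open>G\<close> in itself is \<open>G\<close>, so the section \<open>(G, 1)\<close> is a terminal object.
\<close>

lemma (in group) top_arrow: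
  assumes s: "s \<in> sections G"
  shows "carrier G #> \<one> \<in> Hom (section_orbit_cat G \<C>) s (top_section G)"
    and "t \<in> sections G \<Longrightarrow> a \<in> Hom (section_orbit_cat G \<C>) s t \<Longrightarrow> (carrier G #> \<one>) <#> a = carrier G #> \<one>"
proof -
  note sub = subgroup.subset[OF sectionsD(1)[OF s]] subgroup.subset[OF sectionsD(2)[OF s]]
  show "carrier G #> \<one> \<in> Hom (section_orbit_cat G \<C>) s (top_section G)"
    using orbit_cat_HomI[OF s one_closed, of "top_section G"] subgroup.one_closed[OF sectionsD(2)[OF s]]
    by (simp add: top_section_def conj_set_one sub)
  assume t: "t \<in> sections G" and a: "a \<in> Hom (section_orbit_cat G \<C>) s t"
  obtain g where g: "g \<in> carrier G" "a = fst t #> g" using orbit_cat_HomE[OF a s] .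
  note tc = subgroup.subset[OF sectionsD(1)[OF t]]
  have "(carrier G #> \<one>) <#> a = carrier G #> (\<one> \<otimes> g)"
    unfolding g(2) using tc by (intro coset_product[OF subgroup_self sectionsD(1)[OF t] g(1) one_closed]) (simp add: conj_set_one)
  then show "(carrier G #> \<one>) <#> a = carrier G #> \<one>"
    using g(1) coset_join2[OF _ subgroup_self] by simp
qed

context finite_p_group
begin

context
  fixes R :: "('r, 's) ring_scheme" and F :: "('g section_pair, 'g set, 'r, 'm) cfunctor"
  assumes R: "cring R" and F: "cat_module (section_orbit_cat G (sections G)) R F"
begin

interpretation reflective_subcat "section_orbit_cat G \<N>" \<Z> L "\<lambda>t a. fst (L t) <#> a" "\<lambda>s. fst (L s) #> \<one>"
  by (rule centralizer_sections_reflective)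

lemma cat_module_collection: "\<C> \<subseteq> sections G \<Longrightarrow> cat_module (section_orbit_cat G \<C>) R F"
  using full_subcat_cat_module[OF _ F, of \<C>] by (simp add: section_orbit_cat_full_subcat[of G \<C> "sections G"])

lemma nontrivial_subset: "\<N> \<subseteq> sections G" using nontrivial_sections by blast

lemma F_nontrivial: "cat_module (section_orbit_cat G \<N>) R F"
  by (rule cat_module_collection[OF nontrivial_subset])

lemma centralizer_orbit_cat: "section_orbit_cat G \<Z> = C'"
  by (rule section_orbit_cat_full_subcat)

lemma augmentation_factors:
  assumes s: "s \<in> sections G" and t: "t \<in> sections G" and a: "a \<in> Hom (section_orbit_cat G \<N>) s t"
    and u: "u \<in> carrier (val F (top_section G))"
  shows "res F s t a (res F t (top_section G) (carrier G #> \<one>) u) = res F s (top_section G) (carrier G #> \<one>) u"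
proof -
  have Hom: "Hom (section_orbit_cat G \<N>) = Hom (section_orbit_cat G (sections G))"
    by (simp add: section_orbit_cat_def)
  show ?thesis
    using cat_moduleD(5)[OF F, of s t "top_section G" a "carrier G #> \<one>" u] s t a u top_section
      top_arrow(1)[OF t, of "sections G"] top_arrow(2)[OF s t a]
    by (simp add: Hom)
qed

lemma augmentation_component_hom:
  assumes s: "s \<in> sections G"
  shows "res F s (top_section G) (carrier G #> \<one>) \<in> mod_hom R (val F (top_section G)) (val F s)"
  using cat_moduleD(3)[OF F, of s "top_section G"] s top_section top_arrow(1)[OF s] by simp

text \<open>
  The arrow from \<open>s\<close> to \<open>(G, 1)\<close> factors through \<open>L s\<close>, so an element that restricts to \<open>0\<close> on all
  centralizer sections restricts to \<open>0\<close> everywhere.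
\<close>

lemma reduced_cohomology_minus1_eq:
  "reduced_cohomology_minus1 G \<N> F = reduced_cohomology_minus1 G \<Z> F"
proof -
  let ?\<tau> = "\<lambda>s. res F s (top_section G) (carrier G #> \<one>)"
  have "(\<forall>s\<in>\<N>. ?\<tau> s u = \<zero>\<^bsub>val F s\<^esub>) \<longleftrightarrow> (\<forall>s\<in>\<Z>. ?\<tau> s u = \<zero>\<^bsub>val F s\<^esub>)"
    if u: "u \<in> carrier (val F (top_section G))" for u
  proof
    assume z: "\<forall>s\<in>\<Z>. ?\<tau> s u = \<zero>\<^bsub>val F s\<^esub>"
    show "\<forall>s\<in>\<N>. ?\<tau> s u = \<zero>\<^bsub>val F s\<^esub>"
    proof
      fix s assume s: "s \<in> \<N>"
      have Ls: "L s \<in> \<N>" using L_Obj[of s] s by simp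
      have \<eta>: "fst (L s) #> \<one> \<in> Hom (section_orbit_cat G \<N>) s (L s)" using \<eta>_Hom[of s] s by simp
      have "?\<tau> s u = res F s (L s) (fst (L s) #> \<one>) (?\<tau> (L s) u)"
        using augmentation_factors[OF subsetD[OF nontrivial_subset s] subsetD[OF nontrivial_subset Ls] \<eta> u] by simp
      also have "?\<tau> (L s) u = \<zero>\<^bsub>val F (L s)\<^esub>" using z L_closed[of s] s by simp
      also have "res F s (L s) (fst (L s) #> \<one>) \<zero>\<^bsub>val F (L s)\<^esub> = \<zero>\<^bsub>val F s\<^esub>"
        using s Ls \<eta>
        by (intro mod_hom_zero[of R] cat_moduleD(1)[OF F_nontrivial] cat_moduleD(3)[OF F_nontrivial]) simp_all
      finally show "?\<tau> s u = \<zero>\<^bsub>val F s\<^esub>" .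
    qed
  qed (use D in auto)
  then have "mod_kernel (val F (top_section G)) (cat_lim (section_orbit_cat G \<N>) F) (augmentation G \<N> F) =
      mod_kernel (val F (top_section G)) (cat_lim (section_orbit_cat G \<Z>) F) (augmentation G \<Z> F)"
    unfolding mod_kernel_def augmentation_def cat_lim_simps orbit_cat_simps restrict_eq_iff
    by (intro Collect_cong conj_cong refl)
  then show ?thesis by (simp add: reduced_cohomology_minus1_def)
qed

lemma augmentation_mod_hom:
  "augmentation G \<N> F \<in> mod_hom R (val F (top_section G)) (cat_lim (section_orbit_cat G \<N>) F)"
proof (rule mod_homI)
  note sec = subsetD[OF nontrivial_subset]
  note c = augmentation_component_hom[OF sec]
  fix u assume u: "u \<in> carrier (val F (top_section G))"
  show "augmentation G \<N> F u \<in> carrier (cat_lim (section_orbit_cat G \<N>) F)"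
    by (simp add: augmentation_def mod_hom_closed[OF c u] augmentation_factors[OF sec sec _ u] del: coset_mult_one)
  show "augmentation G \<N> F (u \<oplus>\<^bsub>val F (top_section G)\<^esub> v) =
      augmentation G \<N> F u \<oplus>\<^bsub>cat_lim (section_orbit_cat G \<N>) F\<^esub> augmentation G \<N> F v"
    if "v \<in> carrier (val F (top_section G))" for v
    using u that by (simp add: augmentation_def mod_hom_add[OF c] restrict_eq_iff del: coset_mult_one)
  show "augmentation G \<N> F (r \<odot>\<^bsub>val F (top_section G)\<^esub> u) =
      r \<odot>\<^bsub>cat_lim (section_orbit_cat G \<N>) F\<^esub> augmentation G \<N> F u" if "r \<in> carrier R" for r
    using u that by (simp add: augmentation_def mod_hom_smult[OF c] restrict_eq_iff del: coset_mult_one)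
qed

lemma reduced_cohomology_0_iso:
  "mod_iso R (reduced_cohomology_0 G \<N> F) (reduced_cohomology_0 G \<Z> F)"
proof -
  have "augmentation G \<Z> F = (\<lambda>u. restrict (augmentation G \<N> F u) \<Z>)"
    using D by (auto simp: augmentation_def fun_eq_iff)
  then have img: "augmentation G \<Z> F ` X = (\<lambda>s. restrict s \<Z>) ` augmentation G \<N> F ` X" for X
    by (simp add: image_image)
  have "submodule (augmentation G \<N> F ` carrier (val F (top_section G))) R (cat_lim (section_orbit_cat G \<N>) F)"
    using top_section
    by (intro submodule_image[OF cat_moduleD(1)[OF F] cat_lim_module[OF R F_nontrivial] augmentation_mod_hom]) simp
  from cat_lim_quotient_iso[OF R F_nontrivial this] show ?thesis
    by (simp add: reduced_cohomology_0_def centralizer_orbit_cat img)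
qed

lemma reduced_cohomology_pos_iso:
  "n \<ge> 1 \<Longrightarrow> mod_iso R (reduced_cohomology_pos G R \<N> n F) (reduced_cohomology_pos G R \<Z> n F)"
  using Ext_reflective_iso[OF orbit_cat_finite_cat[OF finite_carrier nontrivial_subset] R F_nontrivial]
  by (simp add: reduced_cohomology_pos_def centralizer_orbit_cat)

end

end

theorem proposition5p1:
  fixes R :: "('r, 's) ring_scheme"
    and G :: "('g, 'h) monoid_scheme"
    and p :: nat
    and F :: "('g section_pair, 'g set, 'r, 'm) cfunctor"
  assumes "cring R"
    and "Factorial_Ring.prime p"
    and "group G" and "finite (carrier G)" and "\<exists>k. order G = p ^ k"
    and "cat_module (section_orbit_cat G (sections G)) R F"
  shows "mod_iso R
           (reduced_cohomology_minus1 G (nontrivial_sections G) F)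
           (reduced_cohomology_minus1 G (centralizer_sections p G) F) \<and>
         mod_iso R
           (reduced_cohomology_0 G (nontrivial_sections G) F)
           (reduced_cohomology_0 G (centralizer_sections p G) F) \<and>
         (\<forall>n\<ge>1. mod_iso R
           (reduced_cohomology_pos G R (nontrivial_sections G) n F)
           (reduced_cohomology_pos G R (centralizer_sections p G) n F))"
proof -
  obtain k where "order G = p ^ k" using assms(5) ..
  then interpret finite_p_group G p k
    using assms(2-4) by (simp add: finite_p_group_def finite_p_group_axioms_def)
  have "mod_iso R M M" for M :: "('r, 'm) module"
    unfolding mod_iso_def by (intro bexI[where x = "\<lambda>u. u"]) (auto simp: mod_hom_def bij_betw_def)
  then show ?thesis
    using reduced_cohomology_minus1_eq[OF assms(1,6)] reduced_cohomology_0_iso[OF assms(1,6)]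
      reduced_cohomology_pos_iso[OF assms(1,6)]
    by simp
qed

end
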